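(* Let $n\ge3$ and let $b$ be a divergence-free vector field in $\mathbb{R}^n$ that is locally Lipschitz and satisfies $b\in L^q(\mathbb{R}^n)\cap L^2(\mathbb{R}^n)$, where $q>\frac n2$. Then for every $x\in\mathbb{R}^n$ the strong solution to $$dX_t=dB_t+b(X_t)\,dt,\qquad X_0=x,$$ is conservative.
   Context: $B$ is a standard Brownian motion in $\mathbb{R}^n$. Since $b$ is locally Lipschitz, the equation has a unique strong solution up to its explosion time. The solution is conservative if its explosion time is infinite almost surely. *)

theory Defs
  imports "HOL-Probability.Probability"
begin

text \<open>Brownian motion in \<open>\<real>\<^sup>n\<close> started at 0. The increment over an interval \<open>[s, t]\<close> has
  law \<open>N(0, (t - s) I)\<close>; the paths are only required to be continuous almost surely.\<close>

locale brownian_motion = prob_space M for M :: "'a measure" +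
  fixes B :: "real \<Rightarrow> 'a \<Rightarrow> real ^ 'n"
  assumes measurable_B: "\<And>t. 0 \<le> t \<Longrightarrow> B t \<in> borel_measurable M"
    and start: "AE \<omega> in M. B 0 \<omega> = 0"
    and continuous_paths: "AE \<omega> in M. continuous_on {0..} (\<lambda>t. B t \<omega>)"
    and increments_normal: "\<And>s t. 0 \<le> s \<Longrightarrow> s < t \<Longrightarrow>
      distributed M lborel (\<lambda>\<omega>. B t \<omega> - B s \<omega>)
        (\<lambda>y. ennreal (\<Prod>i\<in>UNIV. normal_density 0 (sqrt (t - s)) (y $ i)))"
    and increments_indep: "\<And>(t :: nat \<Rightarrow> real) k. 0 \<le> t 0 \<Longrightarrow> incseq t \<Longrightarrow>
      indep_vars (\<lambda>_. borel) (\<lambda>i \<omega>. B (t (Suc i)) \<omega> - B (t i) \<omega>) {..<k}"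

text \<open>The filtration generated by \<open>B\<close>, augmented by the null sets of \<open>M\<close>.\<close>

definition augmented_filtration ::
    "'a measure \<Rightarrow> (real \<Rightarrow> 'a \<Rightarrow> real ^ 'n) \<Rightarrow> real \<Rightarrow> 'a measure" where
  "augmented_filtration M B t = sigma (space M)
     ({B s -` A \<inter> space M | s A. s \<in> {0..t} \<and> A \<in> sets borel} \<union> null_sets M)"

text \<open>\<open>X\<close> is a strong solution of \<open>dX = dB + b(X) dt\<close>, \<open>X\<^sub>0 = x\<close>, with explosion time \<open>\<zeta>\<close>.
  Only the values \<open>X t \<omega>\<close> with \<open>0 \<le> t < \<zeta> \<omega>\<close> matter. The measurability clause says that \<open>\<zeta>\<close>
  is a stopping time (take \<open>A = UNIV\<close>) and that \<open>X\<close> is adapted before \<open>\<zeta>\<close>. The last clause says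
  that a finite \<open>\<zeta>\<close> is a genuine explosion, so that the solution is maximal.\<close>

definition strong_solution ::
    "'a measure \<Rightarrow> (real \<Rightarrow> 'a \<Rightarrow> real ^ 'n) \<Rightarrow> (real ^ 'n \<Rightarrow> real ^ 'n) \<Rightarrow> real ^ 'n \<Rightarrow>
     (real \<Rightarrow> 'a \<Rightarrow> real ^ 'n) \<Rightarrow> ('a \<Rightarrow> ereal) \<Rightarrow> bool" where
  "strong_solution M B b x X \<zeta> \<longleftrightarrow>
     (\<forall>t\<ge>0. \<forall>A\<in>sets borel.
        {\<omega> \<in> space M. ereal t < \<zeta> \<omega> \<and> X t \<omega> \<in> A} \<in> sets (augmented_filtration M B t)) \<and>
     (AE \<omega> in M.
        0 < \<zeta> \<omega> \<and>
        X 0 \<omega> = x \<and>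
        continuous_on {t. 0 \<le> t \<and> ereal t < \<zeta> \<omega>} (\<lambda>t. X t \<omega>) \<and>
        (\<forall>t. 0 \<le> t \<and> ereal t < \<zeta> \<omega> \<longrightarrow>
           X t \<omega> = x + B t \<omega> + integral {0..t} (\<lambda>s. b (X s \<omega>))) \<and>
        (\<zeta> \<omega> < \<infinity> \<longrightarrow>
           filterlim (\<lambda>t. norm (X t \<omega>)) at_top (at_left (real_of_ereal (\<zeta> \<omega>)))))"

definition conservative :: "'a measure \<Rightarrow> ('a \<Rightarrow> ereal) \<Rightarrow> bool" where
  "conservative M \<zeta> \<longleftrightarrow> (AE \<omega> in M. \<zeta> \<omega> = \<infinity>)"

definition locally_lipschitz :: "(real ^ 'n \<Rightarrow> real ^ 'n) \<Rightarrow> bool" where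
  "locally_lipschitz b \<longleftrightarrow> (\<forall>x. \<exists>u>0. \<exists>L. L-lipschitz_on (cball x u) b)"

primrec cont_differentiable :: "nat \<Rightarrow> (real ^ 'n \<Rightarrow> real) \<Rightarrow> bool" where
  "cont_differentiable 0 f \<longleftrightarrow> continuous_on UNIV f"
| "cont_differentiable (Suc k) f \<longleftrightarrow> (\<forall>x. f differentiable (at x)) \<and>
     (\<forall>i\<in>Basis. cont_differentiable k (\<lambda>x. frechet_derivative f (at x) i))"

definition test_function :: "(real ^ 'n \<Rightarrow> real) \<Rightarrow> bool" where
  "test_function \<phi> \<longleftrightarrow> (\<forall>k. cont_differentiable k \<phi>) \<and> compact (closure {x. \<phi> x \<noteq> 0})"

text \<open>Divergence in the sense of distributions, since a locally Lipschitz field need not be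
  differentiable everywhere. The integrand is \<open>b \<bullet> \<nabla>\<phi>\<close>.\<close>

definition divergence_free :: "(real ^ 'n \<Rightarrow> real ^ 'n) \<Rightarrow> bool" where
  "divergence_free b \<longleftrightarrow>
     (\<forall>\<phi>. test_function \<phi> \<longrightarrow> (LINT x|lborel. frechet_derivative \<phi> (at x) (b x)) = 0)"

definition in_Lp :: "ereal \<Rightarrow> (real ^ 'n \<Rightarrow> real ^ 'n) \<Rightarrow> bool" where
  "in_Lp p f \<longleftrightarrow> f \<in> borel_measurable lborel \<and>
     (if p = \<infinity> then \<exists>C. AE x in lborel. norm (f x) \<le> C
      else integrable lborel (\<lambda>x. norm (f x) powr real_of_ereal p))"

end

theory Submission
  imports Defs
begin

text \<open>For a fixed Brownian path the equation is an ODE with a divergence-free time-dependent field,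
  so its flow preserves Lebesgue measure. Hence the time integral of \<open>\<bar>b(X)\<bar>\<^sup>2\<close> up to explosion,
  integrated over initial points with respect to a bounded density, is at most a constant times
  \<open>\<parallel>b\<parallel>\<^sub>2\<^sup>2\<close>; wherever it is finite, \<open>X\<close> stays bounded up to the explosion time. A fixed initial point
  is reduced to this case by a Cameron--Martin shift of the noise on a short interval \<open>[0, t]\<close>: the
  shift in direction \<open>z\<close> moves \<open>X\<^sub>t\<close> by a map of \<open>z\<close> with Lipschitz inverse, so that averaging over
  \<open>z\<close> produces a bounded density. Everything is carried out for the Euler scheme of a truncated
  field, whose divergence is compensated by killing, and Fatou's lemma passes to the limit.\<close>

subsection \<open>Test functions and mollification\<close>

text \<open>The truncation radius \<open>R\<close> has to tend to infinity, so no constant in the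
  final bound may depend on it. Three choices secure this. The shift interval [0, t] must be short
  compared with the Lipschitz constant of the drift, so on it the scheme runs with a separate field
  \<open>a\<close> that has to agree with \<open>b\<close> only on the unit ball about
  \<open>x\<close>. After time \<open>t\<close>, the Lipschitz and sup bounds of the truncated field
  decide only how fine the mesh must be, and the mesh goes to 0 before \<open>R\<close> goes to
  infinity. The killing rate vanishes on the ball of radius \<open>R\<close>, so it is not felt
  along a path that stays inside. The Euler scheme keeps the probability finite-dimensional: what is
  integrated is a function of finitely many Gaussian increments, and \<open>X\<close> is compared
  with it path by path, without building a flow. The square of |b| controls the displacement because
  |b| \<le> 1 + |b|^2: over a finite time the drift moves \<open>X\<close> by at most that time plus
  the integral of |b(X)|^2.\<close>

lemma cont_differentiable_Suc_imp:
  fixes f :: "real ^ 'n \<Rightarrow> real"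
  shows "cont_differentiable (Suc k) f \<Longrightarrow> cont_differentiable k f"
proof (induction k arbitrary: f)
  case 0
  then have "\<And>x. isCont f x"
    by (auto simp only: cont_differentiable.simps intro: differentiable_imp_continuous_within)
  then have "continuous_on UNIV f"
    by (intro continuous_at_imp_continuous_on) blast
  then show ?case by simp
next
  case (Suc k)
  from Suc.prems have "\<forall>x. f differentiable (at x)"
    "\<forall>i\<in>Basis. cont_differentiable (Suc k) (\<lambda>x. frechet_derivative f (at x) i)"
    unfolding cont_differentiable.simps(2)[of "Suc k" f] by blast+
  then show ?case
    unfolding cont_differentiable.simps(2)[of k f] using Suc.IH by blast
qed

lemma cont_differentiable_const: "cont_differentiable k (\<lambda>x :: real ^ 'n. c)"
  by (induction k arbitrary: c) auto

lemma cont_differentiable_inner_left: "cont_differentiable k (\<lambda>x :: real ^ 'n. x \<bullet> v)"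
proof (cases k)
  case (Suc j)
  have D: "((\<lambda>x :: real ^ 'n. x \<bullet> v) has_derivative (\<lambda>y. y \<bullet> v)) (at x)" for x
    by (auto intro!: derivative_eq_intros)
  have fd: "frechet_derivative (\<lambda>x :: real ^ 'n. x \<bullet> v) (at x) = (\<lambda>y. y \<bullet> v)" for x
    using frechet_derivative_at[OF D] by simp
  show ?thesis
    using D by (auto simp: Suc fd cont_differentiable_const differentiable_def)
qed (auto intro!: continuous_intros)

lemma cont_differentiable_add:
  fixes f g :: "real ^ 'n \<Rightarrow> real"
  shows "cont_differentiable k f \<Longrightarrow> cont_differentiable k g \<Longrightarrow>
    cont_differentiable k (\<lambda>x. f x + g x)"
proof (induction k arbitrary: f g)
  case 0
  then show ?case by (auto intro!: continuous_intros)
next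
  case (Suc k)
  have "frechet_derivative (\<lambda>x. f x + g x) (at x) =
      (\<lambda>v. frechet_derivative f (at x) v + frechet_derivative g (at x) v)" for x
    using Suc.prems
    by (intro frechet_derivative_at[symmetric] has_derivative_add)
       (auto simp: frechet_derivative_works[symmetric])
  with Suc show ?case by auto
qed

lemma cont_differentiable_mult:
  fixes f g :: "real ^ 'n \<Rightarrow> real"
  shows "cont_differentiable k f \<Longrightarrow> cont_differentiable k g \<Longrightarrow>
    cont_differentiable k (\<lambda>x. f x * g x)"
proof (induction k arbitrary: f g)
  case 0
  then show ?case by (auto intro!: continuous_intros)
next
  case (Suc k)
  have "frechet_derivative (\<lambda>x. f x * g x) (at x) =
      (\<lambda>v. f x * frechet_derivative g (at x) v + frechet_derivative f (at x) v * g x)" for x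
    using Suc.prems
    by (intro frechet_derivative_at[symmetric] has_derivative_mult)
       (auto simp: frechet_derivative_works[symmetric])
  moreover have "cont_differentiable k f" "cont_differentiable k g"
    using Suc.prems by (auto intro: cont_differentiable_Suc_imp)
  ultimately show ?case
    using Suc.prems by (auto intro!: Suc.IH cont_differentiable_add)
qed

lemma test_function_iff:
  fixes f :: "real ^ 'n \<Rightarrow> real"
  shows "test_function f \<longleftrightarrow>
    (\<forall>k. cont_differentiable k f) \<and> (\<exists>r. \<forall>x. r < norm x \<longrightarrow> f x = 0)"
proof -
  have "bounded {x. f x \<noteq> 0} \<longleftrightarrow> (\<exists>r. \<forall>x. r < norm x \<longrightarrow> f x = 0)"
    unfolding bounded_iff by (auto simp: not_le[symmetric])
  then show ?thesis
    by (auto simp: test_function_def)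
qed

lemma test_function_differentiable: "test_function f \<Longrightarrow> f differentiable (at x)"
  unfolding test_function_def by (metis cont_differentiable.simps(2))

lemma test_function_has_derivative:
  "test_function f \<Longrightarrow> (f has_derivative frechet_derivative f (at x)) (at x)"
  by (simp add: test_function_differentiable frechet_derivative_works[symmetric])

lemma test_function_continuous: "test_function f \<Longrightarrow> continuous_on UNIV f"
  unfolding test_function_def by (metis cont_differentiable.simps(1))

lemma test_function_mult:
  fixes f g :: "real ^ 'n \<Rightarrow> real"
  assumes "test_function f" "test_function g"
  shows "test_function (\<lambda>x. f x * g x)"
  using assms unfolding test_function_iff by (auto intro: cont_differentiable_mult)

lemma test_function_add:
  fixes f g :: "real ^ 'n \<Rightarrow> real"
  assumes "test_function f" "test_function g"
  shows "test_function (\<lambda>x. f x + g x)"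
proof -
  obtain r s where "\<forall>x. r < norm x \<longrightarrow> f x = 0" "\<forall>x. s < norm x \<longrightarrow> g x = 0"
    using assms unfolding test_function_iff by blast
  then have "\<forall>x. max r s < norm x \<longrightarrow> f x + g x = 0" by simp
  then show ?thesis
    using assms unfolding test_function_iff by (blast intro: cont_differentiable_add)
qed

lemma test_function_cmult:
  fixes f :: "real ^ 'n \<Rightarrow> real"
  assumes "test_function f"
  shows "test_function (\<lambda>x. c * f x)"
  using assms unfolding test_function_iff
  by (auto intro!: cont_differentiable_mult cont_differentiable_const)

lemma test_function_derivative_Basis:
  fixes f :: "real ^ 'n \<Rightarrow> real"
  assumes f: "test_function f" and i: "i \<in> Basis"
  shows "test_function (\<lambda>x. frechet_derivative f (at x) i)"
proof -
  obtain r where r: "\<And>x. r < norm x \<Longrightarrow> f x = 0"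
    using f unfolding test_function_iff by blast
  have "frechet_derivative f (at x) i = 0" if x: "r < norm x" for x
  proof -
    have "open {y. r < norm (y :: real ^ 'n)}"
      by (intro open_Collect_less continuous_intros)
    then have "(f has_derivative (\<lambda>_. 0)) (at x)"
      using x by (intro has_derivative_transform_within_open[OF has_derivative_const]) (auto simp: r)
    from frechet_derivative_at[OF this] show ?thesis by metis
  qed
  moreover have "cont_differentiable k (\<lambda>x. frechet_derivative f (at x) i)" for k
    using f i unfolding test_function_def by (metis cont_differentiable.simps(2))
  ultimately show ?thesis
    unfolding test_function_iff by blast
qed

lemma frechet_derivative_euclidean:
  fixes f :: "real ^ 'n \<Rightarrow> real"
  assumes "f differentiable (at x)"
  shows "frechet_derivative f (at x) v = (\<Sum>i\<in>Basis. (v \<bullet> i) * frechet_derivative f (at x) i)"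
proof -
  interpret linear "frechet_derivative f (at x)"
    by (rule linear_frechet_derivative[OF assms])
  have "frechet_derivative f (at x) v = frechet_derivative f (at x) (\<Sum>i\<in>Basis. (v \<bullet> i) *\<^sub>R i)"
    by (simp add: euclidean_representation)
  also have "\<dots> = (\<Sum>i\<in>Basis. (v \<bullet> i) * frechet_derivative f (at x) i)"
    by (simp add: sum scale)
  finally show ?thesis .
qed

lemma test_function_sum:
  fixes f :: "'i \<Rightarrow> real ^ 'n \<Rightarrow> real"
  assumes "finite I" "\<And>i. i \<in> I \<Longrightarrow> test_function (f i)"
  shows "test_function (\<lambda>x. \<Sum>i\<in>I. f i x)"
  using assms
proof (induction I)
  case empty
  have "\<forall>x :: real ^ 'n. 0 < norm x \<longrightarrow> (0::real) = 0" by simp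
  then show ?case
    unfolding test_function_iff by (auto simp: cont_differentiable_const)
qed (auto intro: test_function_add)

lemma test_function_derivative:
  fixes f :: "real ^ 'n \<Rightarrow> real"
  assumes f: "test_function f"
  shows "test_function (\<lambda>x. frechet_derivative f (at x) v)"
  unfolding frechet_derivative_euclidean[OF test_function_differentiable[OF f], of _ v]
  by (intro test_function_sum test_function_cmult test_function_derivative_Basis[OF f]) auto

lemma continuous_zero_outside_ball_bounded:
  fixes f :: "real ^ 'n \<Rightarrow> 'b :: real_normed_vector"
  assumes "continuous_on UNIV f" "\<And>x. r < norm x \<Longrightarrow> f x = 0"
  shows "\<exists>A\<ge>0. \<forall>x. norm (f x) \<le> A"
proof -
  have "compact (f ` cball 0 r)"
    by (intro compact_continuous_image continuous_on_subset[OF assms(1)]) auto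
  then obtain A where A: "\<And>x. x \<in> cball 0 r \<Longrightarrow> norm (f x) \<le> A"
    using compact_imp_bounded[of "f ` cball 0 r"] unfolding bounded_iff by blast
  have "norm (f x) \<le> max A 0" for x
    using A[of x] assms(2)[of x] by (cases "r < norm x") auto
  then show ?thesis by (intro exI[of _ "max A 0"]) auto
qed

lemma test_function_bounded:
  fixes f :: "real ^ 'n \<Rightarrow> real"
  assumes "test_function f"
  shows "\<exists>A\<ge>0. \<forall>x. \<bar>f x\<bar> \<le> A"
  using assms continuous_zero_outside_ball_bounded[of f] test_function_continuous[OF assms]
  unfolding test_function_iff by auto

lemma test_function_derivative_le:
  fixes f :: "real ^ 'n \<Rightarrow> real"
  assumes f: "test_function f"
  shows "\<exists>A\<ge>0. \<forall>x v. \<bar>frechet_derivative f (at x) v\<bar> \<le> A * norm v"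
proof -
  have "\<forall>i\<in>Basis. \<exists>A\<ge>0. \<forall>x. \<bar>frechet_derivative f (at x) i\<bar> \<le> A"
    using test_function_bounded[OF test_function_derivative_Basis[OF f]] by auto
  then obtain A where A: "\<And>i. i \<in> Basis \<Longrightarrow> 0 \<le> A i"
      "\<And>i x. i \<in> Basis \<Longrightarrow> \<bar>frechet_derivative f (at x) i\<bar> \<le> A i"
    by metis
  have "\<bar>frechet_derivative f (at x) v\<bar> \<le> (\<Sum>i\<in>Basis. A i) * norm v" for x v
  proof -
    have "\<bar>frechet_derivative f (at x) v\<bar> \<le> (\<Sum>i\<in>Basis. \<bar>(v \<bullet> i) * frechet_derivative f (at x) i\<bar>)"
      unfolding frechet_derivative_euclidean[OF test_function_differentiable[OF f], of _ v]
      by (rule sum_abs)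
    also have "\<dots> \<le> (\<Sum>i\<in>Basis. norm v * A i)"
      by (intro sum_mono) (auto simp: abs_mult Basis_le_norm intro!: mult_mono A)
    also have "\<dots> = (\<Sum>i\<in>Basis. A i) * norm v"
      by (simp add: sum_distrib_right mult.commute[of "norm v"])
    finally show ?thesis .
  qed
  then show ?thesis using A(1) by (intro exI[of _ "\<Sum>i\<in>Basis. A i"]) (auto intro: sum_nonneg)
qed

lemma test_function_lipschitz:
  fixes f :: "real ^ 'n \<Rightarrow> real"
  assumes f: "test_function f"
  shows "\<exists>K\<ge>0. \<forall>x y. \<bar>f x - f y\<bar> \<le> K * norm (x - y)"
proof -
  obtain A where A: "A \<ge> 0" "\<And>x v. \<bar>frechet_derivative f (at x) v\<bar> \<le> A * norm v"
    using test_function_derivative_le[OF f] by auto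
  have "norm (f x - f y) \<le> A * norm (x - y)" for x y
    using test_function_has_derivative[OF f]
    by (intro differentiable_bound[of UNIV f "\<lambda>x. frechet_derivative f (at x)"])
       (auto intro!: onorm_bound A simp: has_derivative_at_withinI)
  then show ?thesis using A(1) by auto
qed

lemma test_function_derivative_lipschitz:
  fixes f :: "real ^ 'n \<Rightarrow> real"
  assumes f: "test_function f"
  shows "\<exists>K\<ge>0. \<forall>x y v. \<bar>frechet_derivative f (at x) v - frechet_derivative f (at y) v\<bar>
    \<le> K * norm (x - y) * norm v"
proof -
  have "\<forall>i\<in>Basis. \<exists>K\<ge>0. \<forall>x y. \<bar>frechet_derivative f (at x) i - frechet_derivative f (at y) i\<bar>
      \<le> K * norm (x - y)"
    using test_function_lipschitz[OF test_function_derivative_Basis[OF f]] by auto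
  then obtain K where K: "\<And>i. i \<in> Basis \<Longrightarrow> 0 \<le> K i"
      "\<And>i x y. i \<in> Basis \<Longrightarrow> \<bar>frechet_derivative f (at x) i - frechet_derivative f (at y) i\<bar>
        \<le> K i * norm (x - y)"
    by metis
  let ?K = "\<Sum>i\<in>Basis. K i"
  have lip: "\<bar>frechet_derivative f (at x) v - frechet_derivative f (at y) v\<bar>
      \<le> ?K * norm (x - y) * norm v" for x y v
  proof -
    have "\<bar>frechet_derivative f (at x) v - frechet_derivative f (at y) v\<bar> \<le>
        (\<Sum>i\<in>Basis. \<bar>(v \<bullet> i) * (frechet_derivative f (at x) i - frechet_derivative f (at y) i)\<bar>)"
      unfolding frechet_derivative_euclidean[OF test_function_differentiable[OF f], of _ v]
        sum_subtractf[symmetric] right_diff_distrib[symmetric]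
      by (rule sum_abs)
    also have "\<dots> \<le> (\<Sum>i\<in>Basis. norm v * (K i * norm (x - y)))"
      by (intro sum_mono) (auto simp: abs_mult Basis_le_norm intro!: mult_mono K)
    also have "\<dots> = ?K * norm (x - y) * norm v"
      by (simp add: sum_distrib_left[symmetric] sum_distrib_right[symmetric])
    finally show ?thesis .
  qed
  then show ?thesis using K(1) by (intro exI[of _ ?K]) (auto intro: sum_nonneg)
qed

text \<open>Mean value inequality on \<open>cball x (norm v)\<close> for \<open>f\<close> minus its
  derivative at \<open>x\<close>: the derivative of this difference has norm at most
  \<open>K * norm v\<close> there. The uniform \<open>K\<close> later makes the linearisation error
  of an Euler step quadratic in the step size.\<close>

lemma test_function_taylor:
  fixes f :: "real ^ 'n \<Rightarrow> real"
  assumes f: "test_function f"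
  shows "\<exists>K\<ge>0. \<forall>x v. \<bar>f (x + v) - f x - frechet_derivative f (at x) v\<bar> \<le> K * (norm v)\<^sup>2"
proof -
  obtain K where K: "K \<ge> 0" and lip: "\<And>x y v. \<bar>frechet_derivative f (at x) v - frechet_derivative f (at y) v\<bar>
      \<le> K * norm (x - y) * norm v"
    using test_function_derivative_lipschitz[OF f] by blast
  have "\<bar>f (x + v) - f x - frechet_derivative f (at x) v\<bar> \<le> K * (norm v)\<^sup>2" for x v
  proof -
    let ?g = "\<lambda>y. f y - frechet_derivative f (at x) y"
    have bl: "bounded_linear (frechet_derivative f (at x))" for x
      using test_function_has_derivative[OF f] has_derivative_bounded_linear by blast
    have "norm (?g (x + v) - ?g x) \<le> K * norm v * norm (x + v - x)"
    proof (rule differentiable_bound[of "cball x (norm v)" ?g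
          "\<lambda>y w. frechet_derivative f (at y) w - frechet_derivative f (at x) w"])
      fix y assume "y \<in> cball x (norm v)"
      then have y: "norm (y - x) \<le> norm v" by (simp add: dist_norm norm_minus_commute)
      show "(?g has_derivative (\<lambda>w. frechet_derivative f (at y) w - frechet_derivative f (at x) w))
          (at y within cball x (norm v))"
        by (intro has_derivative_diff has_derivative_at_withinI[OF test_function_has_derivative[OF f]]
            bounded_linear_imp_has_derivative bl)
      show "onorm (\<lambda>w. frechet_derivative f (at y) w - frechet_derivative f (at x) w) \<le> K * norm v"
      proof (rule onorm_bound)
        show "0 \<le> K * norm v" using K by simp
        fix w :: "real ^ 'n"
        have "K * norm (y - x) * norm w \<le> K * norm v * norm w"
          using y K by (intro mult_right_mono mult_left_mono) auto
        then show "norm (frechet_derivative f (at y) w - frechet_derivative f (at x) w)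
            \<le> K * norm v * norm w"
          using lip[of y w x] by simp
      qed
    qed (auto simp: dist_norm)
    moreover have "?g (x + v) - ?g x = f (x + v) - f x - frechet_derivative f (at x) v"
      using linear_frechet_derivative[OF test_function_differentiable[OF f], of x]
      by (simp add: linear_add)
    ultimately show ?thesis by (simp add: power2_eq_square mult.assoc)
  qed
  then show ?thesis using K by blast
qed

section \<open>A smooth bump function and mollifiers\<close>

definition flat_exp :: "real poly \<Rightarrow> real \<Rightarrow> real" where
  "flat_exp p s = (if s > 0 then poly p (1 / s) * exp (- (1 / s)) else 0)"

lemma poly_mult_exp_tendsto_0: "((\<lambda>y. poly p y * exp (- y)) \<longlongrightarrow> (0::real)) at_top"
proof -
  have "((\<lambda>y. \<Sum>i\<le>degree p. coeff p i * (y ^ i * exp (- y))) \<longlongrightarrow> (\<Sum>i\<le>degree p. coeff p i * (0::real))) at_top"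
    using tendsto_power_div_exp_0
    by (intro tendsto_sum tendsto_mult tendsto_const) (simp add: exp_minus field_simps)
  then show ?thesis
    by (simp add: poly_altdef sum_distrib_right mult.assoc)
qed

text \<open>Differentiating p(1/s) exp(-1/s) gives s^(-2) (p - p')(1/s) exp(-1/s), again of the same
  form; this closure is why \<open>flat_exp\<close> carries a polynomial.\<close>

lemma flat_exp_has_field_derivative:
  "(flat_exp p has_field_derivative flat_exp ([:0, 0, 1:] * (p - pderiv p)) s) (at s)"
proof -
  consider "s > 0" | "s < 0" | "s = 0" by linarith
  then show ?thesis
  proof cases
    case 1
    have "((\<lambda>s. poly p (1 / s) * exp (- (1 / s))) has_field_derivative
        flat_exp ([:0, 0, 1:] * (p - pderiv p)) s) (at s)"
      using 1 by (auto intro!: derivative_eq_intros simp: flat_exp_def field_simps power2_eq_square)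
    then show ?thesis
      by (rule has_field_derivative_transform_within_open[where S = "{0<..}"])
        (use 1 in \<open>auto simp: flat_exp_def\<close>)
  next
    case 2
    have "((\<lambda>s. 0) has_field_derivative flat_exp ([:0, 0, 1:] * (p - pderiv p)) s) (at s)"
      using 2 by (auto simp: flat_exp_def)
    then show ?thesis
      by (rule has_field_derivative_transform_within_open[where S = "{..<0}"])
        (use 2 in \<open>auto simp: flat_exp_def\<close>)
  next
    case 3
    have "((\<lambda>h. flat_exp p h / h) \<longlongrightarrow> 0) (at_right 0)"
    proof -
      \<comment> \<open>With y = 1/h the difference quotient at 0 is y p(y) exp(-y); the factor
        \<open>[:0, 1:]\<close> is that y.\<close>
      have "((\<lambda>h. poly ([:0, 1:] * p) (inverse h) * exp (- (inverse h))) \<longlongrightarrow> 0) (at_right (0::real))"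
        using filterlim_inverse_at_top_right
        by (rule filterlim_compose[OF poly_mult_exp_tendsto_0])
      then show ?thesis
        by (rule Lim_transform_eventually)
          (auto simp: eventually_at flat_exp_def field_simps intro!: exI[of _ 1])
    qed
    moreover have "((\<lambda>h. flat_exp p h / h) \<longlongrightarrow> 0) (at_left 0)"
      by (rule Lim_transform_eventually[OF tendsto_const])
         (auto simp: eventually_at flat_exp_def intro!: exI[of _ 1])
    ultimately have "((\<lambda>h. flat_exp p h / h) \<longlongrightarrow> 0) (at 0)"
      by (simp add: filterlim_at_split)
    then show ?thesis
      using 3 by (simp add: DERIV_def flat_exp_def)
  qed
qed

text \<open>Each derivative is a member of the same family times a linear function, so the induction
  on \<open>k\<close> has to range over all \<open>p\<close>.\<close>

lemma cont_differentiable_flat_exp: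
  "cont_differentiable k (\<lambda>x :: real ^ 'n. flat_exp p (r - x \<bullet> x))"
proof (induction k arbitrary: p)
  case 0
  have "continuous_on UNIV (flat_exp p)"
    by (intro DERIV_continuous_on[OF has_field_derivative_at_within[OF flat_exp_has_field_derivative]])
  then show ?case
    by (auto intro!: continuous_intros continuous_on_compose2[of UNIV "flat_exp p"])
next
  case (Suc k)
  let ?q = "[:0, 0, 1:] * (p - pderiv p)"
  have D: "((\<lambda>x :: real ^ 'n. flat_exp p (r - x \<bullet> x)) has_derivative
      (\<lambda>v. flat_exp ?q (r - x \<bullet> x) * (- 2 * (x \<bullet> v)))) (at x)" for x
    by (rule has_derivative_eq_rhs[OF has_derivative_compose[of "\<lambda>x. r - x \<bullet> x" "\<lambda>v. - 2 * (x \<bullet> v)",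
          OF _ flat_exp_has_field_derivative[unfolded has_field_derivative_def]]])
       (auto intro!: derivative_eq_intros simp: inner_commute)
  have fd: "frechet_derivative (\<lambda>x :: real ^ 'n. flat_exp p (r - x \<bullet> x)) (at x) =
      (\<lambda>v. flat_exp ?q (r - x \<bullet> x) * (- 2 * (x \<bullet> v)))" for x
    using frechet_derivative_at[OF D] by simp
  show ?case
    unfolding cont_differentiable.simps fd
  proof (intro conjI allI ballI)
    show "(\<lambda>x :: real ^ 'n. flat_exp p (r - x \<bullet> x)) differentiable at x" for x
      using D by (auto simp: differentiable_def)
    show "cont_differentiable k (\<lambda>x :: real ^ 'n. flat_exp ?q (r - x \<bullet> x) * (- 2 * (x \<bullet> i)))" for i
      by (intro cont_differentiable_mult cont_differentiable_const cont_differentiable_inner_left Suc.IH)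
  qed
qed

lemma test_function_flat_exp:
  "test_function (\<lambda>x :: real ^ 'n. flat_exp p (e\<^sup>2 - x \<bullet> x))"
proof -
  have "flat_exp p (e\<^sup>2 - x \<bullet> x) = 0" if "\<bar>e\<bar> < norm x" for x :: "real ^ 'n"
    using power_strict_mono[OF that, of 2] by (simp add: flat_exp_def power2_norm_eq_inner)
  then show ?thesis
    by (auto simp: test_function_iff cont_differentiable_flat_exp)
qed

lemma integrable_continuous_zero_outside_cball:
  fixes f :: "real ^ 'n \<Rightarrow> real"
  assumes f: "continuous_on UNIV f" and z: "\<And>x. x \<notin> cball p r \<Longrightarrow> f x = 0"
  shows "integrable lborel f"
proof -
  have "integrable lborel (\<lambda>x. indicator (cball p r) x *\<^sub>R f x)"
    by (intro borel_integrable_compact continuous_on_subset[OF f]) auto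
  also have "(\<lambda>x. indicator (cball p r) x *\<^sub>R f x) = f"
    using z by (auto simp: indicator_def fun_eq_iff)
  finally show ?thesis .
qed

lemma test_function_integrable:
  fixes f :: "real ^ 'n \<Rightarrow> real"
  assumes f: "test_function f"
  shows "integrable lborel f"
proof -
  obtain r where "\<And>x. r < norm x \<Longrightarrow> f x = 0"
    using f unfolding test_function_iff by blast
  then show ?thesis
    by (intro integrable_continuous_zero_outside_cball[of f 0 r] test_function_continuous f) auto
qed

lemma mollifier_exists:
  fixes e :: real
  assumes e: "e > 0"
  obtains \<rho> :: "real ^ 'n \<Rightarrow> real" where
    "test_function \<rho>" "\<And>x. 0 \<le> \<rho> x" "\<And>x. e < norm x \<Longrightarrow> \<rho> x = 0" "(LINT x|lborel. \<rho> x) = 1"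
proof -
  let ?f = "\<lambda>x :: real ^ 'n. flat_exp 1 (e\<^sup>2 - x \<bullet> x)"
  let ?Z = "LINT x|lborel. ?f x"
  have nn: "0 \<le> ?f x" for x by (simp add: flat_exp_def)
  have int: "integrable lborel ?f" by (intro test_function_integrable test_function_flat_exp)
  \<comment> \<open>The bump is strictly positive on the ball of radius \<open>e\<close>, which has
    positive measure.\<close>
  have "?Z \<noteq> 0"
  proof
    assume "?Z = 0"
    then have "AE x in lborel. ?f x = 0"
      using integral_nonneg_eq_0_iff_AE[OF int] nn by auto
    then have "AE x in lborel. x \<notin> ball (0 :: real ^ 'n) e"
    proof eventually_elim
      case (elim x)
      have "e\<^sup>2 - x \<bullet> x > 0" if "norm x < e"
        using power_strict_mono[OF that, of 2] by (simp add: power2_norm_eq_inner)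
      then show ?case using elim by (auto simp: flat_exp_def)
    qed
    then have "emeasure lborel (ball (0 :: real ^ 'n) e) = 0"
      by (subst (asm) AE_iff_measurable[OF _ refl]) (auto simp: ball_def)
    then show False
      using e zero_less_power[OF e, of "CARD('n)"] unit_ball_vol_pos[OF of_nat_0_le_iff, of "CARD('n)"]
      by (simp add: emeasure_ball ennreal_eq_0_iff mult_le_0_iff del: unit_ball_vol_pos)
  qed
  moreover have "?Z \<ge> 0" by (intro integral_nonneg_AE) (auto simp: nn)
  ultimately have Z: "?Z > 0" by simp
  show thesis
  proof (rule that[of "\<lambda>x. (1 / ?Z) * ?f x"])
    show "test_function (\<lambda>x. (1 / ?Z) * ?f x)"
      by (intro test_function_cmult test_function_flat_exp)
    show "0 \<le> (1 / ?Z) * ?f x" for x using nn Z by simp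
    show "(1 / ?Z) * ?f x = 0" if "e < norm x" for x
      using power_strict_mono[OF that, of 2] e by (simp add: flat_exp_def power2_norm_eq_inner)
    show "(LINT x|lborel. (1 / ?Z) * ?f x) = 1" using Z by simp
  qed
qed

section \<open>Convolution with a test function\<close>

lemma integral_lborel_translate:
  fixes f :: "real ^ 'n \<Rightarrow> real"
  assumes "f \<in> borel_measurable borel"
  shows "(LINT x|lborel. f (x + t)) = (LINT x|lborel. f x)"
proof -
  have "(LINT x|lborel. f x) = (LINT x|distr lborel borel ((+) t). f x)"
    by (simp add: lborel_distr_plus)
  also have "\<dots> = (LINT x|lborel. f (x + t))"
    using assms by (subst integral_distr) (auto simp: add.commute)
  finally show ?thesis by simp
qed

lemma lborel_distr_reflect:
  fixes t :: "real ^ 'n"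
  shows "distr lborel borel (\<lambda>x. t - x) = lborel"
proof -
  show ?thesis
    using lborel_affine[of "- 1" t] by (simp add: density_1)
qed

lemma integral_lborel_reflect:
  fixes f :: "real ^ 'n \<Rightarrow> real"
  assumes "f \<in> borel_measurable borel"
  shows "(LINT x|lborel. f (t - x)) = (LINT x|lborel. f x)"
proof -
  have "(LINT x|lborel. f x) = (LINT x|distr lborel borel (\<lambda>x. t - x). f x)"
    by (simp add: lborel_distr_reflect)
  also have "\<dots> = (LINT x|lborel. f (t - x))"
    using assms by (subst integral_distr) auto
  finally show ?thesis by simp
qed

text \<open>The convolution of \<open>u\<close> with \<open>\<eta>\<close>. The shift sits in
  \<open>\<eta>\<close>, so that derivatives fall on \<open>\<eta>\<close> and \<open>u\<close> need
  only be integrable; \<open>mollify_commute\<close> provides the other form, in which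
  \<open>u\<close> is averaged.\<close>

definition mollify ::
    "(real ^ 'n \<Rightarrow> real) \<Rightarrow> (real ^ 'n \<Rightarrow> real) \<Rightarrow> real ^ 'n \<Rightarrow> real" where
  "mollify \<eta> u y = (LINT a|lborel. u a * \<eta> (y - a))"

lemma test_function_borel: "test_function f \<Longrightarrow> f \<in> borel_measurable borel"
  by (intro borel_measurable_continuous_onI test_function_continuous)

lemma mollify_commute:
  assumes [measurable]: "u \<in> borel_measurable borel" "\<eta> \<in> borel_measurable borel"
  shows "mollify \<eta> u y = (LINT a|lborel. \<eta> a * u (y - a))"
proof -
  have "(LINT a|lborel. u (y - a) * \<eta> (y - (y - a))) = mollify \<eta> u y"
    unfolding mollify_def
    by (intro integral_lborel_reflect[of "\<lambda>a. u a * \<eta> (y - a)" y]) simp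
  then show ?thesis by (simp add: mult.commute)
qed

lemma integrable_mollify:
  fixes u :: "real ^ 'n \<Rightarrow> real"
  assumes \<eta>: "test_function \<eta>" and u: "integrable lborel u"
  shows "integrable lborel (\<lambda>a. u a * \<eta> (y - a))"
proof -
  obtain A where A: "A \<ge> 0" "\<And>x. \<bar>\<eta> x\<bar> \<le> A"
    using test_function_bounded[OF \<eta>] by auto
  have [measurable]: "\<eta> \<in> borel_measurable borel" "u \<in> borel_measurable borel"
    using test_function_borel[OF \<eta>] borel_measurable_integrable[OF u] by auto
  show ?thesis
  proof (rule Bochner_Integration.integrable_bound)
    show "integrable lborel (\<lambda>a. u a * A)" using u by simp
    show "AE a in lborel. norm (u a * \<eta> (y - a)) \<le> norm (u a * A)"
      using A by (intro AE_I2) (auto simp: abs_mult intro!: mult_left_mono)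
  qed measurable
qed

text \<open>The Taylor estimate for \<open>\<eta>\<close>, integrated against \<open>u\<close>. The
  constant sees \<open>u\<close> only through its L1 norm, which makes the estimate uniform over all
  functions \<open>u\<close> that arise in the Euler iteration.\<close>

lemma mollify_taylor:
  fixes u :: "real ^ 'n \<Rightarrow> real"
  assumes \<eta>: "test_function \<eta>" and u: "integrable lborel u"
    and K: "\<And>x v. \<bar>\<eta> (x + v) - \<eta> x - frechet_derivative \<eta> (at x) v\<bar> \<le> K * (norm v)\<^sup>2"
  shows "\<bar>mollify \<eta> u (y + v) - mollify \<eta> u y
      - mollify (\<lambda>x. frechet_derivative \<eta> (at x) v) u y\<bar>
    \<le> K * (norm v)\<^sup>2 * (LINT a|lborel. \<bar>u a\<bar>)"
proof -
  let ?d = "\<lambda>a. \<eta> (y + v - a) - \<eta> (y - a) - frechet_derivative \<eta> (at (y - a)) v"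
  note int = integrable_mollify[OF \<eta> u]
    integrable_mollify[OF test_function_derivative[OF \<eta>] u]
  have "mollify \<eta> u (y + v) - mollify \<eta> u y
      - mollify (\<lambda>x. frechet_derivative \<eta> (at x) v) u y = (LINT a|lborel. u a * ?d a)"
    (is "?l = ?r") unfolding mollify_def by (simp add: int right_diff_distrib)
  then have "\<bar>?l\<bar> = \<bar>?r\<bar>" by simp
  also have "\<bar>?r\<bar> \<le> (LINT a|lborel. \<bar>u a * ?d a\<bar>)"
    by (rule integral_abs_bound)
  also have "\<dots> \<le> (LINT a|lborel. K * (norm v)\<^sup>2 * \<bar>u a\<bar>)"
  proof (rule integral_mono)
    show "integrable lborel (\<lambda>a. \<bar>u a * ?d a\<bar>)"
      by (simp add: int right_diff_distrib)
    show "\<bar>u a * ?d a\<bar> \<le> K * (norm v)\<^sup>2 * \<bar>u a\<bar>" for a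
      using mult_left_mono[OF K[of "y - a" v], of "\<bar>u a\<bar>"]
      by (simp add: abs_mult add_diff_eq[symmetric] diff_add_eq mult_ac)
  qed (use u in simp)
  finally show ?thesis by simp
qed

text \<open>The remainder in \<open>mollify_taylor\<close> is quadratic in the displacement, so its
  quotient by the displacement tends to 0; this replaces an interchange of limit and
  integral.\<close>

lemma mollify_has_derivative:
  fixes u :: "real ^ 'n \<Rightarrow> real"
  assumes \<eta>: "test_function \<eta>" and u: "integrable lborel u"
  shows "(mollify \<eta> u has_derivative
    (\<lambda>v. mollify (\<lambda>x. frechet_derivative \<eta> (at x) v) u y)) (at y)"
proof -
  obtain K where K: "K \<ge> 0"
      "\<And>x v. \<bar>\<eta> (x + v) - \<eta> x - frechet_derivative \<eta> (at x) v\<bar> \<le> K * (norm v)\<^sup>2"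
    using test_function_taylor[OF \<eta>] by auto
  note lin = linear_frechet_derivative[OF test_function_differentiable[OF \<eta>]]
  note int = integrable_mollify[OF test_function_derivative[OF \<eta>] u]
  have "linear (\<lambda>v. mollify (\<lambda>x. frechet_derivative \<eta> (at x) v) u y)"
    unfolding mollify_def
    by (rule linearI)
      (simp_all add: linear_add[OF lin] linear_cmul[OF lin] distrib_left int mult.left_commute)
  then have "bounded_linear (\<lambda>v. mollify (\<lambda>x. frechet_derivative \<eta> (at x) v) u y)"
    by (simp add: linear_conv_bounded_linear)
  moreover have "((\<lambda>z. K * norm (z - y) * (LINT a|lborel. \<bar>u a\<bar>)) \<longlongrightarrow> 0) (at y)"
    by (rule tendsto_eq_intros | simp)+
  moreover have "norm (mollify \<eta> u z - mollify \<eta> u y -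
      mollify (\<lambda>x. frechet_derivative \<eta> (at x) (z - y)) u y) / norm (z - y)
      \<le> K * norm (z - y) * (LINT a|lborel. \<bar>u a\<bar>)" if "z \<noteq> y" for z
    using mollify_taylor[OF \<eta> u K(2), of y "z - y"] that
    by (simp add: divide_simps power2_eq_square mult_ac)
  ultimately show ?thesis
    by (intro has_derivativeI_sandwich[of 1]) auto
qed

lemma frechet_derivative_mollify:
  fixes u :: "real ^ 'n \<Rightarrow> real"
  assumes "test_function \<eta>" "integrable lborel u"
  shows "frechet_derivative (mollify \<eta> u) (at y) =
    (\<lambda>v. mollify (\<lambda>x. frechet_derivative \<eta> (at x) v) u y)"
  using frechet_derivative_at[OF mollify_has_derivative[OF assms]] by simp

lemma cont_differentiable_mollify:
  fixes u :: "real ^ 'n \<Rightarrow> real"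
  assumes "test_function \<eta>" "integrable lborel u"
  shows "cont_differentiable k (mollify \<eta> u)"
  using assms
proof (induction k arbitrary: \<eta>)
  case 0
  then show ?case
    using has_derivative_continuous[OF mollify_has_derivative[OF 0]]
    by (simp add: continuous_at_imp_continuous_on)
next
  case (Suc k)
  have "cont_differentiable k (\<lambda>y. mollify (\<lambda>x. frechet_derivative \<eta> (at x) i) u y)"
    if "i \<in> Basis" for i
    using Suc.IH[OF test_function_derivative_Basis[OF Suc.prems(1) that] Suc.prems(2)] .
  then show ?case
    using mollify_has_derivative[OF Suc.prems]
    by (simp add: frechet_derivative_mollify[OF Suc.prems]) (auto simp: differentiable_def)
qed

lemma mollify_zero_outside_cball:
  fixes u :: "real ^ 'n \<Rightarrow> real"
  assumes "\<And>x. e < norm x \<Longrightarrow> \<eta> x = 0" "\<And>x. x \<notin> cball p r \<Longrightarrow> u x = 0"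
    and y: "y \<notin> cball p (r + e)"
  shows "mollify \<eta> u y = 0"
proof -
  have "u a * \<eta> (y - a) = 0" for a
  proof (cases "a \<in> cball p r")
    case True
    then have "dist p y \<le> r + norm (y - a)"
      using dist_triangle[of p y a] by (auto simp: dist_norm norm_minus_commute)
    then show ?thesis using y assms(1)[of "y - a"] by auto
  qed (use assms(2) in simp)
  then show ?thesis unfolding mollify_def by (simp only: integral_zero)
qed

lemma test_function_mollify:
  fixes u :: "real ^ 'n \<Rightarrow> real"
  assumes \<eta>: "test_function \<eta>" and u: "integrable lborel u"
    and z: "\<And>x. x \<notin> cball p r \<Longrightarrow> u x = 0"
  shows "test_function (mollify \<eta> u)"
proof -
  obtain e where e: "\<And>x. e < norm x \<Longrightarrow> \<eta> x = 0"
    using \<eta> unfolding test_function_iff by blast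
  have "mollify \<eta> u y = 0" if "norm p + r + e < norm y" for y
  proof (rule mollify_zero_outside_cball[OF e z])
    show "y \<notin> cball p (r + e)"
      using that norm_triangle_ineq2[of y p] by (auto simp: dist_norm norm_minus_commute)
  qed
  then show ?thesis
    unfolding test_function_iff using cont_differentiable_mollify[OF \<eta> u] by blast
qed

text \<open>Averaging the indicator of the ball of radius R + 1 over distances at most 1 leaves the
  value 1 on the ball of radius R.\<close>

lemma smooth_cutoff_exists:
  fixes R :: real
  obtains \<psi> :: "real ^ 'n \<Rightarrow> real" where
    "test_function \<psi>" "\<And>x. 0 \<le> \<psi> x" "\<And>x. \<psi> x \<le> 1" "\<And>x. norm x < R \<Longrightarrow> \<psi> x = 1"
proof -
  obtain \<rho> :: "real ^ 'n \<Rightarrow> real" where \<rho>: "test_function \<rho>" "\<And>x. 0 \<le> \<rho> x"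
      "\<And>x. 1 < norm x \<Longrightarrow> \<rho> x = 0" "(LINT x|lborel. \<rho> x) = 1"
    using mollifier_exists[of 1] by auto
  let ?u = "indicator (cball 0 (R + 1)) :: real ^ 'n \<Rightarrow> real"
  have u: "integrable lborel ?u"
    using emeasure_lborel_cball_finite by (intro integrable_real_indicator) auto
  have [measurable]: "\<rho> \<in> borel_measurable borel" by (rule test_function_borel[OF \<rho>(1)])
  have conv: "mollify \<rho> ?u y = (LINT a|lborel. \<rho> a * ?u (y - a))" for y
    by (intro mollify_commute borel_measurable_indicator test_function_borel[OF \<rho>(1)]) simp
  have \<rho>int: "integrable lborel \<rho>" by (rule test_function_integrable[OF \<rho>(1)])
  show thesis
  proof (rule that[of "mollify \<rho> ?u"])
    show "test_function (mollify \<rho> ?u)"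
      by (rule test_function_mollify[OF \<rho>(1) u, of 0 "R + 1"]) auto
    show "0 \<le> mollify \<rho> ?u x" for x
      unfolding conv by (intro integral_nonneg_AE) (auto simp: \<rho>)
    have int: "integrable lborel (\<lambda>a. \<rho> a * ?u (x - a))" for x
      by (rule Bochner_Integration.integrable_bound[OF \<rho>int]) (auto simp: \<rho> indicator_def)
    have "mollify \<rho> ?u x \<le> (LINT a|lborel. \<rho> a)" for x
      unfolding conv by (intro integral_mono int \<rho>int) (auto simp: \<rho> indicator_def)
    then show "mollify \<rho> ?u x \<le> 1" for x using \<rho>(4) by simp
    show "mollify \<rho> ?u x = 1" if "norm x < R" for x
    proof -
      have "\<rho> a * ?u (x - a) = \<rho> a" for a
        using \<rho>(3)[of a] norm_triangle_ineq4[of x a] that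
        by (cases "1 < norm a") (auto simp: indicator_def)
      then show ?thesis unfolding conv using \<rho>(4) by (simp only:)
    qed
  qed
qed

subsection \<open>Euler steps almost preserve Lebesgue measure\<close>

lemma measure_cball_translate: "measure lborel (cball (p :: real ^ 'n) r) = measure lborel (cball (0 :: real ^ 'n) r)"
proof (cases "r \<ge> 0")
  case True
  then show ?thesis by (simp add: measure_def emeasure_cball)
qed simp

text \<open>Turns a pointwise error on a ball into an error of integrals. The centre
  \<open>p\<close> is absent from the bound, because the noise will translate supports by arbitrary
  amounts.\<close>

lemma integral_le_add_const:
  fixes f g :: "real ^ 'n \<Rightarrow> real"
  assumes f: "integrable lborel f" and g: "integrable lborel g"
    and le: "\<And>x. x \<in> cball p r \<Longrightarrow> f x \<le> g x + k"
    and z: "\<And>x. x \<notin> cball p r \<Longrightarrow> f x = g x"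
  shows "(LINT x|lborel. f x) \<le> (LINT x|lborel. g x) + k * measure lborel (cball (0 :: real ^ 'n) r)"
proof -
  have int: "integrable lborel (\<lambda>x. k * indicator (cball p r) x)"
    using emeasure_lborel_cball_finite[of p r]
    by (intro integrable_mult_right integrable_real_indicator) auto
  have "(LINT x|lborel. f x) \<le> (LINT x|lborel. g x + k * indicator (cball p r) x)"
    using le z by (intro integral_mono f Bochner_Integration.integrable_add g int)
      (auto simp: indicator_def)
  also have "\<dots> = (LINT x|lborel. g x) + (LINT x|lborel. k * indicator (cball p r) x)"
    by (rule Bochner_Integration.integral_add[OF g int])
  also have "(LINT x|lborel. k * indicator (cball p r) x) = k * measure lborel (cball 0 r :: (real ^ 'n) set)"
    by (simp add: measure_cball_translate[of p])
  finally show ?thesis .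
qed

lemma lipschitz_continuous_on:
  fixes f :: "real ^ 'n \<Rightarrow> 'b :: real_normed_vector"
  assumes "\<And>x y. norm (f x - f y) \<le> L * norm (x - y)"
  shows "continuous_on S f"
proof -
  have "\<bar>L\<bar>-lipschitz_on S f"
  proof (rule lipschitz_onI)
    fix x y :: "real ^ 'n"
    have "L * norm (x - y) \<le> \<bar>L\<bar> * norm (x - y)" by (intro mult_right_mono) auto
    then show "dist (f x) (f y) \<le> \<bar>L\<bar> * dist x y" 
      using assms[of x y] by (simp add: dist_norm)
  qed simp
  then show ?thesis by (rule lipschitz_on_continuous_on)
qed

text \<open>Mollification almost commutes with the Euler step \<open>y \<mapsto> y + d *\<^sub>R c y\<close>: translating the
  integration variable moves the shift \<open>a\<close> into the argument of the Lipschitz field \<open>c\<close>, so that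
  the error carries the factor \<open>d\<close>.\<close>

lemma euler_step_mollify:
  fixes u \<rho> :: "real ^ 'n \<Rightarrow> real" and c :: "real ^ 'n \<Rightarrow> real ^ 'n"
  assumes u: "\<And>x y. \<bar>u x - u y\<bar> \<le> \<Lambda> * norm (x - y)" and \<Lambda>: "0 \<le> \<Lambda>"
    and uz: "\<And>x. x \<notin> cball p r \<Longrightarrow> u x = 0"
    and c: "\<And>x y. norm (c x - c y) \<le> L * norm (x - y)" and L: "0 \<le> L"
    and C: "\<And>x. norm (c x) \<le> C"
    and d: "0 \<le> d" "d \<le> 1"
    and \<rho>: "test_function \<rho>" "\<And>x. 0 \<le> \<rho> x" "\<And>x. e < norm x \<Longrightarrow> \<rho> x = 0"
      "(LINT x|lborel. \<rho> x) = 1" and e: "e \<le> 1"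
    and r': "r + C + 1 \<le> r'"
  shows "(LINT y|lborel. u (y + d *\<^sub>R c y) - u y)
    \<le> (LINT y|lborel. mollify \<rho> u (y + d *\<^sub>R c y) - mollify \<rho> u y)
      + d * L * \<Lambda> * e * measure lborel (cball (0 :: real ^ 'n) r')"
proof -
  let ?\<nu> = "measure lborel (cball (0 :: real ^ 'n) r')"
  have contu: "continuous_on S u" for S
    by (rule lipschitz_continuous_on[of u \<Lambda>]) (use u in simp)
  have contc: "continuous_on S c" for S by (rule lipschitz_continuous_on[OF c])
  have cont\<rho>: "continuous_on S \<rho>" for S
    by (rule continuous_on_subset[OF test_function_continuous[OF \<rho>(1)]]) simp
  have [measurable]: "u \<in> borel_measurable borel" "\<rho> \<in> borel_measurable borel"
      "c \<in> borel_measurable borel"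
    by (auto intro!: borel_measurable_continuous_onI contu cont\<rho> contc)
  have C0: "0 \<le> C" using norm_ge_zero[of "c 0"] C[of 0] by linarith
  have dC: "norm (d *\<^sub>R c y) \<le> C" for y
    using mult_mono[OF d(2) C[of y]] d by simp
  have dC1: "norm (d *\<^sub>R c y) \<le> C + 1" for y
    using dC[of y] by simp
  have in_ball: "y \<in> cball p r'" if "y + v \<in> cball p r" "norm v \<le> C + 1" for y v
    using that dist_triangle[of p y "y + v"] r' by (simp add: dist_norm)
  have uint: "integrable lborel (\<lambda>y. u (y + w y))" if "continuous_on UNIV w" "\<And>y. norm (w y) \<le> C + 1"
    for w :: "real ^ 'n \<Rightarrow> real ^ 'n"
  proof (rule integrable_continuous_zero_outside_cball)
    show "continuous_on UNIV (\<lambda>y. u (y + w y))"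
      by (rule continuous_on_compose2[OF contu[of UNIV]]) (auto intro!: continuous_intros that)
    show "u (y + w y) = 0" if "y \<notin> cball p r'" for y
      using in_ball[of y "w y"] that \<open>\<And>y. norm (w y) \<le> C + 1\<close> by (intro uz) auto
  qed
  \<comment> \<open>By Fubini the integral for the mollified function is the
    \<open>\<rho>\<close>-average of \<open>D a\<close>, and \<open>D 0\<close> is the one for
    \<open>u\<close> itself. As \<open>\<rho>\<close> lives on |a| \<le> e, it is enough to compare
    \<open>D a\<close> with \<open>D 0\<close> there.\<close>
  define D where "D a = (LINT y|lborel. u (y + d *\<^sub>R c y - a) - u (y - a))" for a
  have D: "D 0 - d * L * \<Lambda> * e * ?\<nu> \<le> D a" if a: "norm a \<le> e" for a
  proof -
    have a1: "norm a \<le> 1" using a e by simp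
    have int1: "integrable lborel (\<lambda>y. u (y + d *\<^sub>R c y - a))"
    proof -
      have "norm (d *\<^sub>R c y - a) \<le> C + 1" for y
        using norm_triangle_ineq4[of "d *\<^sub>R c y" a] dC[of y] a1 by linarith
      then show ?thesis
        using uint[of "\<lambda>y. d *\<^sub>R c y - a"]
        by (simp add: add_diff_eq continuous_on_diff continuous_on_scaleR contc)
    qed
    have int2: "integrable lborel (\<lambda>y. u (y - a))"
      using uint[of "\<lambda>y. - a"] a1 C0 by simp
    have int3: "integrable lborel (\<lambda>y. u (y + d *\<^sub>R c y))"
      by (intro uint dC1 continuous_intros contc)
    have int4: "integrable lborel u"
      using uint[of "\<lambda>y. 0"] C0 by simp
    have int5: "integrable lborel (\<lambda>y. u (y + d *\<^sub>R c (y + a)))"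
      by (intro uint dC1 continuous_intros continuous_on_compose2[OF contc[of UNIV]]) auto
    have "D a = (LINT y|lborel. u (y + d *\<^sub>R c y - a)) - (LINT y|lborel. u (y - a))"
      unfolding D_def by (rule Bochner_Integration.integral_diff[OF int1 int2])
    moreover have "(LINT y|lborel. u (y + a + d *\<^sub>R c (y + a) - a)) = (LINT y|lborel. u (y + d *\<^sub>R c y - a))"
      by (rule integral_lborel_translate[of "\<lambda>y. u (y + d *\<^sub>R c y - a)" a]) simp
    moreover have "(LINT y|lborel. u (y + a - a)) = (LINT y|lborel. u (y - a))"
      by (rule integral_lborel_translate[of "\<lambda>y. u (y - a)" a]) simp
    moreover have "D 0 = (LINT y|lborel. u (y + d *\<^sub>R c y)) - (LINT y|lborel. u y)"
      unfolding D_def using Bochner_Integration.integral_diff[OF int3 int4] by simp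
    moreover have "(LINT y|lborel. u (y + d *\<^sub>R c y)) \<le> (LINT y|lborel. u (y + d *\<^sub>R c (y + a)))
        + (d * L * \<Lambda> * e) * ?\<nu>"
    proof (rule integral_le_add_const[OF int3 int5])
      fix y
      have "\<bar>u (y + d *\<^sub>R c y) - u (y + d *\<^sub>R c (y + a))\<bar>
          \<le> \<Lambda> * norm (y + d *\<^sub>R c y - (y + d *\<^sub>R c (y + a)))"
        by (rule u)
      also have "norm (y + d *\<^sub>R c y - (y + d *\<^sub>R c (y + a))) = d * norm (c y - c (y + a))"
        using d by (simp add: scaleR_diff_right[symmetric])
      also have "norm (c y - c (y + a)) \<le> L * norm (y - (y + a))" by (rule c)
      also have "norm (y - (y + a)) \<le> e" using a by simp
      finally have "\<bar>u (y + d *\<^sub>R c y) - u (y + d *\<^sub>R c (y + a))\<bar> \<le> \<Lambda> * (d * (L * e))"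
        using \<Lambda> d L by (simp add: mult_left_mono)
      then show "u (y + d *\<^sub>R c y) \<le> u (y + d *\<^sub>R c (y + a)) + d * L * \<Lambda> * e"
        by (simp add: mult_ac)
      show "u (y + d *\<^sub>R c y) = u (y + d *\<^sub>R c (y + a))" if "y \<notin> cball p r'"
        using in_ball[of y "d *\<^sub>R c y"] in_ball[of y "d *\<^sub>R c (y + a)"] that dC[of y] dC[of "y + a"]
        by (metis uz add_increasing2 zero_le_one)
    qed
    ultimately show ?thesis by simp
  qed
  \<comment> \<open>Jointly continuous with compact support, which gives the integrability that
    Fubini asks for.\<close>
  let ?h = "\<lambda>(a, y). \<rho> a * (u (y + d *\<^sub>R c y - a) - u (y - a))"
  have hz: "?h x = 0" if "x \<notin> cball 0 e \<times> cball p r'" for x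
  proof (cases x)
    case (Pair a y)
    show ?thesis
    proof (cases "norm a \<le> e")
      case True
      then have "y \<notin> cball p r'" using that Pair by auto
      moreover have "norm (d *\<^sub>R c y - a) \<le> C + 1"
        using norm_triangle_ineq4[of "d *\<^sub>R c y" a] dC[of y] True e by linarith
      ultimately have "u (y + (d *\<^sub>R c y - a)) = 0" "u (y + (- a)) = 0"
        using in_ball[of y "d *\<^sub>R c y - a"] in_ball[of y "- a"] True e C0
        by (auto intro!: uz simp del: mem_cball)
      then show ?thesis by (simp add: Pair algebra_simps)
    qed (simp add: Pair \<rho>(3))
  qed
  have "continuous_on UNIV ?h"
    unfolding split_beta
    by (intro continuous_intros continuous_on_compose2[OF cont\<rho>[of UNIV]]
        continuous_on_compose2[OF contu[of UNIV]] continuous_on_compose2[OF contc[of UNIV]]) auto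
  note borel_integrable_compact[OF compact_Times[OF compact_cball compact_cball]
      continuous_on_subset[OF this subset_UNIV], of 0 e p r']
  also have "(\<lambda>x. indicator (cball 0 e \<times> cball p r') x *\<^sub>R ?h x) = ?h"
    using hz by (intro ext) (auto simp: indicator_def simp del: mem_cball)
  finally have hint: "integrable (lborel \<Otimes>\<^sub>M lborel) ?h"
    by (simp add: lborel_prod)
  have D0: "D 0 - d * L * \<Lambda> * e * ?\<nu> \<le> (LINT a|lborel. \<rho> a * D a)"
  proof -
    have \<rho>int: "integrable lborel \<rho>" by (rule test_function_integrable[OF \<rho>(1)])
    have int: "integrable lborel (\<lambda>a. \<rho> a * D a)"
      using lborel_pair.integrable_fst'[OF hint] by (simp add: D_def)
    have "(LINT a|lborel. \<rho> a * (D 0 - d * L * \<Lambda> * e * ?\<nu>)) \<le> (LINT a|lborel. \<rho> a * D a)"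
    proof (rule integral_mono)
      show "\<rho> a * (D 0 - d * L * \<Lambda> * e * ?\<nu>) \<le> \<rho> a * D a" for a
        using D[of a] \<rho>(2)[of a] \<rho>(3)[of a] by (cases "norm a \<le> e") (auto intro: mult_left_mono)
    qed (use \<rho>int int in auto)
    then show ?thesis using \<rho>(4) by simp
  qed
  have "(LINT a|lborel. \<rho> a * D a) = (LINT y|lborel. LINT a|lborel. ?h (a, y))"
    unfolding D_def using lborel_pair.Fubini_integral[of "\<lambda>a y. ?h (a, y)"] hint by simp
  also have "\<dots> = (LINT y|lborel. mollify \<rho> u (y + d *\<^sub>R c y) - mollify \<rho> u y)"
  proof (rule Bochner_Integration.integral_cong[OF refl])
    fix y
    have int: "integrable lborel (\<lambda>a. \<rho> a * u (z - a))" for z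
    proof (rule integrable_continuous_zero_outside_cball)
      show "continuous_on UNIV (\<lambda>a. \<rho> a * u (z - a))"
        by (intro continuous_intros cont\<rho> continuous_on_compose2[OF contu[of UNIV]]) auto
      show "\<rho> a * u (z - a) = 0" if "a \<notin> cball 0 e" for a using that \<rho>(3) by simp
    qed
    show "(LINT a|lborel. ?h (a, y)) = mollify \<rho> u (y + d *\<^sub>R c y) - mollify \<rho> u y"
      by (simp add: mollify_commute right_diff_distrib Bochner_Integration.integral_diff[OF int int])
  qed
  finally show ?thesis using D0 unfolding D_def by simp
qed

lemma frechet_derivative_zero_on_open:
  assumes "open S" "x \<in> S" "\<And>y. y \<in> S \<Longrightarrow> f y = 0"
  shows "frechet_derivative f (at x) = (\<lambda>_. 0)"
proof -
  have "(f has_derivative (\<lambda>_. 0)) (at x)"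
    using assms by (intro has_derivative_transform_within_open[OF has_derivative_const]) auto
  from frechet_derivative_at[OF this] show ?thesis by simp
qed

section \<open>One Euler step with killing\<close>

lemma exp_minus_lipschitz:
  fixes x y :: real
  assumes "0 \<le> x" "0 \<le> y"
  shows "\<bar>exp (- x) - exp (- y)\<bar> \<le> \<bar>x - y\<bar>"
proof -
  have *: "\<bar>exp (- x) - exp (- y)\<bar> \<le> \<bar>x - y\<bar>" if "0 \<le> x" "x \<le> y" for x y :: real
  proof -
    have "exp (- x) - exp (- y) = exp (- x) * (1 - exp (- (y - x)))"
      by (simp add: right_diff_distrib exp_add[symmetric])
    also have "\<dots> \<le> 1 * (y - x)"
    proof (intro mult_mono)
      show "1 - exp (- (y - x)) \<le> y - x"
        using exp_ge_add_one_self[of "x - y"] unfolding minus_diff_eq by linarith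
    qed (use that in auto)
    finally show ?thesis using that by simp
  qed
  show ?thesis
    using *[of x y] *[of y x] assms by (cases "x \<le> y") (auto simp: abs_minus_commute)
qed

lemma exp_minus_le_quadratic:
  fixes x :: real
  assumes "0 \<le> x"
  shows "exp (- x) \<le> 1 - x + x\<^sup>2"
proof -
  have "exp (- x) \<le> 1 / (1 + x)"
    using exp_ge_add_one_self[of x] assms by (simp add: exp_minus divide_simps)
  \<comment> \<open>(1 + x) (1 - x + x^2) = 1 + x^3.\<close>
  also have "\<dots> \<le> 1 - x + x\<^sup>2"
    using assms by (simp add: divide_simps algebra_simps power2_eq_square)
  finally show ?thesis .
qed

text \<open>The field \<open>c = \<psi> b\<close> has divergence \<open>b \<bullet> \<nabla>\<psi>\<close>, which is compensated by killing at rate \<open>V\<close>.\<close>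

locale truncated_field =
  fixes b c :: "real ^ 'n \<Rightarrow> real ^ 'n" and \<psi> V :: "real ^ 'n \<Rightarrow> real" and L C LV :: real
  assumes \<psi>: "test_function \<psi>"
    and div_free: "divergence_free b"
    and b_cont: "continuous_on UNIV b"
    and c_def: "\<And>y. c y = \<psi> y *\<^sub>R b y"
    and V_def: "\<And>y. V y = \<bar>frechet_derivative \<psi> (at y) (b y)\<bar>"
    and c_lip: "\<And>x y. norm (c x - c y) \<le> L * norm (x - y)"
    and V_lip: "\<And>x y. \<bar>V x - V y\<bar> \<le> LV * norm (x - y)"
    and c_bd: "\<And>x. norm (c x) \<le> C"
    and V_bd: "\<And>x. V x \<le> C"
    and nonneg: "0 \<le> L" "0 \<le> LV"
begin

lemma V_nonneg: "0 \<le> V x"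
  by (simp add: V_def)

lemma C_nonneg: "0 \<le> C"
  using norm_ge_zero[of "c 0"] c_bd[of 0] by linarith

lemma c_cont: "continuous_on S c"
  by (rule lipschitz_continuous_on[OF c_lip])

lemma V_cont: "continuous_on S V"
  by (rule lipschitz_continuous_on[of V LV]) (simp add: V_lip)

text \<open>The distributional divergence is tested with the product of \<psi> and \<open>U\<close>:
  by the product rule the integrals of c . grad U and of U (b . grad \<psi>) add up to 0, and the
  second integrand is at least -U V. This is where \<open>div_free\<close> enters.\<close>

lemma integral_derivative_le:
  assumes U: "test_function U" and U0: "\<And>y. 0 \<le> U y"
  shows "(LINT y|lborel. frechet_derivative U (at y) (c y)) \<le> (LINT y|lborel. U y * V y)"
    and "integrable lborel (\<lambda>y. frechet_derivative U (at y) (c y))"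
    and "integrable lborel (\<lambda>y. U y * V y)"
proof -
  obtain r where r: "\<And>y. r < norm y \<Longrightarrow> U y = 0"
    using U unfolding test_function_iff by blast
  have DU0: "frechet_derivative U (at y) = (\<lambda>_. 0)" if "r < norm y" for y
    by (rule frechet_derivative_zero_on_open[of "{y. r < norm y}"])
      (auto intro!: open_Collect_less continuous_intros that r)
  have contD: "continuous_on UNIV (\<lambda>y. frechet_derivative \<phi> (at y) (w y))"
    if \<phi>: "test_function \<phi>" and w: "continuous_on UNIV w" for \<phi> and w :: "real ^ 'n \<Rightarrow> real ^ 'n"
    unfolding frechet_derivative_euclidean[OF test_function_differentiable[OF \<phi>], of _ "w _"]
    by (intro continuous_intros w test_function_continuous test_function_derivative_Basis[OF \<phi>])
  have int: "integrable lborel f" if "continuous_on UNIV f" "\<And>y. r < norm y \<Longrightarrow> f y = 0" for f :: "real ^ 'n \<Rightarrow> real"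
    using that by (intro integrable_continuous_zero_outside_cball[of f 0 r]) auto
  show int1: "integrable lborel (\<lambda>y. frechet_derivative U (at y) (c y))"
    by (intro int contD U c_cont) (simp add: DU0)
  show int2: "integrable lborel (\<lambda>y. U y * V y)"
    by (intro int continuous_intros test_function_continuous U V_cont) (simp add: r)
  have int3: "integrable lborel (\<lambda>y. frechet_derivative \<psi> (at y) (b y) * U y)"
    by (intro int continuous_intros test_function_continuous U contD \<psi> b_cont) (simp add: r)
  have prod: "frechet_derivative (\<lambda>y. \<psi> y * U y) (at y) (b y) =
      frechet_derivative U (at y) (c y) + frechet_derivative \<psi> (at y) (b y) * U y" for y
  proof -
    have "frechet_derivative (\<lambda>y. \<psi> y * U y) (at y) = (\<lambda>v. \<psi> y * frechet_derivative U (at y) v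
        + frechet_derivative \<psi> (at y) v * U y)"
      by (intro frechet_derivative_at[symmetric] has_derivative_mult test_function_has_derivative U \<psi>)
    then show ?thesis
      using linear_cmul[OF linear_frechet_derivative[OF test_function_differentiable[OF U]], of y "\<psi> y" "b y"]
      by (simp add: c_def)
  qed
  have "(LINT y|lborel. frechet_derivative (\<lambda>y. \<psi> y * U y) (at y) (b y)) = 0"
    using div_free test_function_mult[OF \<psi> U] unfolding divergence_free_def by blast
  then have "(LINT y|lborel. frechet_derivative U (at y) (c y)) =
      (LINT y|lborel. - (frechet_derivative \<psi> (at y) (b y) * U y))"
    unfolding prod using Bochner_Integration.integral_add[OF int1 int3] by simp
  also have "\<dots> \<le> (LINT y|lborel. U y * V y)"
  proof (rule integral_mono)
    show "- (frechet_derivative \<psi> (at y) (b y) * U y) \<le> U y * V y" for y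
      using mult_left_mono[OF abs_ge_minus_self[of "frechet_derivative \<psi> (at y) (b y)"] U0[of y]]
      by (simp add: V_def mult.commute)
  qed (use int2 int3 in auto)
  finally show "(LINT y|lborel. frechet_derivative U (at y) (c y)) \<le> (LINT y|lborel. U y * V y)" .
qed

text \<open>Moving the mass raises the integral, to first order, by at most \<open>d\<close> times
  that of \<open>V y * u y\<close>, and the killing removes just as much. Since \<open>u\<close> is
  only Lipschitz, it is mollified at scale \<open>e\<close> before a derivative is taken. In the
  error, the two summands with \<open>e\<close> are the cost of passing to the mollification and
  back, the summand with \<open>K\<close> is its Taylor remainder, and the last two come from
  expanding the killing factor. \<open>K\<close> depends on \<open>e\<close>, so the two small
  parameters are kept apart.\<close>

lemma integral_euler_step_le:
  fixes u \<rho> :: "real ^ 'n \<Rightarrow> real"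
  assumes u0: "\<And>x. 0 \<le> u x" and uA: "\<And>x. u x \<le> A"
    and u: "\<And>x y. \<bar>u x - u y\<bar> \<le> \<Lambda> * norm (x - y)" and \<Lambda>: "0 \<le> \<Lambda>"
    and uz: "\<And>x. x \<notin> cball p r \<Longrightarrow> u x = 0"
    and d: "0 \<le> d" "d \<le> 1"
    and \<rho>: "test_function \<rho>" "\<And>x. 0 \<le> \<rho> x" "\<And>x. e < norm x \<Longrightarrow> \<rho> x = 0"
      "(LINT x|lborel. \<rho> x) = 1" and e: "0 \<le> e" "e \<le> 1"
    and K: "0 \<le> K" "\<And>x v. \<bar>\<rho> (x + v) - \<rho> x - frechet_derivative \<rho> (at x) v\<bar> \<le> K * (norm v)\<^sup>2"
    and \<nu>: "\<nu> = measure lborel (cball (0 :: real ^ 'n) (r + C + 2))"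
  shows "(LINT y|lborel. exp (- (d * V y)) * u (y + d *\<^sub>R c y)) \<le> (LINT y|lborel. u y)
    + d * (e * (L * \<Lambda> * \<nu> + \<Lambda> * C * \<nu>)) + d * (d * (K * A * \<nu> * C\<^sup>2 * \<nu> + C\<^sup>2 * A * \<nu> + C * \<Lambda> * C * \<nu>))"
proof -
  let ?r = "r + C + 2" and ?U = "mollify \<rho> u"
  note C0 = C_nonneg
  have A0: "0 \<le> A" using u0[of 0] uA[of 0] by simp
  have contu: "continuous_on S u" for S
    by (rule lipschitz_continuous_on[of u \<Lambda>]) (use u in simp)
  have cont\<rho>: "continuous_on S \<rho>" for S
    by (rule continuous_on_subset[OF test_function_continuous[OF \<rho>(1)]]) simp
  have [measurable]: "u \<in> borel_measurable borel" "\<rho> \<in> borel_measurable borel"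
    by (auto intro!: borel_measurable_continuous_onI contu cont\<rho>)
  have dC: "norm (d *\<^sub>R c y) \<le> C" for y
    using mult_mono[OF d(2) c_bd[of y]] d by simp
  have in_ball: "y \<in> cball p ?r" if "y + v \<in> cball p (r + e)" "norm v \<le> C" for y v
    using that dist_triangle[of p y "y + v"] e by (simp add: dist_norm)
  have in_ball': "y + d *\<^sub>R c y \<notin> cball p (r + e)" "y \<notin> cball p (r + e)" "y + d *\<^sub>R c y \<notin> cball p r" "y \<notin> cball p r"
    if "y \<notin> cball p ?r" for y
    using that in_ball[of y "d *\<^sub>R c y"] in_ball[of y 0] dC[of y] C0 e by auto
  have int: "integrable lborel f" if "continuous_on UNIV f" "\<And>y. y \<notin> cball p ?r \<Longrightarrow> f y = 0"
    for f :: "real ^ 'n \<Rightarrow> real"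
    by (rule integrable_continuous_zero_outside_cball[OF that])
  have uint: "integrable lborel u"
    by (intro int contu uz in_ball')
  have Vuint: "integrable lborel (\<lambda>y. V y * u y)"
    by (intro int continuous_intros contu V_cont) (use uz in_ball' in simp)
  have cont_uc: "continuous_on UNIV (\<lambda>y. u (y + d *\<^sub>R c y))"
    by (intro continuous_on_compose2[OF contu[of UNIV]] continuous_intros c_cont) auto
  have ucint: "integrable lborel (\<lambda>y. u (y + d *\<^sub>R c y))"
    by (intro int cont_uc uz in_ball')
  have U: "test_function ?U"
    by (rule test_function_mollify[OF \<rho>(1) uint uz])
  have Uz: "?U y = 0" if "y \<notin> cball p (r + e)" for y
    by (rule mollify_zero_outside_cball[OF \<rho>(3) uz that])
  have Ueq: "?U y = (LINT a|lborel. \<rho> a * u (y - a))" for y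
    by (rule mollify_commute) auto
  have U0: "0 \<le> ?U y" for y
    unfolding Ueq by (intro integral_nonneg_AE) (auto simp: \<rho> u0)
  have \<rho>int: "integrable lborel \<rho>" by (rule test_function_integrable[OF \<rho>(1)])
  have U_le: "?U y \<le> u y + \<Lambda> * e" for y
  proof -
    have "?U y \<le> (LINT a|lborel. \<rho> a * (u y + \<Lambda> * e))"
      unfolding Ueq
    proof (rule integral_mono)
      show "integrable lborel (\<lambda>a. \<rho> a * u (y - a))"
      proof (rule integrable_continuous_zero_outside_cball)
        show "continuous_on UNIV (\<lambda>a. \<rho> a * u (y - a))"
          by (intro continuous_intros cont\<rho> continuous_on_compose2[OF contu[of UNIV]]) auto
        show "\<rho> a * u (y - a) = 0" if "a \<notin> cball 0 e" for a using that \<rho>(3) by simp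
      qed
      show "\<rho> a * u (y - a) \<le> \<rho> a * (u y + \<Lambda> * e)" for a
      proof (cases "norm a \<le> e")
        case True
        then have "u (y - a) \<le> u y + \<Lambda> * e"
          using u[of "y - a" y] mult_left_mono[OF True \<Lambda>] by simp
        then show ?thesis using \<rho>(2) by (intro mult_left_mono)
      qed (simp add: \<rho>(3))
    qed (use \<rho>int in simp)
    then show ?thesis using \<rho>(4) by simp
  qed
  have DU0: "frechet_derivative ?U (at y) = (\<lambda>_. 0)" if "y \<notin> cball p ?r" for y
  proof (rule frechet_derivative_zero_on_open[of "- cball p (r + e)"])
    show "y \<in> - cball p (r + e)" using in_ball'[OF that] by simp
  qed (auto simp: Uz)
  \<comment> \<open>Replaces the killing factor by 1 - d V and, in the term with V, the value of
    \<open>u\<close> at the new point by that at the old one; both changes are of order d^2.\<close>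
  have "(LINT y|lborel. exp (- (d * V y)) * u (y + d *\<^sub>R c y)) \<le>
      (LINT y|lborel. u (y + d *\<^sub>R c y) - d * (V y * u y)) + d * (d * (C\<^sup>2 * A + C * \<Lambda> * C)) * \<nu>"
    unfolding \<nu>
  proof (rule integral_le_add_const)
    show "integrable lborel (\<lambda>y. exp (- (d * V y)) * u (y + d *\<^sub>R c y))"
      by (intro int continuous_intros V_cont cont_uc) (simp add: uz in_ball' del: mem_cball)
    show "integrable lborel (\<lambda>y. u (y + d *\<^sub>R c y) - d * (V y * u y))"
      using ucint Vuint by auto
    show "exp (- (d * V y)) * u (y + d *\<^sub>R c y) = u (y + d *\<^sub>R c y) - d * (V y * u y)"
      if "y \<notin> cball p ?r" for y
      using in_ball'[OF that] by (simp add: uz)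
    fix y
    let ?w = "u (y + d *\<^sub>R c y)"
    have V: "0 \<le> V y" "V y \<le> C" by (simp_all add: V_nonneg V_bd)
    have "exp (- (d * V y)) * ?w \<le> (1 - d * V y + (d * V y)\<^sup>2) * ?w"
      using exp_minus_le_quadratic[of "d * V y"] d V u0 by (intro mult_right_mono) auto
    moreover have "(d * V y)\<^sup>2 * ?w \<le> (d * C)\<^sup>2 * A"
      using d V u0 uA by (intro mult_mono power_mono mult_left_mono) auto
    moreover have "d * V y * (u y - ?w) \<le> d * C * (\<Lambda> * (d * C))"
    proof -
      have "u y - ?w \<le> \<Lambda> * norm (d *\<^sub>R c y)"
        using u[of y "y + d *\<^sub>R c y"] by simp
      also have "\<dots> \<le> \<Lambda> * (d * C)"
        using \<Lambda> d c_bd by (intro mult_left_mono) (auto intro: mult_left_mono)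
      finally have "d * V y * (u y - ?w) \<le> d * V y * (\<Lambda> * (d * C))"
        using d V by (intro mult_left_mono) auto
      also have "\<dots> \<le> d * C * (\<Lambda> * (d * C))"
        using d V \<Lambda> C0 by (intro mult_right_mono mult_left_mono) auto
      finally show ?thesis .
    qed
    ultimately show "exp (- (d * V y)) * ?w \<le> ?w - d * (V y * u y) + d * (d * (C\<^sup>2 * A + C * \<Lambda> * C))"
      by (simp add: algebra_simps power2_eq_square)
  qed
  also have "(LINT y|lborel. u (y + d *\<^sub>R c y) - d * (V y * u y)) =
      (LINT y|lborel. u (y + d *\<^sub>R c y) - u y) + (LINT y|lborel. u y) - d * (LINT y|lborel. V y * u y)"
    using ucint uint Vuint by simp
  also have "(LINT y|lborel. u (y + d *\<^sub>R c y) - u y)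
      \<le> (LINT y|lborel. ?U (y + d *\<^sub>R c y) - ?U y) + d * L * \<Lambda> * e * \<nu>"
    unfolding \<nu>
    by (rule euler_step_mollify[OF u \<Lambda> uz c_lip nonneg(1) c_bd d \<rho> e(2)]) auto
  also have "(LINT y|lborel. ?U (y + d *\<^sub>R c y) - ?U y) \<le>
      (LINT y|lborel. d * frechet_derivative ?U (at y) (c y)) + d * d * (K * C\<^sup>2 * (A * \<nu>)) * \<nu>"
    unfolding \<nu>
  proof (rule integral_le_add_const)
    have "continuous_on UNIV (\<lambda>y. ?U (y + d *\<^sub>R c y) - ?U y)"
      by (intro continuous_intros continuous_on_compose2[OF test_function_continuous[OF U]] c_cont) auto
    then show "integrable lborel (\<lambda>y. ?U (y + d *\<^sub>R c y) - ?U y)"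
      by (rule int) (simp add: Uz in_ball' del: mem_cball)
    show "integrable lborel (\<lambda>y. d * frechet_derivative ?U (at y) (c y))"
      using integral_derivative_le(2)[OF U U0] by simp
    show "?U (y + d *\<^sub>R c y) - ?U y = d * frechet_derivative ?U (at y) (c y)" if "y \<notin> cball p ?r" for y
      using in_ball'[OF that] by (simp add: Uz DU0[OF that])
    fix y
    \<comment> \<open>The L1 norm in \<open>mollify_taylor\<close>, estimated by comparing
      \<open>u\<close> with the zero function.\<close>
    have "(LINT a|lborel. \<bar>u a\<bar>) \<le> (LINT a|lborel. (\<lambda>a :: real ^ 'n. 0 :: real) a) + A * measure lborel (cball (0 :: real ^ 'n) ?r)"
    proof (rule integral_le_add_const)
      show "\<bar>u x\<bar> = 0" if "x \<notin> cball p ?r" for x using in_ball'[OF that] uz by simp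
      show "\<bar>u x\<bar> \<le> 0 + A" for x using u0[of x] uA[of x] by simp
    qed (use uint in auto)
    then have uA1: "(LINT a|lborel. \<bar>u a\<bar>) \<le> A * \<nu>" by (simp add: \<nu>)
    have "?U (y + d *\<^sub>R c y) - ?U y \<le> frechet_derivative ?U (at y) (d *\<^sub>R c y)
        + K * (norm (d *\<^sub>R c y))\<^sup>2 * (LINT a|lborel. \<bar>u a\<bar>)"
      using mollify_taylor[OF \<rho>(1) uint K(2), of y "d *\<^sub>R c y"]
      by (simp add: frechet_derivative_mollify[OF \<rho>(1) uint])
    also have "frechet_derivative ?U (at y) (d *\<^sub>R c y) = d * frechet_derivative ?U (at y) (c y)"
      using linear_cmul[OF linear_frechet_derivative[OF test_function_differentiable[OF U]]] by simp
    also have "K * (norm (d *\<^sub>R c y))\<^sup>2 * (LINT a|lborel. \<bar>u a\<bar>) \<le> K * (d * C)\<^sup>2 * (A * \<nu>)"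
      using K(1) d c_bd C0 uA1 A0 by (intro mult_mono power_mono) (auto intro!: mult_left_mono)
    finally show "?U (y + d *\<^sub>R c y) - ?U y \<le> d * frechet_derivative ?U (at y) (c y)
        + d * d * (K * C\<^sup>2 * (A * measure lborel (cball (0 :: real ^ 'n) ?r)))"
      by (simp add: \<nu> power2_eq_square mult_ac)
  qed
  \<comment> \<open>The divergence bound yields \<open>d\<close> times the integral of
    \<open>?U y * V y\<close>; once \<open>u\<close> is back in place of \<open>?U\<close>, this
    cancels the killing term.\<close>
  also have "(LINT y|lborel. d * frechet_derivative ?U (at y) (c y)) \<le> d * (LINT y|lborel. ?U y * V y)"
    using integral_derivative_le(1)[OF U U0] d by (simp add: mult_left_mono)
  also have "d * (LINT y|lborel. ?U y * V y) \<le> d * ((LINT y|lborel. V y * u y) + \<Lambda> * e * C * \<nu>)"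
    unfolding \<nu>
  proof (rule mult_left_mono[OF _ d(1)], rule integral_le_add_const[OF integral_derivative_le(3)[OF U U0] Vuint])
    show "?U y * V y = V y * u y" if "y \<notin> cball p ?r" for y
      using in_ball'[OF that] by (simp add: Uz uz)
    show "?U y * V y \<le> V y * u y + \<Lambda> * e * C" for y
    proof -
      have "?U y * V y \<le> (u y + \<Lambda> * e) * V y"
        using U_le V_nonneg by (intro mult_right_mono)
      moreover have "\<Lambda> * e * V y \<le> \<Lambda> * e * C"
        using \<Lambda> e V_bd by (intro mult_left_mono) auto
      ultimately show ?thesis by (simp add: algebra_simps)
    qed
  qed
  finally show ?thesis by (simp add: algebra_simps power2_eq_square)
qed

text \<open>The scale \<open>e\<close> is chosen first, which fixes the mollifier and
  \<open>K\<close>, and \<open>d0\<close> afterwards. The point is uniformity: \<open>d0\<close>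
  knows \<open>u\<close> only through \<open>A\<close>, \<open>\<Lambda>\<close> and
  \<open>r\<close>, and does not know the centre \<open>p\<close>, so that one step size serves all
  stages of the iteration and all noise sequences.\<close>

lemma integral_euler_step_le_uniform:
  assumes A: "0 \<le> A" and \<Lambda>: "0 \<le> \<Lambda>" and \<epsilon>: "0 < \<epsilon>"
  obtains d0 where "0 < d0" "d0 \<le> 1"
    "\<And>d u p. \<lbrakk>0 \<le> d; d \<le> d0; \<And>x. 0 \<le> u x; \<And>x. u x \<le> A;
      \<And>x y. \<bar>u x - u y\<bar> \<le> \<Lambda> * norm (x - y); \<And>x. x \<notin> cball p r \<Longrightarrow> u x = 0\<rbrakk> \<Longrightarrow>
      (LINT y|lborel. exp (- (d * V y)) * u (y + d *\<^sub>R c y)) \<le> (LINT y|lborel. u y) + d * \<epsilon>"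
proof -
  define \<nu> where "\<nu> = measure lborel (cball (0 :: real ^ 'n) (r + C + 2))"
  define E where "E = L * \<Lambda> * \<nu> + \<Lambda> * C * \<nu>"
  have E: "0 \<le> E" using \<Lambda> nonneg C_nonneg by (simp add: E_def \<nu>_def)
  define e where "e = min 1 (\<epsilon> / (2 * (E + 1)))"
  have e: "0 < e" "e \<le> 1" "e * E \<le> \<epsilon> / 2"
  proof -
    show "0 < e" "e \<le> 1" using E \<epsilon> by (auto simp: e_def)
    have "e * E \<le> \<epsilon> / (2 * (E + 1)) * (E + 1)"
      using E \<epsilon> by (intro mult_mono) (auto simp: e_def)
    also have "\<dots> = \<epsilon> / 2" using E by (simp add: field_simps)
    finally show "e * E \<le> \<epsilon> / 2" .
  qed
  obtain \<rho> :: "real ^ 'n \<Rightarrow> real" where \<rho>: "test_function \<rho>" "\<And>x. 0 \<le> \<rho> x"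
      "\<And>x. e < norm x \<Longrightarrow> \<rho> x = 0" "(LINT x|lborel. \<rho> x) = 1"
    using mollifier_exists[OF e(1)] by auto
  obtain K where K: "0 \<le> K" "\<And>x v. \<bar>\<rho> (x + v) - \<rho> x - frechet_derivative \<rho> (at x) v\<bar> \<le> K * (norm v)\<^sup>2"
    using test_function_taylor[OF \<rho>(1)] by auto
  define Q where "Q = K * A * \<nu> * C\<^sup>2 * \<nu> + C\<^sup>2 * A * \<nu> + C * \<Lambda> * C * \<nu>"
  have Q: "0 \<le> Q" using K A \<Lambda> C_nonneg by (simp add: Q_def \<nu>_def)
  define d0 where "d0 = min 1 (\<epsilon> / (2 * (Q + 1)))"
  have d0: "0 < d0" "d0 \<le> 1" using Q \<epsilon> by (auto simp: d0_def)
  have dQ: "d * Q \<le> \<epsilon> / 2" if "0 \<le> d" "d \<le> d0" for d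
  proof -
    have "d * Q \<le> \<epsilon> / (2 * (Q + 1)) * (Q + 1)"
      using that Q \<epsilon> by (intro mult_mono) (auto simp: d0_def)
    also have "\<dots> = \<epsilon> / 2" using Q by (simp add: field_simps)
    finally show ?thesis .
  qed
  show thesis
  proof (rule that[OF d0])
    fix d p and u :: "real ^ 'n \<Rightarrow> real"
    assume d: "0 \<le> d" "d \<le> d0" and u: "\<And>x. 0 \<le> u x" "\<And>x. u x \<le> A"
      "\<And>x y. \<bar>u x - u y\<bar> \<le> \<Lambda> * norm (x - y)" "\<And>x. x \<notin> cball p r \<Longrightarrow> u x = 0"
    have d1: "d \<le> 1" using d d0 by simp
    have "(LINT y|lborel. exp (- (d * V y)) * u (y + d *\<^sub>R c y)) \<le> (LINT y|lborel. u y)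
        + d * (e * E) + d * (d * Q)"
      unfolding E_def Q_def
      using integral_euler_step_le[OF u(1-3) \<Lambda> u(4) d(1) d1 \<rho> less_imp_le[OF e(1)] e(2) K \<nu>_def] .
    moreover have "d * (e * E + d * Q) \<le> d * \<epsilon>"
      using e(3) dQ[OF d] d by (intro mult_left_mono) auto
    ultimately show "(LINT y|lborel. exp (- (d * V y)) * u (y + d *\<^sub>R c y)) \<le> (LINT y|lborel. u y) + d * \<epsilon>"
      by (simp add: distrib_left)
  qed
qed

end

section \<open>Iteration of the killed step\<close>

primrec euler :: "real \<Rightarrow> (real ^ 'n \<Rightarrow> real ^ 'n) \<Rightarrow> (nat \<Rightarrow> real ^ 'n) \<Rightarrow> real ^ 'n \<Rightarrow> nat \<Rightarrow> real ^ 'n" where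
  "euler d c \<xi> x 0 = x"
| "euler d c \<xi> x (Suc i) = euler d c \<xi> x i + d *\<^sub>R c (euler d c \<xi> x i) + \<xi> i"

text \<open>The value of \<open>g\<close> at the \<open>k\<close>-th Euler point, times the product
  of exp(-d V) over the points before it. The recursion peels off the first step, whereas
  \<open>euler\<close> appends the last one: in this form the functional is one killed step applied
  to a functional of the remaining noise.\<close>

primrec killed_euler ::
    "real \<Rightarrow> (real ^ 'n \<Rightarrow> real ^ 'n) \<Rightarrow> (real ^ 'n \<Rightarrow> real) \<Rightarrow> (real ^ 'n \<Rightarrow> real) \<Rightarrow>
      nat \<Rightarrow> (nat \<Rightarrow> real ^ 'n) \<Rightarrow> real ^ 'n \<Rightarrow> real" where
  "killed_euler d c V g 0 \<xi> y = g y"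
| "killed_euler d c V g (Suc k) \<xi> y =
    exp (- (d * V y)) * killed_euler d c V g k (\<lambda>i. \<xi> (Suc i)) (y + d *\<^sub>R c y + \<xi> 0)"

context truncated_field
begin

lemma killed_euler_bounds:
  assumes "0 \<le> d" "\<And>x. 0 \<le> g x" "\<And>x. g x \<le> A"
  shows "0 \<le> killed_euler d c V g k \<xi> y" "killed_euler d c V g k \<xi> y \<le> A"
proof -
  have "0 \<le> killed_euler d c V g k \<xi> y \<and> killed_euler d c V g k \<xi> y \<le> A"
  proof (induction k arbitrary: \<xi> y)
    case (Suc k)
    let ?u = "killed_euler d c V g k (\<lambda>i. \<xi> (Suc i)) (y + d *\<^sub>R c y + \<xi> 0)"
    have u: "0 \<le> ?u" "?u \<le> A" using Suc.IH by auto
    have "exp (- (d * V y)) * ?u \<le> 1 * ?u"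
      using assms(1) V_nonneg u(1) by (intro mult_right_mono) auto
    with u show ?case by simp
  qed (use assms in auto)
  then show "0 \<le> killed_euler d c V g k \<xi> y" "killed_euler d c V g k \<xi> y \<le> A" by auto
qed

text \<open>A step costs a factor 1 + d L from the drift and a summand d LV A from the killing rate.
  As long as k d stays below a fixed time, the resulting constant is bounded uniformly in the mesh
  and in the noise.\<close>

lemma killed_euler_lipschitz:
  assumes d: "0 \<le> d" and g: "\<And>x. 0 \<le> g x" "\<And>x. g x \<le> A"
    and gl: "\<And>x y. \<bar>g x - g y\<bar> \<le> \<Lambda> * norm (x - y)" and \<Lambda>: "0 \<le> \<Lambda>"
  shows "\<bar>killed_euler d c V g k \<xi> x - killed_euler d c V g k \<xi> y\<bar>
    \<le> (\<Lambda> + real k * d * LV * A) * (1 + d * L) ^ k * norm (x - y)"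
proof (induction k arbitrary: \<xi> x y)
  case 0
  then show ?case using gl by simp
next
  case (Suc k)
  define u where "u = killed_euler d c V g k (\<lambda>i. \<xi> (Suc i))"
  let ?G = "\<lambda>y. y + d *\<^sub>R c y + \<xi> 0" and ?M = "\<Lambda> + real k * d * LV * A"
  have A0: "0 \<le> A" using g[of 0] by simp
  have u: "0 \<le> u x" "u x \<le> A" for x
    unfolding u_def using killed_euler_bounds[OF d g] by auto
  have M0: "0 \<le> ?M" using \<Lambda> d nonneg A0 by simp
  have dL: "1 \<le> 1 + d * L" using d nonneg by simp
  have "norm (?G x - ?G y) \<le> (1 + d * L) * norm (x - y)"
  proof -
    have "?G x - ?G y = (x - y) + d *\<^sub>R (c x - c y)" by (simp add: algebra_simps)
    also have "norm \<dots> \<le> norm (x - y) + d * norm (c x - c y)"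
      using norm_triangle_ineq[of "x - y" "d *\<^sub>R (c x - c y)"] d by simp
    also have "\<dots> \<le> norm (x - y) + d * (L * norm (x - y))"
      using c_lip d by (intro add_left_mono mult_left_mono)
    finally show ?thesis by (simp add: algebra_simps)
  qed
  then have 1: "\<bar>u (?G x) - u (?G y)\<bar> \<le> ?M * (1 + d * L) ^ k * ((1 + d * L) * norm (x - y))"
    using Suc.IH[of "\<lambda>i. \<xi> (Suc i)" "?G x" "?G y"] M0 dL unfolding u_def[symmetric]
    by (elim order_trans) (intro mult_left_mono, auto)
  have "\<bar>exp (- (d * V x)) - exp (- (d * V y))\<bar> \<le> \<bar>d * V x - d * V y\<bar>"
    using d V_nonneg by (intro exp_minus_lipschitz) auto
  also have "\<dots> = d * \<bar>V x - V y\<bar>" using d by (simp add: right_diff_distrib[symmetric] abs_mult)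
  also have "\<dots> \<le> d * (LV * norm (x - y))" using V_lip d by (intro mult_left_mono)
  finally have 2: "\<bar>exp (- (d * V x)) - exp (- (d * V y))\<bar> \<le> d * (LV * norm (x - y))" .
  have "exp (- (d * V x)) * u (?G x) - exp (- (d * V y)) * u (?G y) =
      exp (- (d * V x)) * (u (?G x) - u (?G y)) + (exp (- (d * V x)) - exp (- (d * V y))) * u (?G y)"
    by (simp add: algebra_simps)
  also have "\<bar>\<dots>\<bar> \<le> 1 * \<bar>u (?G x) - u (?G y)\<bar> + \<bar>exp (- (d * V x)) - exp (- (d * V y))\<bar> * A"
    using d V_nonneg u A0
    by (intro order_trans[OF abs_triangle_ineq] add_mono) (auto simp: abs_mult intro!: mult_mono mult_left_le_one_le)
  also have "\<dots> \<le> ?M * (1 + d * L) ^ k * ((1 + d * L) * norm (x - y)) + d * (LV * norm (x - y)) * A"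
    using 1 2 A0 by (intro add_mono mult_right_mono) auto
  \<comment> \<open>The summand from the killing rate is padded with a power of 1 + d L, which is at
    least 1, to fit the closed form.\<close>
  also have "\<dots> \<le> ?M * (1 + d * L) ^ k * ((1 + d * L) * norm (x - y))
      + (d * (LV * norm (x - y)) * A) * (1 + d * L) ^ Suc k"
    using mult_left_mono[OF one_le_power[OF dL, of "Suc k"], of "d * (LV * norm (x - y)) * A"]
      d nonneg A0 by simp
  also have "\<dots> = (\<Lambda> + real (Suc k) * d * LV * A) * (1 + d * L) ^ Suc k * norm (x - y)"
    by (simp add: algebra_simps)
  finally show ?case by (simp add: u_def)
qed

text \<open>The noise only translates the centre; the radius grows by \<open>d * C\<close> per step,
  whatever the noise.\<close>

lemma killed_euler_support:
  assumes d: "0 \<le> d" and gz: "\<And>x. x \<notin> cball 0 r \<Longrightarrow> g x = 0"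
  shows "\<exists>p. \<forall>x. x \<notin> cball p (r + real k * d * C) \<longrightarrow> killed_euler d c V g k \<xi> x = 0"
proof (induction k arbitrary: \<xi>)
  case 0
  show ?case using gz by (intro exI[of _ 0]) auto
next
  case (Suc k)
  obtain p where p: "\<And>x. x \<notin> cball p (r + real k * d * C) \<Longrightarrow>
      killed_euler d c V g k (\<lambda>i. \<xi> (Suc i)) x = 0"
    using Suc.IH[of "\<lambda>i. \<xi> (Suc i)"] by blast
  show ?case
  proof (intro exI[of _ "p - \<xi> 0"] allI impI)
    fix x assume x: "x \<notin> cball (p - \<xi> 0) (r + real (Suc k) * d * C)"
    have "norm (p - \<xi> 0 - x) \<le> norm (p - (x + d *\<^sub>R c x + \<xi> 0)) + norm (d *\<^sub>R c x)"
      by (rule order_trans[OF _ norm_triangle_ineq]) (simp add: algebra_simps)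
    also have "norm (d *\<^sub>R c x) \<le> d * C" using d c_bd by (simp add: mult_left_mono)
    finally have "x + d *\<^sub>R c x + \<xi> 0 \<notin> cball p (r + real k * d * C)"
      using x by (simp add: dist_norm algebra_simps)
    then show "killed_euler d c V g (Suc k) \<xi> x = 0" by (simp add: p)
  qed
qed

text \<open>Induction on the number of steps. The first increment acts as a translation and drops
  out of the Lebesgue integral, which leaves one killed step. A step has error
  \<open>d * \<epsilon>\<close>, so the total is proportional to the elapsed time k d and not to k.
  The same \<open>d0\<close> serves every noise sequence and every k with k d \<le> T.\<close>

lemma integral_killed_euler_le:
  assumes g: "\<And>x. 0 \<le> g x" "\<And>x. g x \<le> A" "\<And>x y. \<bar>g x - g y\<bar> \<le> \<Lambda> * norm (x - y)"
      "\<And>x. x \<notin> cball 0 r \<Longrightarrow> g x = 0"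
    and \<Lambda>: "0 \<le> \<Lambda>" and T: "0 \<le> T" and \<epsilon>: "0 < \<epsilon>"
  obtains d0 where "0 < d0"
    "\<And>d k \<xi>. \<lbrakk>0 \<le> d; d \<le> d0; real k * d \<le> T\<rbrakk> \<Longrightarrow>
      (LINT y|lborel. killed_euler d c V g k \<xi> y) \<le> (LINT y|lborel. g y) + real k * d * \<epsilon>"
proof -
  have A0: "0 \<le> A" using g(1,2)[of 0] by simp
  \<comment> \<open>A Lipschitz constant for all stages, from (1 + d L)^k \<le> exp(T L) when k d
    \<le> T.\<close>
  define M where "M = (\<Lambda> + T * LV * A) * exp (T * L)"
  have M0: "0 \<le> M" using \<Lambda> T nonneg A0 by (simp add: M_def)
  obtain d0 where d0: "0 < d0" "d0 \<le> 1"
    and step: "\<And>d u p. \<lbrakk>0 \<le> d; d \<le> d0; \<And>x. 0 \<le> u x; \<And>x. u x \<le> A;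
      \<And>x y. \<bar>u x - u y\<bar> \<le> M * norm (x - y); \<And>x. x \<notin> cball p (r + T * C) \<Longrightarrow> u x = 0\<rbrakk> \<Longrightarrow>
      (LINT y|lborel. exp (- (d * V y)) * u (y + d *\<^sub>R c y)) \<le> (LINT y|lborel. u y) + d * \<epsilon>"
    using integral_euler_step_le_uniform[OF A0 M0 \<epsilon>, where r = "r + T * C"] by blast
  have "(LINT y|lborel. killed_euler d c V g k \<xi> y) \<le> (LINT y|lborel. g y) + real k * d * \<epsilon>"
    if d: "0 \<le> d" "d \<le> d0" "real k * d \<le> T" for d k \<xi>
    using d(3)
  proof (induction k arbitrary: \<xi>)
    case 0
    then show ?case by simp
  next
    case (Suc k)
    have kd: "real k * d \<le> T"
      using Suc.prems d(1) by (simp add: algebra_simps)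
    define w where "w = killed_euler d c V g k (\<lambda>i. \<xi> (Suc i))"
    have wl: "\<bar>w x - w y\<bar> \<le> M * norm (x - y)" for x y
    proof -
      have "(1 + d * L) ^ k \<le> exp (d * L) ^ k"
        using d nonneg by (intro power_mono exp_ge_add_one_self) auto
      also have "\<dots> = exp (real k * d * L)" by (simp add: exp_of_nat_mult mult.assoc)
      also have "\<dots> \<le> exp (T * L)" using kd nonneg by (simp add: mult_right_mono)
      finally have pow: "(1 + d * L) ^ k \<le> exp (T * L)" .
      have "real k * d * (LV * A) \<le> T * (LV * A)"
        using kd nonneg A0 by (intro mult_right_mono) auto
      then have "(\<Lambda> + real k * d * LV * A) * (1 + d * L) ^ k \<le> M"
        unfolding M_def using pow \<Lambda> d nonneg A0 T
        by (intro mult_mono) (simp_all add: mult.assoc)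
      then have "(\<Lambda> + real k * d * LV * A) * (1 + d * L) ^ k * norm (x - y) \<le> M * norm (x - y)"
        by (rule mult_right_mono) simp
      then show ?thesis
        using killed_euler_lipschitz[OF d(1) g(1-3) \<Lambda>, of k "\<lambda>i. \<xi> (Suc i)" x y]
        unfolding w_def by linarith
    qed
    obtain p where p: "\<And>x. x \<notin> cball p (r + real k * d * C) \<Longrightarrow> w x = 0"
      using killed_euler_support[where g = g and r = r and k = k and \<xi> = "\<lambda>i. \<xi> (Suc i)", OF d(1) g(4)]
      unfolding w_def by blast
    \<comment> \<open>With the first increment moved into the function, the noiseless step treated
      by \<open>step\<close> remains.\<close>
    define u where "u x = w (x + \<xi> 0)" for x
    have "(LINT y|lborel. exp (- (d * V y)) * u (y + d *\<^sub>R c y)) \<le> (LINT y|lborel. u y) + d * \<epsilon>"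
    proof (rule step[OF d(1,2), of u "p - \<xi> 0"])
      show "0 \<le> u x" "u x \<le> A" for x
        unfolding u_def w_def using killed_euler_bounds[OF d(1) g(1,2)] by auto
      show "\<bar>u x - u y\<bar> \<le> M * norm (x - y)" for x y
        using wl[of "x + \<xi> 0" "y + \<xi> 0"] by (simp add: u_def)
      show "u x = 0" if "x \<notin> cball (p - \<xi> 0) (r + T * C)" for x
      proof -
        have "real k * d * C \<le> T * C" using kd C_nonneg by (intro mult_right_mono)
        moreover have "dist p (x + \<xi> 0) = dist (p - \<xi> 0) x"
          by (simp add: dist_norm algebra_simps)
        ultimately show ?thesis unfolding u_def using that by (intro p) auto
      qed
    qed
    also have "(LINT y|lborel. u y) = (LINT y|lborel. w y)"
    proof -
      have "continuous_on UNIV w" by (rule lipschitz_continuous_on[of w M]) (use wl in simp)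
      then show ?thesis
        unfolding u_def by (intro integral_lborel_translate borel_measurable_continuous_onI)
    qed
    also have "(LINT y|lborel. w y) \<le> (LINT y|lborel. g y) + real k * d * \<epsilon>"
      unfolding w_def by (rule Suc.IH[OF kd])
    finally show ?case by (simp add: u_def w_def algebra_simps)
  qed
  then show thesis using d0(1) that by blast
qed

end

subsection \<open>Shifting the noise\<close>

text \<open>The ball averages of \<open>Q\<close> converge to \<open>Q\<close>, and the preimage of a ball under \<open>F\<close> is
  contained in a ball of four times the radius.\<close>

lemma nn_integral_expanding_le:
  fixes F :: "real ^ 'n \<Rightarrow> real ^ 'n" and Q :: "real ^ 'n \<Rightarrow> real"
  assumes Q: "continuous_on UNIV Q" "\<And>x. 0 \<le> Q x"
    and F[measurable]: "F \<in> borel_measurable borel"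
    and exp: "\<And>z z'. norm (z - z') \<le> 2 * norm (F z - F z')"
  shows "(\<integral>\<^sup>+z. Q (F z) \<partial>lborel) \<le> 4 ^ CARD('n) * (\<integral>\<^sup>+y. Q y \<partial>lborel)"
proof -
  have [measurable]: "Q \<in> borel_measurable borel" using Q(1) by (rule borel_measurable_continuous_onI)
  define r where "r k = 1 / real (Suc k)" for k
  have r: "0 < r k" for k by (simp add: r_def)
  define v where "v k = unit_ball_vol (real CARD('n)) * r k ^ CARD('n)" for k
  have v: "0 < v k" for k unfolding v_def using r unit_ball_vol_pos[OF of_nat_0_le_iff] by simp
  define m where "m k x = (\<integral>\<^sup>+y. ennreal (Q y) * ennreal (1 / v k) * indicator {p. dist (fst p) (snd p) < r k} (x, y) \<partial>lborel)" for k x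
  have "ennreal (Q x) \<le> liminf (\<lambda>k. m k x)" for x
    unfolding le_Liminf_iff
  proof (intro allI impI)
    fix t assume t: "t < ennreal (Q x)"
    obtain s where s: "t < ennreal s" "s < Q x" "0 \<le> s"
    proof (cases t)
      case (real t')
      then have "t' < Q x" using t by (simp add: ennreal_less_iff)
      then obtain s where "t' < s" "s < Q x" using dense by blast
      then show thesis using real by (intro that[of s]) (auto simp: ennreal_less_iff)
    qed (use t in simp)
    have "open {y. s < Q y}" using Q(1) by (intro open_Collect_less continuous_intros)
    then obtain e where e: "e > 0" "ball x e \<subseteq> {y. s < Q y}"
      using s(2) open_contains_ball by blast
    have "eventually (\<lambda>k. r k < e) sequentially"
      unfolding r_def using e(1) by real_asymp
    then show "eventually (\<lambda>k. t < m k x) sequentially"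
    proof eventually_elim
      case (elim k)
      have "ennreal s = ennreal (s / v k) * emeasure lborel (ball x (r k))"
        using r[of k] v[of k] s by (simp add: emeasure_ball v_def[symmetric] ennreal_mult'[symmetric])
      also have "\<dots> = (\<integral>\<^sup>+y. ennreal (s / v k) * indicator (ball x (r k)) y \<partial>lborel)"
        by (simp add: nn_integral_cmult_indicator)
      also have "\<dots> \<le> m k x"
        unfolding m_def
      proof (rule nn_integral_mono)
        fix y
        show "ennreal (s / v k) * indicator (ball x (r k)) y \<le>
            ennreal (Q y) * ennreal (1 / v k) * indicator {p. dist (fst p) (snd p) < r k} (x, y)"
        proof (cases "y \<in> ball x (r k)")
          case True
          then have "y \<in> ball x e" using elim by simp
          then have "s < Q y" using e by blast
          then show ?thesis
            using True v[of k] Q(2) by (auto simp: ennreal_mult'[symmetric] divide_right_mono intro!: ennreal_leI)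
        qed simp
      qed
      finally show ?case using s(1) by simp
    qed
  qed
  then have "(\<integral>\<^sup>+z. Q (F z) \<partial>lborel) \<le> (\<integral>\<^sup>+z. liminf (\<lambda>k. m k (F z)) \<partial>lborel)"
    by (intro nn_integral_mono)
  also have "\<dots> \<le> liminf (\<lambda>k. \<integral>\<^sup>+z. m k (F z) \<partial>lborel)"
    unfolding m_def by (intro nn_integral_liminf) measurable
  also have "\<dots> \<le> liminf (\<lambda>k. 4 ^ CARD('n) * (\<integral>\<^sup>+y. Q y \<partial>lborel))"
  proof (intro Liminf_mono always_eventually allI)
    fix k
    \<comment> \<open>Fubini turns the average of \<open>Q\<close> over the ball about
      \<open>F z\<close> into the measure of the set of \<open>z\<close> with \<open>F z\<close>
      close to \<open>y\<close>. Only the diameter of that set is needed, so no Jacobian of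
      \<open>F\<close> appears.\<close>
    have "(\<integral>\<^sup>+z. m k (F z) \<partial>lborel) = (\<integral>\<^sup>+y. \<integral>\<^sup>+z. ennreal (Q y) * ennreal (1 / v k) * indicator {p. dist (fst p) (snd p) < r k} (F z, y) \<partial>lborel \<partial>lborel)"
      unfolding m_def by (intro lborel_pair.Fubini') measurable
    also have "\<dots> \<le> (\<integral>\<^sup>+y. 4 ^ CARD('n) * ennreal (Q y) \<partial>lborel)"
    proof (rule nn_integral_mono)
      fix y
      let ?S = "{z. dist (F z) y < r k}"
      have "emeasure lborel ?S \<le> 4 ^ CARD('n) * ennreal (v k)"
      proof (cases "?S = {}")
        case False
        then obtain z0 where z0: "dist (F z0) y < r k" by auto
        have "?S \<subseteq> cball z0 (4 * r k)"
        proof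
          fix z assume "z \<in> ?S"
          then have "norm (F z0 - F z) < 2 * r k"
            using z0 dist_triangle2[of "F z0" "F z" y] by (simp add: dist_norm)
          then show "z \<in> cball z0 (4 * r k)" using exp[of z0 z] by (simp add: dist_norm)
        qed
        then have "emeasure lborel ?S \<le> emeasure lborel (cball z0 (4 * r k))"
          by (intro emeasure_mono) auto
        also have "\<dots> = ennreal (4 ^ CARD('n) * v k)"
          using r[of k] by (simp add: emeasure_cball v_def power_mult_distrib mult_ac)
        also have "\<dots> = 4 ^ CARD('n) * ennreal (v k)"
          by (simp add: ennreal_mult' ennreal_power[symmetric])
        finally show ?thesis .
      qed simp
      then have "ennreal (Q y) * ennreal (1 / v k) * emeasure lborel ?S \<le>
          ennreal (Q y) * ennreal (1 / v k) * (4 ^ CARD('n) * ennreal (v k))"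
        by (rule mult_left_mono) simp
      also have "\<dots> = 4 ^ CARD('n) * ennreal (Q y) * (ennreal (1 / v k) * ennreal (v k))"
        by (simp add: mult_ac)
      also have "ennreal (1 / v k) * ennreal (v k) = 1"
        using v[of k] by (simp add: ennreal_mult'[symmetric])
      finally have *: "ennreal (Q y) * ennreal (1 / v k) * emeasure lborel ?S \<le> 4 ^ CARD('n) * ennreal (Q y)"
        by simp
      have "(\<integral>\<^sup>+z. ennreal (Q y) * ennreal (1 / v k) * indicator {p. dist (fst p) (snd p) < r k} (F z, y) \<partial>lborel)
        = (\<integral>\<^sup>+z. ennreal (Q y) * ennreal (1 / v k) * indicator ?S z \<partial>lborel)"
        by (intro nn_integral_cong) (simp add: indicator_def)
      also have "\<dots> = ennreal (Q y) * ennreal (1 / v k) * emeasure lborel ?S"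
        by (intro nn_integral_cmult_indicator) simp
      finally show "(\<integral>\<^sup>+z. ennreal (Q y) * ennreal (1 / v k) * indicator {p. dist (fst p) (snd p) < r k} (F z, y) \<partial>lborel)
          \<le> 4 ^ CARD('n) * ennreal (Q y)" using * by simp
    qed
    also have "\<dots> = 4 ^ CARD('n) * (\<integral>\<^sup>+y. Q y \<partial>lborel)"
      by (rule nn_integral_cmult) simp
    finally show "(\<integral>\<^sup>+z. m k (F z) \<partial>lborel) \<le> 4 ^ CARD('n) * (\<integral>\<^sup>+y. Q y \<partial>lborel)" .
  qed
  also have "\<dots> = 4 ^ CARD('n) * (\<integral>\<^sup>+y. Q y \<partial>lborel)"
    by (simp add: Liminf_const)
  finally show ?thesis .
qed

text \<open>The shift alone moves the endpoint by z; the drift changes the difference of two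
  endpoints by at most half of |z - z'|. Along the way this difference stays below 3/2 |z - z'|, so
  \<open>m\<close> steps of drift contribute at most m d L (3/2) |z - z'|, which explains the 3 in
  the hypothesis.\<close>

lemma euler_shift_expanding:
  fixes c :: "real ^ 'n \<Rightarrow> real ^ 'n" and x :: "real ^ 'n" and \<xi> :: "nat \<Rightarrow> real ^ 'n"
  assumes c: "\<And>x y. norm (c x - c y) \<le> L * norm (x - y)" and L: "0 \<le> L"
    and m: "0 < m" and d: "0 \<le> d" "3 * (real m * d * L) \<le> 1"
  defines "F z \<equiv> euler d c (\<lambda>i. \<xi> i + z /\<^sub>R real m) x m"
  shows "norm (z - z') \<le> 2 * norm (F z - F z')"
proof -
  define E where "E z i = euler d c (\<lambda>i. \<xi> i + z /\<^sub>R real m) x i" for z i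
  \<comment> \<open>The invariant compares with linear interpolation and allows an error
    proportional to i / m, so that each step may add the share 1 / m.\<close>
  have "norm (E z i - E z' i - (real i / real m) *\<^sub>R (z - z')) \<le> 1 / 2 * (real i / real m) * norm (z - z')"
    if "i \<le> m" for i
    using that
  proof (induction i)
    case 0
    then show ?case by (simp add: E_def)
  next
    case (Suc i)
    let ?w = "z - z'"
    let ?D = "E z i - E z' i"
    have IH: "norm (?D - (real i / real m) *\<^sub>R ?w) \<le> 1 / 2 * (real i / real m) * norm ?w"
      using Suc by simp
    have im: "real i / real m \<le> 1" using Suc.prems m by simp
    have "norm ?D \<le> norm (?D - (real i / real m) *\<^sub>R ?w) + norm ((real i / real m) *\<^sub>R ?w)"
      using norm_triangle_ineq[of "?D - (real i / real m) *\<^sub>R ?w" "(real i / real m) *\<^sub>R ?w"] by simp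
    also have "\<dots> \<le> 3 / 2 * (real i / real m) * norm ?w" using IH by simp
    also have "\<dots> \<le> 3 / 2 * 1 * norm ?w" using im by (intro mult_right_mono mult_left_mono) auto
    finally have D: "norm ?D \<le> 3 / 2 * norm ?w" by simp
    have "norm (d *\<^sub>R (c (E z i) - c (E z' i))) \<le> d * (L * (3 / 2 * norm ?w))"
    proof -
      have "norm (c (E z i) - c (E z' i)) \<le> L * (3 / 2 * norm ?w)"
        using c[of "E z i" "E z' i"] mult_left_mono[OF D L] by (rule order_trans)
      then have "d * norm (c (E z i) - c (E z' i)) \<le> d * (L * (3 / 2 * norm ?w))"
        using d(1) by (rule mult_left_mono)
      then show ?thesis using d(1) by simp
    qed
    also have "\<dots> \<le> 1 / 2 * (1 / real m) * norm ?w"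
    proof -
      have "d * L * 3 \<le> 1 / real m" using d(2) m by (simp add: field_simps)
      then have "d * L * 3 * (1 / 2 * norm ?w) \<le> 1 / real m * (1 / 2 * norm ?w)"
        by (intro mult_right_mono) auto
      then show ?thesis by (simp add: mult_ac)
    qed
    finally have st: "norm (d *\<^sub>R (c (E z i) - c (E z' i))) \<le> 1 / 2 * (1 / real m) * norm ?w" .
    have "E z (Suc i) - E z' (Suc i) - (real (Suc i) / real m) *\<^sub>R ?w =
        (?D - (real i / real m) *\<^sub>R ?w) + d *\<^sub>R (c (E z i) - c (E z' i))"
      by (simp add: E_def algebra_simps add_divide_distrib divide_inverse)
    also have "norm \<dots> \<le> 1 / 2 * (real i / real m) * norm ?w + 1 / 2 * (1 / real m) * norm ?w"
      by (rule order_trans[OF norm_triangle_ineq add_mono[OF IH st]])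
    also have "\<dots> = 1 / 2 * (real (Suc i) / real m) * norm ?w"
      by (simp add: algebra_simps add_divide_distrib)
    finally show ?case .
  qed
  from this[of m] have "norm (F z - F z' - (z - z')) \<le> 1 / 2 * norm (z - z')"
    using m by (simp add: F_def E_def)
  then show ?thesis
    using norm_triangle_ineq4[of "F z - F z'" "F z - F z' - (z - z')"] by simp
qed

lemma nn_integral_lborel_translate:
  fixes f :: "real ^ 'n \<Rightarrow> ennreal"
  assumes "f \<in> borel_measurable borel"
  shows "(\<integral>\<^sup>+x. f (x + t) \<partial>lborel) = (\<integral>\<^sup>+x. f x \<partial>lborel)"
proof -
  have "(\<integral>\<^sup>+x. f x \<partial>lborel) = (\<integral>\<^sup>+x. f x \<partial>distr lborel borel ((+) t))"
    by (simp add: lborel_distr_plus)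
  also have "\<dots> = (\<integral>\<^sup>+x. f (x + t) \<partial>lborel)"
    using assms by (subst nn_integral_distr) (auto simp: add.commute)
  finally show ?thesis by simp
qed

section \<open>Cameron-Martin shifts of Gaussian increments\<close>

definition gauss_density :: "real \<Rightarrow> real ^ 'n \<Rightarrow> real" where
  "gauss_density d y = (\<Prod>i\<in>UNIV. normal_density 0 (sqrt d) (y $ i))"

text \<open>The density of N(v, d I) with respect to N(0, d I): the finite-dimensional
  Cameron-Martin factor.\<close>

definition gauss_shift :: "real \<Rightarrow> real ^ 'n \<Rightarrow> real ^ 'n \<Rightarrow> real" where
  "gauss_shift d v x = exp ((2 * (v \<bullet> x) - v \<bullet> v) / (2 * d))"

lemma gauss_density_shift:
  fixes x v :: "real ^ 'n"
  assumes d: "0 < d"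
  shows "gauss_density d (x - v) = gauss_shift d v x * gauss_density d x"
proof -
  have "normal_density 0 (sqrt d) ((x - v) $ i) =
      exp ((2 * (v $ i * x $ i) - v $ i * v $ i) / (2 * d)) * normal_density 0 (sqrt d) (x $ i)" for i
  proof -
    have "- ((x $ i - v $ i)\<^sup>2 / (2 * d)) = (2 * (v $ i * x $ i) - v $ i * v $ i) / (2 * d) + - ((x $ i)\<^sup>2 / (2 * d))"
      using d by (simp add: field_simps power2_eq_square)
    then show ?thesis
      using d by (simp add: normal_density_def exp_add[symmetric])
  qed
  then have "gauss_density d (x - v) = (\<Prod>i\<in>UNIV. exp ((2 * (v $ i * x $ i) - v $ i * v $ i) / (2 * d)))
      * gauss_density d x"
    by (simp add: gauss_density_def prod.distrib)
  also have "(\<Prod>i\<in>UNIV. exp ((2 * (v $ i * x $ i) - v $ i * v $ i) / (2 * d))) = gauss_shift d v x"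
    by (simp add: exp_sum[symmetric] gauss_shift_def inner_vec_def sum_divide_distrib[symmetric]
        sum_subtractf sum_distrib_left)
  finally show ?thesis .
qed

lemma gauss_density_nonneg: "0 \<le> gauss_density d y"
  by (simp add: gauss_density_def prod_nonneg)

lemma borel_measurable_gauss_density [measurable]:
  "(gauss_density d :: real ^ 'n \<Rightarrow> real) \<in> borel_measurable borel"
  unfolding gauss_density_def by measurable

lemma borel_measurable_gauss_shift [measurable]:
  "(\<lambda>p. gauss_shift d (fst p) (snd p :: real ^ 'n)) \<in> borel_measurable (borel \<Otimes>\<^sub>M borel)"
  "(gauss_shift d v :: real ^ 'n \<Rightarrow> real) \<in> borel_measurable borel"
  unfolding gauss_shift_def by measurable

definition gauss_measure :: "real \<Rightarrow> (real ^ 'n) measure" where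
  "gauss_measure d = density lborel (\<lambda>y. ennreal (gauss_density d y))"

lemma sets_gauss_measure [simp, measurable_cong]: "sets (gauss_measure d) = sets borel"
  by (simp add: gauss_measure_def)

lemma space_gauss_measure [simp]: "space (gauss_measure d) = UNIV"
  by (simp add: gauss_measure_def)

lemma nn_integral_gauss_shift:
  fixes f :: "real ^ 'n \<Rightarrow> ennreal"
  assumes d: "0 < d" and f[measurable]: "f \<in> borel_measurable borel"
  shows "(\<integral>\<^sup>+x. f (x + v) \<partial>gauss_measure d) = (\<integral>\<^sup>+x. f x * gauss_shift d v x \<partial>gauss_measure d)"
proof -
  have "(\<integral>\<^sup>+x. f (x + v) \<partial>gauss_measure d) = (\<integral>\<^sup>+x. ennreal (gauss_density d (x + v - v)) * f (x + v) \<partial>lborel)"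
    by (simp add: gauss_measure_def nn_integral_density)
  also have "\<dots> = (\<integral>\<^sup>+x. ennreal (gauss_density d (x - v)) * f x \<partial>lborel)"
    by (rule nn_integral_lborel_translate) simp
  also have "\<dots> = (\<integral>\<^sup>+x. f x * gauss_shift d v x \<partial>gauss_measure d)"
    by (simp add: gauss_measure_def nn_integral_density gauss_density_shift[OF d] ennreal_mult'
        gauss_density_nonneg mult_ac)
  finally show ?thesis .
qed

lemma measurable_fun_upd_value:
  assumes "s \<in> space (PiM I (\<lambda>_. borel))"
  shows "(\<lambda>y. s(j := y)) \<in> measurable borel (PiM (insert j I) (\<lambda>_. borel))"
  using measurable_fun_upd[where I = I and i = j and J = "insert j I" and f = "\<lambda>_. s" and h = "\<lambda>y. y" and N = borel] assms
  by (simp add: measurable_const)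

text \<open>Induction over the coordinates: \<open>nn_integral_gauss_shift\<close> in the new
  coordinate with the others frozen, then the induction hypothesis for the partially integrated
  function \<open>G\<close>.\<close>

lemma nn_integral_PiM_gauss_shift:
  fixes v :: "'i \<Rightarrow> real ^ 'n"
  assumes d: "0 < d" and sf: "sigma_finite_measure (gauss_measure d :: (real ^ 'n) measure)"
    and I: "finite I" and f: "f \<in> borel_measurable (PiM I (\<lambda>_. borel))"
  shows "(\<integral>\<^sup>+x. f (\<lambda>i\<in>I. x i + v i) \<partial>PiM I (\<lambda>_. gauss_measure d)) =
    (\<integral>\<^sup>+x. f x * (\<Prod>i\<in>I. ennreal (gauss_shift d (v i) (x i))) \<partial>PiM I (\<lambda>_. gauss_measure d))"
  using I f
proof (induction I arbitrary: f)
  case empty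
  have "(\<lambda>i\<in>{}. x i + v i) = x" if "x \<in> space (PiM {} (\<lambda>_. gauss_measure d))" for x
    using that by (auto simp: space_PiM)
  then show ?case by (intro nn_integral_cong) simp
next
  case (insert j I)
  interpret P: product_sigma_finite "\<lambda>_ :: 'i. gauss_measure d :: (real ^ 'n) measure"
    using sf by (simp add: product_sigma_finite_def)
  interpret sigma_finite_measure "gauss_measure d :: (real ^ 'n) measure" by (rule sf)
  have cong: "sets (PiM J (\<lambda>_ :: 'i. gauss_measure d :: (real ^ 'n) measure)) = sets (PiM J (\<lambda>_. borel))" for J
    by (intro sets_PiM_cong) auto
  note [measurable_cong] = cong
  note [measurable] = insert.prems
  define G where "G x = (\<integral>\<^sup>+y. f (x(j := y)) * gauss_shift d (v j) y \<partial>gauss_measure d)" for x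
  have G[measurable]: "G \<in> borel_measurable (PiM I (\<lambda>_. borel))"
    unfolding G_def by measurable
  have "(\<integral>\<^sup>+x. f (\<lambda>i\<in>insert j I. x i + v i) \<partial>PiM (insert j I) (\<lambda>_. gauss_measure d)) =
      (\<integral>\<^sup>+x. (\<integral>\<^sup>+y. f (\<lambda>i\<in>insert j I. (x(j := y)) i + v i) \<partial>gauss_measure d) \<partial>PiM I (\<lambda>_. gauss_measure d))"
    by (intro P.product_nn_integral_insert insert.hyps) measurable
  also have "\<dots> = (\<integral>\<^sup>+x. G (\<lambda>i\<in>I. x i + v i) \<partial>PiM I (\<lambda>_. gauss_measure d))"
  proof (rule nn_integral_cong)
    fix x assume x: "x \<in> space (PiM I (\<lambda>_. gauss_measure d :: (real ^ 'n) measure))"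
    let ?s = "\<lambda>i\<in>I. x i + v i"
    have s: "?s \<in> space (PiM I (\<lambda>_. borel))" by (simp add: space_PiM)
    have eq: "(\<lambda>i\<in>insert j I. (x(j := y)) i + v i) = ?s(j := y + v j)" for y
      using insert.hyps by (auto simp: restrict_def fun_eq_iff)
    have "(\<lambda>y. f (?s(j := y))) \<in> borel_measurable borel"
      by (rule measurable_compose[OF measurable_fun_upd_value[OF s] insert.prems])
    then show "(\<integral>\<^sup>+y. f (\<lambda>i\<in>insert j I. (x(j := y)) i + v i) \<partial>gauss_measure d) = G ?s"
      unfolding eq G_def by (rule nn_integral_gauss_shift[OF d])
  qed
  also have "\<dots> = (\<integral>\<^sup>+x. G x * (\<Prod>i\<in>I. ennreal (gauss_shift d (v i) (x i))) \<partial>PiM I (\<lambda>_. gauss_measure d))"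
    by (rule insert.IH[OF G])
  also have "\<dots> = (\<integral>\<^sup>+x. (\<integral>\<^sup>+y. f (x(j := y)) * (\<Prod>i\<in>insert j I. ennreal (gauss_shift d (v i) ((x(j := y)) i)))
      \<partial>gauss_measure d) \<partial>PiM I (\<lambda>_. gauss_measure d))"
  proof (rule nn_integral_cong)
    fix x assume x: "x \<in> space (PiM I (\<lambda>_. gauss_measure d :: (real ^ 'n) measure))"
    then have s: "x \<in> space (PiM I (\<lambda>_. borel))" by (simp add: space_PiM)
    have m: "(\<lambda>y. f (x(j := y))) \<in> borel_measurable borel"
      by (rule measurable_compose[OF measurable_fun_upd_value[OF s] insert.prems])
    have "(\<Prod>i\<in>I. ennreal (gauss_shift d (v i) ((x(j := y)) i))) = (\<Prod>i\<in>I. ennreal (gauss_shift d (v i) (x i)))" for y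
      using insert.hyps by (intro prod.cong) auto
    then show "G x * (\<Prod>i\<in>I. ennreal (gauss_shift d (v i) (x i))) =
        (\<integral>\<^sup>+y. f (x(j := y)) * (\<Prod>i\<in>insert j I. ennreal (gauss_shift d (v i) ((x(j := y)) i))) \<partial>gauss_measure d)"
      unfolding G_def using insert.hyps m
      by (subst nn_integral_multc[symmetric]) (auto simp: mult_ac intro!: nn_integral_cong)
  qed
  also have "\<dots> = (\<integral>\<^sup>+x. f x * (\<Prod>i\<in>insert j I. ennreal (gauss_shift d (v i) (x i))) \<partial>PiM (insert j I) (\<lambda>_. gauss_measure d))"
    by (intro P.product_nn_integral_insert[symmetric] insert.hyps) measurable
  finally show ?case .
qed

text \<open>Independence makes the joint law of the increments a product of Gaussian laws; the shift
  identity on the product space is then pulled back to \<open>M\<close>.\<close>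

lemma (in prob_space) nn_integral_gauss_increments_shift:
  fixes \<xi> :: "nat \<Rightarrow> 'a \<Rightarrow> real ^ 'n"
  assumes d: "0 < d" and N: "0 < N"
    and indep: "indep_vars (\<lambda>_. borel) \<xi> {..<N}"
    and distr: "\<And>i. i < N \<Longrightarrow> distributed M lborel (\<xi> i) (\<lambda>y. ennreal (gauss_density d y))"
    and f[measurable]: "f \<in> borel_measurable (PiM {..<N} (\<lambda>_. borel))"
  shows "(\<integral>\<^sup>+\<omega>. f (\<lambda>i\<in>{..<N}. \<xi> i \<omega> + v i) \<partial>M) =
    (\<integral>\<^sup>+\<omega>. f (\<lambda>i\<in>{..<N}. \<xi> i \<omega>) * (\<Prod>i<N. ennreal (gauss_shift d (v i) (\<xi> i \<omega>))) \<partial>M)"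
proof -
  have \<xi>: "\<xi> i \<in> borel_measurable M" if "i < N" for i
    using distributed_measurable[OF distr[OF that]] by simp
  have g: "distr M borel (\<xi> i) = gauss_measure d" if "i < N" for i
    using distributed_distr_eq_density[OF distr[OF that]]
    by (simp add: gauss_measure_def cong: distr_cong)
  interpret G: prob_space "gauss_measure d :: (real ^ 'n) measure"
    using prob_space_distr[OF \<xi>[OF N]] by (simp add: g[OF N])
  have "{..<N} \<noteq> {}" using N by auto
  then have D: "distr M (PiM {..<N} (\<lambda>_. borel)) (\<lambda>\<omega>. \<lambda>i\<in>{..<N}. \<xi> i \<omega>) = PiM {..<N} (\<lambda>i. distr M borel (\<xi> i))"
    using indep by (subst (asm) indep_vars_iff_distr_eq_PiM') (auto simp: \<xi>)
  also have "\<dots> = PiM {..<N} (\<lambda>_. gauss_measure d)"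
    by (intro PiM_cong) (auto simp: g)
  finally have D: "PiM {..<N} (\<lambda>_. gauss_measure d) = distr M (PiM {..<N} (\<lambda>_. borel)) (\<lambda>\<omega>. \<lambda>i\<in>{..<N}. \<xi> i \<omega>)" ..
  have m: "(\<lambda>\<omega>. \<lambda>i\<in>{..<N}. \<xi> i \<omega>) \<in> measurable M (PiM {..<N} (\<lambda>_. borel))"
    by (intro measurable_restrict) (simp add: \<xi>)
  have comp[measurable]: "(\<lambda>x. x i) \<in> borel_measurable (PiM {..<N} (\<lambda>_. borel :: (real ^ 'n) measure))" if "i \<in> {..<N}" for i
    using that by measurable
  have sh[measurable]: "(\<lambda>x. \<lambda>i\<in>{..<N}. x i + v i) \<in> measurable (PiM {..<N} (\<lambda>_. borel)) (PiM {..<N} (\<lambda>_. borel))"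
    by (intro measurable_restrict borel_measurable_add comp) auto
  have "(\<integral>\<^sup>+\<omega>. f (\<lambda>i\<in>{..<N}. \<xi> i \<omega> + v i) \<partial>M) =
      (\<integral>\<^sup>+x. f (\<lambda>i\<in>{..<N}. x i + v i) \<partial>PiM {..<N} (\<lambda>_. gauss_measure d))"
    unfolding D by (subst nn_integral_distr[OF m]) (auto intro!: nn_integral_cong arg_cong[of _ _ f])
  also have "\<dots> = (\<integral>\<^sup>+x. f x * (\<Prod>i<N. ennreal (gauss_shift d (v i) (x i))) \<partial>PiM {..<N} (\<lambda>_. gauss_measure d))"
    by (rule nn_integral_PiM_gauss_shift[OF d G.sigma_finite_measure_axioms]) auto
  also have "\<dots> = (\<integral>\<^sup>+\<omega>. f (\<lambda>i\<in>{..<N}. \<xi> i \<omega>) * (\<Prod>i<N. ennreal (gauss_shift d (v i) (\<xi> i \<omega>))) \<partial>M)"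
    unfolding D by (subst nn_integral_distr[OF m]) (auto intro!: nn_integral_cong)
  finally show ?thesis .
qed

text \<open>Completing the square, 2 z . S - z . z = S . S - |z - S|^2, so the integral is at least
  that of a centred Gaussian profile, whatever \<open>S\<close> is. This uniform positive bound
  allows the shift to be averaged over Lebesgue measure.\<close>

lemma gauss_shift_average:
  fixes t :: real
  assumes t: "0 < t"
  obtains \<kappa> :: real where "0 < \<kappa>"
    "\<And>S :: real ^ 'n. ennreal \<kappa> \<le> (\<integral>\<^sup>+z. ennreal (gauss_shift t z S) \<partial>lborel)"
proof -
  let ?I = "\<integral>\<^sup>+z. ennreal (exp (- ((z :: real ^ 'n) \<bullet> z) / (2 * t))) \<partial>lborel"
  have "?I \<noteq> 0"
  proof
    assume "?I = 0"
    then have "AE z :: real ^ 'n in lborel. ennreal (exp (- (z \<bullet> z) / (2 * t))) = 0"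
      by (subst (asm) nn_integral_0_iff_AE) auto
    then have "AE z :: real ^ 'n in lborel. False" by simp
    then have "emeasure lborel (UNIV :: (real ^ 'n) set) = 0"
      by (subst (asm) AE_iff_measurable[OF _ refl]) auto
    then show False by simp
  qed
  \<comment> \<open>The minimum with 1 secures finiteness without evaluating the Gaussian
    integral.\<close>
  then have "0 < min 1 ?I" by (simp add: zero_less_iff_neq_zero)
  moreover have "min 1 ?I < \<top>" by (simp add: min_less_iff_disj)
  moreover obtain \<kappa> where "enn2real (min 1 ?I) = \<kappa>" by blast
  ultimately have \<kappa>: "0 < \<kappa>" "ennreal \<kappa> = min 1 ?I"
    by (auto simp only: enn2real_positive_iff ennreal_enn2real)
  have "ennreal \<kappa> \<le> (\<integral>\<^sup>+z. ennreal (gauss_shift t z S) \<partial>lborel)" for S :: "real ^ 'n"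
  proof -
    have "ennreal \<kappa> \<le> ?I" by (simp add: \<kappa>)
    also have "\<dots> = (\<integral>\<^sup>+z. ennreal (exp (- ((z + - S) \<bullet> (z + - S)) / (2 * t))) \<partial>lborel)"
      by (rule nn_integral_lborel_translate[symmetric]) simp
    also have "\<dots> \<le> (\<integral>\<^sup>+z. ennreal (gauss_shift t z S) \<partial>lborel)"
      unfolding gauss_shift_def using t
      by (intro nn_integral_mono ennreal_leI)
        (auto simp: inner_simps inner_commute intro!: divide_right_mono)
    finally show ?thesis .
  qed
  then show thesis using \<kappa>(1) that by blast
qed

text \<open>With z spread evenly over \<open>m\<close> increments the exponents add up to one that
  sees the noise only through its sum, with total variance m d. When m d = t, the factor no longer
  depends on the mesh.\<close>

lemma prod_gauss_shift:
  fixes z :: "real ^ 'n"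
  assumes m: "0 < m" "m \<le> N" and d: "0 < d"
  shows "(\<Prod>i<N. ennreal (gauss_shift d (if i < m then z /\<^sub>R real m else 0) (x i))) =
    ennreal (gauss_shift (real m * d) z (\<Sum>i<m. x i))"
proof -
  have "(\<Prod>i<N. gauss_shift d (if i < m then z /\<^sub>R real m else 0) (x i)) = (\<Prod>i<m. gauss_shift d (z /\<^sub>R real m) (x i))"
    using m by (intro prod.mono_neutral_cong_right) (auto simp: gauss_shift_def)
  also have "\<dots> = exp (\<Sum>i<m. (2 * ((z /\<^sub>R real m) \<bullet> x i) - (z /\<^sub>R real m) \<bullet> (z /\<^sub>R real m)) / (2 * d))"
    by (simp add: gauss_shift_def exp_sum)
  also have "(\<Sum>i<m. (2 * ((z /\<^sub>R real m) \<bullet> x i) - (z /\<^sub>R real m) \<bullet> (z /\<^sub>R real m)) / (2 * d)) =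
      (2 * (z \<bullet> (\<Sum>i<m. x i)) - z \<bullet> z) / (2 * (real m * d))"
    using m d by (simp add: inner_sum_right sum_subtractf sum_divide_distrib[symmetric]
        sum_distrib_left[symmetric] field_simps)
  finally have "(\<Prod>i<N. gauss_shift d (if i < m then z /\<^sub>R real m else 0) (x i)) = gauss_shift (real m * d) z (\<Sum>i<m. x i)"
    by (simp add: gauss_shift_def)
  then show ?thesis
    by (subst prod_ennreal) (auto simp: gauss_shift_def)
qed

text \<open>The shift identity integrated over all z. For fixed noise the Cameron-Martin factors
  integrate to at least \<kappa>, so the expectation for the given noise is controlled by one in
  which the first \<open>m\<close> increments carry an additional displacement spread over the whole
  space.\<close>

lemma (in prob_space) gauss_increments_average_shift:
  fixes \<xi> :: "nat \<Rightarrow> 'a \<Rightarrow> real ^ 'n"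
  assumes m: "0 < m" "m \<le> N" and d: "0 < d"
    and \<kappa>: "\<And>S :: real ^ 'n. ennreal \<kappa> \<le> (\<integral>\<^sup>+z. ennreal (gauss_shift (real m * d) z S) \<partial>lborel)"
    and indep: "indep_vars (\<lambda>_. borel) \<xi> {..<N}"
    and distr: "\<And>i. i < N \<Longrightarrow> distributed M lborel (\<xi> i) (\<lambda>y. ennreal (gauss_density d y))"
    and f[measurable]: "f \<in> borel_measurable (PiM {..<N} (\<lambda>_. borel))"
  shows "ennreal \<kappa> * (\<integral>\<^sup>+\<omega>. f (\<lambda>i\<in>{..<N}. \<xi> i \<omega>) \<partial>M) \<le>
    (\<integral>\<^sup>+\<omega>. (\<integral>\<^sup>+z. f (\<lambda>i\<in>{..<N}. \<xi> i \<omega> + (if i < m then z /\<^sub>R real m else 0)) \<partial>lborel) \<partial>M)"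
proof -
  interpret P: pair_sigma_finite M "lborel :: (real ^ 'n) measure" ..
  have \<xi>[measurable]: "\<xi> i \<in> borel_measurable M" if "i \<in> {..<N}" for i
    using distributed_measurable[OF distr, of i] that by simp
  have m1[measurable]: "(\<lambda>\<omega>. \<lambda>i\<in>{..<N}. \<xi> i \<omega>) \<in> measurable M (PiM {..<N} (\<lambda>_. borel))"
    by (intro measurable_restrict \<xi>)
  have m2[measurable]: "(\<lambda>p. \<lambda>i\<in>{..<N}. \<xi> i (fst p) + (if i < m then snd p /\<^sub>R real m else 0))
      \<in> measurable (M \<Otimes>\<^sub>M lborel) (PiM {..<N} (\<lambda>_. borel))"
    by (intro measurable_restrict) measurable
  have S[measurable]: "(\<lambda>\<omega>. \<Sum>i<m. \<xi> i \<omega>) \<in> borel_measurable M"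
    using m by (intro borel_measurable_sum \<xi>) auto
  have "ennreal \<kappa> * (\<integral>\<^sup>+\<omega>. f (\<lambda>i\<in>{..<N}. \<xi> i \<omega>) \<partial>M) = (\<integral>\<^sup>+\<omega>. ennreal \<kappa> * f (\<lambda>i\<in>{..<N}. \<xi> i \<omega>) \<partial>M)"
    by (rule nn_integral_cmult[symmetric]) measurable
  also have "\<dots> \<le> (\<integral>\<^sup>+\<omega>. (\<integral>\<^sup>+z. f (\<lambda>i\<in>{..<N}. \<xi> i \<omega>) * ennreal (gauss_shift (real m * d) z (\<Sum>i<m. \<xi> i \<omega>)) \<partial>lborel) \<partial>M)"
  proof (rule nn_integral_mono)
    fix \<omega> assume "\<omega> \<in> space M"
    have "(\<integral>\<^sup>+z. f (\<lambda>i\<in>{..<N}. \<xi> i \<omega>) * ennreal (gauss_shift (real m * d) z (\<Sum>i<m. \<xi> i \<omega>)) \<partial>lborel) =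
        f (\<lambda>i\<in>{..<N}. \<xi> i \<omega>) * (\<integral>\<^sup>+z. ennreal (gauss_shift (real m * d) z (\<Sum>i<m. \<xi> i \<omega>)) \<partial>lborel)"
      unfolding gauss_shift_def by (intro nn_integral_cmult) measurable
    then show "ennreal \<kappa> * f (\<lambda>i\<in>{..<N}. \<xi> i \<omega>) \<le>
        (\<integral>\<^sup>+z. f (\<lambda>i\<in>{..<N}. \<xi> i \<omega>) * ennreal (gauss_shift (real m * d) z (\<Sum>i<m. \<xi> i \<omega>)) \<partial>lborel)"
      using mult_left_mono[OF \<kappa>, of "f (\<lambda>i\<in>{..<N}. \<xi> i \<omega>)"] by (simp add: mult.commute)
  qed
  also have "\<dots> = (\<integral>\<^sup>+z. (\<integral>\<^sup>+\<omega>. f (\<lambda>i\<in>{..<N}. \<xi> i \<omega>) * ennreal (gauss_shift (real m * d) z (\<Sum>i<m. \<xi> i \<omega>)) \<partial>M) \<partial>lborel)"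
    unfolding gauss_shift_def by (intro P.Fubini'[symmetric]) measurable
  also have "\<dots> = (\<integral>\<^sup>+z. (\<integral>\<^sup>+\<omega>. f (\<lambda>i\<in>{..<N}. \<xi> i \<omega> + (if i < m then z /\<^sub>R real m else 0)) \<partial>M) \<partial>lborel)"
  proof (rule nn_integral_cong)
    fix z :: "real ^ 'n"
    show "(\<integral>\<^sup>+\<omega>. f (\<lambda>i\<in>{..<N}. \<xi> i \<omega>) * ennreal (gauss_shift (real m * d) z (\<Sum>i<m. \<xi> i \<omega>)) \<partial>M) =
        (\<integral>\<^sup>+\<omega>. f (\<lambda>i\<in>{..<N}. \<xi> i \<omega> + (if i < m then z /\<^sub>R real m else 0)) \<partial>M)"
      using m nn_integral_gauss_increments_shift[OF d _ indep distr f, of "\<lambda>i. if i < m then z /\<^sub>R real m else 0"]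
      by (simp add: prod_gauss_shift[OF m d])
  qed
  also have "\<dots> = (\<integral>\<^sup>+\<omega>. (\<integral>\<^sup>+z. f (\<lambda>i\<in>{..<N}. \<xi> i \<omega> + (if i < m then z /\<^sub>R real m else 0)) \<partial>lborel) \<partial>M)"
    using measurable_compose[OF m2 f] by (intro P.Fubini') (simp add: split_beta')
  finally show ?thesis .
qed

section \<open>The occupation functional and its expectation\<close>

lemma euler_cong:
  "(\<And>i. i < k \<Longrightarrow> \<xi> i = \<xi>' i) \<Longrightarrow> euler d c \<xi> x k = euler d c \<xi>' x k"
  by (induction k) auto

lemma killed_euler_cong:
  "(\<And>i. i < k \<Longrightarrow> \<xi> i = \<xi>' i) \<Longrightarrow> killed_euler d c V g k \<xi> y = killed_euler d c V g k \<xi>' y"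
proof (induction k arbitrary: \<xi> \<xi>' y)
  case (Suc k)
  have "killed_euler d c V g k (\<lambda>i. \<xi> (Suc i)) z = killed_euler d c V g k (\<lambda>i. \<xi>' (Suc i)) z" for z
    by (rule Suc.IH) (simp add: Suc.prems)
  then show ?case using Suc.prems[of 0] by simp
qed simp

lemma measurable_euler:
  assumes [measurable]: "c \<in> borel_measurable borel" "x \<in> borel_measurable S"
    and "\<And>i. i < k \<Longrightarrow> (\<lambda>w. \<xi> w i) \<in> borel_measurable S"
  shows "(\<lambda>w. euler d c (\<xi> w) (x w) k) \<in> borel_measurable S"
  using assms(3)
proof (induction k)
  case (Suc k)
  have [measurable]: "(\<lambda>w. euler d c (\<xi> w) (x w) k) \<in> borel_measurable S"
    "(\<lambda>w. \<xi> w k) \<in> borel_measurable S"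
    using Suc by auto
  show ?case by simp
qed simp

lemma measurable_killed_euler:
  assumes [measurable]: "c \<in> borel_measurable borel" "V \<in> borel_measurable borel" "g \<in> borel_measurable borel"
    and "y \<in> borel_measurable S" "\<And>i. i < k \<Longrightarrow> (\<lambda>w. \<xi> w i) \<in> borel_measurable S"
  shows "(\<lambda>w. killed_euler d c V g k (\<xi> w) (y w)) \<in> borel_measurable S"
  using assms(4,5)
proof (induction k arbitrary: \<xi> y)
  case 0
  then show ?case by simp
next
  case (Suc k)
  have [measurable]: "y \<in> borel_measurable S" "(\<lambda>w. \<xi> w 0) \<in> borel_measurable S"
    using Suc.prems by auto
  have [measurable]: "(\<lambda>w. killed_euler d c V g k (\<lambda>i. \<xi> w (Suc i)) (y w + d *\<^sub>R c (y w) + \<xi> w 0)) \<in> borel_measurable S"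
    by (rule Suc.IH) (auto intro: Suc.prems)
  show ?case by simp
qed

text \<open>The first \<open>m\<close> steps use the field \<open>a\<close> and no killing, the remaining ones \<open>c\<close> and \<open>V\<close>.\<close>

definition occupation ::
    "real \<Rightarrow> (real ^ 'n \<Rightarrow> real ^ 'n) \<Rightarrow> (real ^ 'n \<Rightarrow> real ^ 'n) \<Rightarrow> (real ^ 'n \<Rightarrow> real) \<Rightarrow>
      (real ^ 'n \<Rightarrow> real) \<Rightarrow> real ^ 'n \<Rightarrow> nat \<Rightarrow> nat \<Rightarrow> (nat \<Rightarrow> real ^ 'n) \<Rightarrow> real" where
  "occupation d a c V g x m k \<xi> =
    (\<Sum>j<k. d * killed_euler d c V g j (\<lambda>i. \<xi> (m + i)) (euler d a \<xi> x m))"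

definition increment :: "(real \<Rightarrow> 'a \<Rightarrow> real ^ 'n) \<Rightarrow> real \<Rightarrow> 'a \<Rightarrow> nat \<Rightarrow> real ^ 'n" where
  "increment B d \<omega> i = B (real (Suc i) * d) \<omega> - B (real i * d) \<omega>"

text \<open>Allows the noise to be restricted to the finitely many indices of the product
  space.\<close>

lemma occupation_cong:
  assumes "\<And>i. i < m + k \<Longrightarrow> \<xi> i = \<xi>' i"
  shows "occupation d a c V g x m k \<xi> = occupation d a c V g x m k \<xi>'"
proof -
  have e: "euler d a \<xi> x m = euler d a \<xi>' x m" by (rule euler_cong) (simp add: assms)
  have "killed_euler d c V g j (\<lambda>i. \<xi> (m + i)) y = killed_euler d c V g j (\<lambda>i. \<xi>' (m + i)) y" if "j < k" for j y
    by (rule killed_euler_cong) (use that assms in simp)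
  then show ?thesis unfolding occupation_def e by simp
qed

lemma measurable_occupation:
  assumes "a \<in> borel_measurable borel" "c \<in> borel_measurable borel" "V \<in> borel_measurable borel" "g \<in> borel_measurable borel"
    and "\<And>i. i < m + k \<Longrightarrow> (\<lambda>w. \<xi> w i) \<in> borel_measurable S"
  shows "(\<lambda>w. occupation d a c V g x m k (\<xi> w)) \<in> borel_measurable S"
  unfolding occupation_def
  by (intro borel_measurable_sum borel_measurable_times borel_measurable_const
      measurable_killed_euler measurable_euler assms) auto

context truncated_field
begin

text \<open>The shift is confined to the first \<open>m\<close> increments, so it enters only
  through the position \<open>F z\<close> after \<open>m\<close> steps; from there on the functional
  is a fixed \<open>Q\<close>. As \<open>F\<close> has a 2-Lipschitz inverse, the image of Lebesgue
  measure under \<open>F\<close> is at most 4^n times Lebesgue measure, and \<open>int\<close>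
  controls each summand of the integral of \<open>Q\<close>.\<close>

lemma integral_occupation_shift_le:
  fixes a :: "real ^ 'n \<Rightarrow> real ^ 'n"
  assumes g: "\<And>x. 0 \<le> g x" "\<And>x. g x \<le> A" "\<And>x y. \<bar>g x - g y\<bar> \<le> \<Lambda> * norm (x - y)"
      "\<And>x. x \<notin> cball 0 r \<Longrightarrow> g x = 0"
    and \<Lambda>: "0 \<le> \<Lambda>"
    and a: "\<And>x y. norm (a x - a y) \<le> La * norm (x - y)" and La: "0 \<le> La"
    and m: "0 < m" and d: "0 \<le> d" "3 * (real m * d * La) \<le> 1"
    and int: "\<And>j \<xi>. j < k \<Longrightarrow> (LINT y|lborel. killed_euler d c V g j \<xi> y) \<le> I"
  shows "(\<integral>\<^sup>+z. occupation d a c V g x m k (\<lambda>i. \<xi> i + (if i < m then z /\<^sub>R real m else 0)) \<partial>lborel)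
    \<le> ennreal (4 ^ CARD('n) * (real k * d * I))"
proof -
  define Q where "Q y = (\<Sum>j<k. d * killed_euler d c V g j (\<lambda>i. \<xi> (m + i)) y)" for y
  define F where "F z = euler d a (\<lambda>i. \<xi> i + z /\<^sub>R real m) x m" for z
  have eq: "occupation d a c V g x m k (\<lambda>i. \<xi> i + (if i < m then z /\<^sub>R real m else 0)) = Q (F z)" for z
  proof -
    have "euler d a (\<lambda>i. \<xi> i + (if i < m then z /\<^sub>R real m else 0)) x m = F z"
      unfolding F_def by (rule euler_cong) simp
    then show ?thesis by (simp add: occupation_def Q_def)
  qed
  have "continuous_on UNIV a" by (rule lipschitz_continuous_on[OF a])
  then have [measurable]: "F \<in> borel_measurable borel"
    unfolding F_def
    by (intro measurable_euler borel_measurable_continuous_onI) (auto intro!: continuous_intros)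
  have kcont: "continuous_on UNIV (killed_euler d c V g j \<xi>)" for j \<xi>
    by (rule lipschitz_continuous_on[where L = "(\<Lambda> + real j * d * LV * A) * (1 + d * L) ^ j"])
      (use killed_euler_lipschitz[OF d(1) g(1-3) \<Lambda>] in simp)
  have kint: "integrable lborel (killed_euler d c V g j \<xi>)" for j \<xi>
  proof -
    obtain p where p: "\<And>x. x \<notin> cball p (r + real j * d * C) \<Longrightarrow> killed_euler d c V g j \<xi> x = 0"
      using killed_euler_support[where g = g and r = r and k = j and \<xi> = \<xi>, OF d(1) g(4)] by blast
    show ?thesis by (rule integrable_continuous_zero_outside_cball[OF kcont p])
  qed
  have Q0: "0 \<le> Q y" for y
    unfolding Q_def using d killed_euler_bounds(1)[OF d(1) g(1,2)] by (intro sum_nonneg mult_nonneg_nonneg) auto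
  have "(\<integral>\<^sup>+z. Q (F z) \<partial>lborel) \<le> 4 ^ CARD('n) * (\<integral>\<^sup>+y. Q y \<partial>lborel)"
  proof (rule nn_integral_expanding_le)
    show "continuous_on UNIV Q" unfolding Q_def by (intro continuous_intros kcont)
    show "norm (z - z') \<le> 2 * norm (F z - F z')" for z z'
      unfolding F_def by (rule euler_shift_expanding[OF a La m d])
  qed (use Q0 in auto)
  also have "(\<integral>\<^sup>+y. Q y \<partial>lborel) = ennreal (LINT y|lborel. Q y)"
    using Q0 kint by (intro nn_integral_eq_integral) (auto simp: Q_def)
  also have "(LINT y|lborel. Q y) = (\<Sum>j<k. d * (LINT y|lborel. killed_euler d c V g j (\<lambda>i. \<xi> (m + i)) y))"
    unfolding Q_def using kint by (subst Bochner_Integration.integral_sum) auto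
  also have "\<dots> \<le> (\<Sum>j<k. d * I)"
    using d int by (intro sum_mono mult_left_mono) auto
  also have "\<dots> = real k * d * I" by simp
  finally have "(\<integral>\<^sup>+z. Q (F z) \<partial>lborel) \<le> 4 ^ CARD('n) * ennreal (real k * d * I)"
    by (simp add: ennreal_leI mult_left_mono)
  then show ?thesis unfolding eq by (simp add: ennreal_mult' ennreal_power[symmetric])
qed

text \<open>Joins the averaged shift with the almost-preservation of Lebesgue measure. The constants
  \<open>L\<close>, \<open>LV\<close> and \<open>C\<close> of the truncation, like \<open>A\<close>,
  \<open>\<Lambda>\<close> and \<open>r\<close>, decide only from which \<open>m\<close> on the
  bound holds; the bound itself sees the truncation only through the integral of
  \<open>g\<close>.\<close>

lemma expectation_occupation_le:
  fixes a :: "real ^ 'n \<Rightarrow> real ^ 'n" and B :: "real \<Rightarrow> 'a \<Rightarrow> real ^ 'n"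
  assumes bm: "brownian_motion M B"
    and g: "\<And>x. 0 \<le> g x" "\<And>x. g x \<le> A" "\<And>x y. \<bar>g x - g y\<bar> \<le> \<Lambda> * norm (x - y)"
      "\<And>x. x \<notin> cball 0 r \<Longrightarrow> g x = 0"
    and \<Lambda>: "0 \<le> \<Lambda>"
    and a: "\<And>x y. norm (a x - a y) \<le> La * norm (x - y)" and La: "0 \<le> La"
    and t: "0 < t" "3 * (t * La) \<le> 1"
    and \<kappa>: "\<And>S :: real ^ 'n. ennreal \<kappa> \<le> (\<integral>\<^sup>+z. ennreal (gauss_shift t z S) \<partial>lborel)"
  shows "\<forall>\<^sub>F m in sequentially.
    ennreal \<kappa> * (\<integral>\<^sup>+\<omega>. occupation (t / real m) a c V g x m (K * m) (increment B (t / real m) \<omega>) \<partial>M)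
      \<le> ennreal (4 ^ CARD('n) * (real K * t * ((LINT y|lborel. g y) + 1)))"
proof -
  interpret brownian_motion M B by (rule bm)
  let ?T = "real K * t"
  \<comment> \<open>With 1 / (T + 1) as the error per unit of time, the accumulated error over time
    T is at most 1, the summand in the claim.\<close>
  have T: "0 \<le> ?T" "0 < 1 / (?T + 1)" using t by (auto intro!: add_nonneg_pos)
  have gc: "continuous_on UNIV g" by (rule lipschitz_continuous_on[of g \<Lambda>]) (use g(3) in simp)
  have meas: "a \<in> borel_measurable borel" "c \<in> borel_measurable borel" "V \<in> borel_measurable borel"
      "g \<in> borel_measurable borel"
    using lipschitz_continuous_on[OF a] c_cont V_cont gc by (auto intro: borel_measurable_continuous_onI)
  obtain d0 where d0: "0 < d0" and int: "\<And>d k \<xi>. \<lbrakk>0 \<le> d; d \<le> d0; real k * d \<le> ?T\<rbrakk> \<Longrightarrow>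
      (LINT y|lborel. killed_euler d c V g k \<xi> y) \<le> (LINT y|lborel. g y) + real k * d * (1 / (?T + 1))"
    using integral_killed_euler_le[OF g \<Lambda> T] by blast
  have "\<forall>\<^sub>F m in sequentially. t / real m \<le> d0"
    using d0 by real_asymp
  then show ?thesis
    using eventually_gt_at_top[of 0]
  proof eventually_elim
    case (elim m)
    define d where "d = t / real m"
    have d: "0 < d" "d \<le> d0" "real m * d = t" using t elim by (auto simp: d_def)
    \<comment> \<open>\<open>m\<close> steps cover [0, t]; the other \<open>K * m\<close> cover a
      further time \<open>real K * t\<close>.\<close>
    define N where "N = m + K * m"
    define f where "f \<xi> = ennreal (occupation d a c V g x m (K * m) \<xi>)" for \<xi>
    have "indep_vars (\<lambda>_. borel) (\<lambda>i \<omega>. increment B d \<omega> i) {..<N}"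
      unfolding increment_def using d
      by (intro increments_indep[of "\<lambda>i. real i * d" N]) (auto intro!: incseq_SucI mult_right_mono)
    moreover have "distributed M lborel (\<lambda>\<omega>. increment B d \<omega> i) (\<lambda>y. ennreal (gauss_density d y))" for i
    proof -
      have "real (Suc i) * d - real i * d = d" by (simp add: algebra_simps)
      then show ?thesis
        using increments_normal[of "real i * d" "real (Suc i) * d"] d
        unfolding increment_def gauss_density_def by (simp del: of_nat_Suc)
    qed
    moreover have "f \<in> borel_measurable (PiM {..<N} (\<lambda>_. borel))"
      unfolding f_def
      by (intro measurable_compose[OF measurable_occupation[OF meas] measurable_ennreal]
          measurable_component_singleton) (simp add: N_def)
    ultimately have "ennreal \<kappa> * (\<integral>\<^sup>+\<omega>. f (\<lambda>i\<in>{..<N}. increment B d \<omega> i) \<partial>M) \<le>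
        (\<integral>\<^sup>+\<omega>. (\<integral>\<^sup>+z. f (\<lambda>i\<in>{..<N}. increment B d \<omega> i + (if i < m then z /\<^sub>R real m else 0)) \<partial>lborel) \<partial>M)"
      using \<kappa> d elim by (intro gauss_increments_average_shift[of m N d \<kappa>]) (auto simp: N_def)
    also have "\<dots> \<le> (\<integral>\<^sup>+\<omega>. ennreal (4 ^ CARD('n) * (?T * ((LINT y|lborel. g y) + 1))) \<partial>M)"
    proof (rule nn_integral_mono)
      fix \<omega>
      have "(\<integral>\<^sup>+z. f (\<lambda>i\<in>{..<N}. increment B d \<omega> i + (if i < m then z /\<^sub>R real m else 0)) \<partial>lborel) =
          (\<integral>\<^sup>+z. occupation d a c V g x m (K * m) (\<lambda>i. increment B d \<omega> i + (if i < m then z /\<^sub>R real m else 0)) \<partial>lborel)"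
        unfolding f_def by (intro nn_integral_cong arg_cong[of _ _ ennreal] occupation_cong) (simp add: N_def)
      also have "\<dots> \<le> ennreal (4 ^ CARD('n) * (real (K * m) * d * ((LINT y|lborel. g y) + 1)))"
      proof (rule integral_occupation_shift_le[OF g \<Lambda> a La])
        fix j \<xi> assume "j < K * m"
        then have "real j * d \<le> real (K * m) * d"
          using d by (intro mult_right_mono) (auto simp del: of_nat_mult)
        also have "\<dots> = ?T" using d(3) by (simp add: mult.assoc)
        finally have jd: "real j * d \<le> ?T" .
        then have "real j * d * (1 / (?T + 1)) \<le> 1" using T(1) by (simp add: divide_le_eq)
        then show "(LINT y|lborel. killed_euler d c V g j \<xi> y) \<le> (LINT y|lborel. g y) + 1"
          using int[of d j \<xi>] d jd by simp
      qed (use elim d t in auto)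
      also have "real (K * m) * d = ?T" using d(3) by (simp add: mult.assoc)
      finally show "(\<integral>\<^sup>+z. f (\<lambda>i\<in>{..<N}. increment B d \<omega> i + (if i < m then z /\<^sub>R real m else 0)) \<partial>lborel)
          \<le> ennreal (4 ^ CARD('n) * (?T * ((LINT y|lborel. g y) + 1)))" .
    qed
    also have "\<dots> = ennreal (4 ^ CARD('n) * (?T * ((LINT y|lborel. g y) + 1)))"
      by (simp add: emeasure_space_1)
    also have "(\<integral>\<^sup>+\<omega>. f (\<lambda>i\<in>{..<N}. increment B d \<omega> i) \<partial>M) =
        (\<integral>\<^sup>+\<omega>. occupation d a c V g x m (K * m) (increment B d \<omega>) \<partial>M)"
      unfolding f_def by (intro nn_integral_cong arg_cong[of _ _ ennreal] occupation_cong) (simp add: N_def)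
    finally show ?case by (simp add: d_def)
  qed
qed

end

subsection \<open>Convergence of the Euler scheme\<close>

text \<open>Peels off the first step of \<open>euler\<close> instead of the last, to match the
  recursion of \<open>killed_euler\<close>.\<close>

lemma euler_Suc_shift:
  "euler d c (\<lambda>i. \<xi> (Suc i)) (y + d *\<^sub>R c y + \<xi> 0) k = euler d c \<xi> y (Suc k)"
  by (induction k) auto

lemma killed_euler_eq:
  assumes "\<And>i. i < k \<Longrightarrow> V (euler d c \<xi> y i) = 0"
  shows "killed_euler d c V g k \<xi> y = g (euler d c \<xi> y k)"
  using assms
proof (induction k arbitrary: \<xi> y)
  case (Suc k)
  have "killed_euler d c V g k (\<lambda>i. \<xi> (Suc i)) (y + d *\<^sub>R c y + \<xi> 0) = g (euler d c \<xi> y (Suc k))"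
    using Suc.prems by (subst Suc.IH) (auto simp only: euler_Suc_shift Suc_less_eq)
  then show ?case using Suc.prems[of 0] by simp
qed simp

text \<open>Discrete Gronwall inequality for a sequence \<open>p\<close> that satisfies the Euler
  recursion up to a defect d \<eta> in each step: a step multiplies the error by at most 1 + d L
  \<le> exp(d L) and adds the defect.\<close>

lemma euler_error:
  fixes p :: "nat \<Rightarrow> real ^ 'n"
  assumes c: "\<And>x y. norm (c x - c y) \<le> L * norm (x - y)" and L: "0 \<le> L" and d: "0 \<le> d"
    and e0: "norm (y - p 0) \<le> e0" and \<eta>: "0 \<le> \<eta>"
    and p: "\<And>i. i < k \<Longrightarrow> norm (p (Suc i) - p i - d *\<^sub>R c (p i) - \<xi> i) \<le> d * \<eta>"
  shows "norm (euler d c \<xi> y k - p k) \<le> (e0 + real k * d * \<eta>) * exp (real k * d * L)"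
  using p
proof (induction k)
  case 0
  then show ?case using e0 by simp
next
  case (Suc k)
  let ?E = "euler d c \<xi> y k"
  have e00: "0 \<le> e0" using e0 norm_ge_zero order_trans by blast
  have IH: "norm (?E - p k) \<le> (e0 + real k * d * \<eta>) * exp (real k * d * L)"
    using Suc by simp
  have "euler d c \<xi> y (Suc k) - p (Suc k) =
      (?E - p k) + d *\<^sub>R (c ?E - c (p k)) - (p (Suc k) - p k - d *\<^sub>R c (p k) - \<xi> k)"
    by (simp add: algebra_simps)
  also have "norm \<dots> \<le> norm (?E - p k) + norm (d *\<^sub>R (c ?E - c (p k))) + d * \<eta>"
    by (rule order_trans[OF norm_triangle_ineq4 add_mono[OF norm_triangle_ineq Suc.prems[OF lessI]]])
  also have "norm (d *\<^sub>R (c ?E - c (p k))) \<le> d * (L * norm (?E - p k))"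
    using c d by (simp add: mult_left_mono)
  also have "norm (?E - p k) + d * (L * norm (?E - p k)) + d * \<eta> = (1 + d * L) * norm (?E - p k) + d * \<eta>"
    by (simp add: algebra_simps)
  also have "\<dots> \<le> exp (d * L) * ((e0 + real k * d * \<eta>) * exp (real k * d * L)) + d * \<eta> * exp (real (Suc k) * d * L)"
  proof (rule add_mono)
    show "(1 + d * L) * norm (?E - p k) \<le> exp (d * L) * ((e0 + real k * d * \<eta>) * exp (real k * d * L))"
      using IH by (intro mult_mono exp_ge_add_one_self) auto
    have "1 \<le> exp (real (Suc k) * d * L)" using d L by simp
    then have "d * \<eta> * 1 \<le> d * \<eta> * exp (real (Suc k) * d * L)"
      using d \<eta> by (intro mult_left_mono) auto
    then show "d * \<eta> \<le> d * \<eta> * exp (real (Suc k) * d * L)" by simp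
  qed
  also have "\<dots> = (e0 + real (Suc k) * d * \<eta>) * exp (real (Suc k) * d * L)"
    by (simp add: algebra_simps exp_add)
  finally show ?case by simp
qed

text \<open>The scheme is driven by the true increments of \<open>w\<close>, so they cancel and the
  defect of a step is the oscillation of the drift, integrated over it.\<close>

lemma integral_equation_increment:
  fixes X w :: "real \<Rightarrow> real ^ 'n"
  assumes s: "\<And>r. 0 \<le> r \<Longrightarrow> r \<le> s \<Longrightarrow> X r = x + w r + integral {0..r} h"
    and h: "continuous_on {0..s} h"
    and uv: "0 \<le> u" "u \<le> v" "v \<le> s"
    and \<eta>: "\<And>r. u \<le> r \<Longrightarrow> r \<le> v \<Longrightarrow> norm (h r - h u) \<le> \<eta>"
  shows "norm (X v - X u - (v - u) *\<^sub>R h u - (w v - w u)) \<le> (v - u) * \<eta>"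
proof -
  have hi: "h integrable_on {p..q}" if "0 \<le> p" "q \<le> s" for p q
    by (rule integrable_continuous_real) (use that in \<open>auto intro: continuous_on_subset[OF h]\<close>)
  have "integral {0..v} h = integral {0..u} h + integral {u..v} h"
    using uv by (intro Henstock_Kurzweil_Integration.integral_combine[symmetric] hi) auto
  then have "X v - X u - (v - u) *\<^sub>R h u - (w v - w u) = integral {u..v} h - (v - u) *\<^sub>R h u"
    using s[of u] s[of v] uv by simp
  also have "\<dots> = integral {u..v} (\<lambda>r. h r - h u)"
    using uv by (subst Henstock_Kurzweil_Integration.integral_diff[OF hi]) auto
  also have "norm \<dots> \<le> \<eta> * (v - u)"
    using uv \<eta> by (intro integral_bound continuous_on_diff continuous_on_const continuous_on_subset[OF h]) auto
  finally show ?thesis by (simp add: mult.commute)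
qed

lemma le_one_plus_square: "(x :: real) \<le> 1 + x\<^sup>2"
  using zero_le_power2[of "x - 1 / 2"] by (simp add: power2_eq_square algebra_simps)

context truncated_field
begin

text \<open>For a fine mesh the Euler points after time \<open>t\<close> stay within 1 of the path,
  hence in the ball of radius \<open>R\<close>, where \<open>c\<close> is \<open>b\<close>, the
  killing is absent and \<open>g\<close> is |b|^2. The occupation sum then bounds the drift
  displacement after \<open>t\<close>. The 3 collects three unit errors: at time \<open>t\<close>,
  at the last grid point before \<open>s\<close>, and between that point and \<open>s\<close>. A
  noise increment is at most \<open>2 * W\<close>.\<close>

lemma norm_solution_le_occupation:
  fixes X w :: "real \<Rightarrow> real ^ 'n" and a :: "real ^ 'n \<Rightarrow> real ^ 'n"
  assumes X: "continuous_on {0..s} X"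
      "\<And>r. 0 \<le> r \<Longrightarrow> r \<le> s \<Longrightarrow> X r = x + w r + integral {0..r} (\<lambda>r. b (X r))" and X0: "X 0 = x"
    and t: "0 < t" "t \<le> s" "s \<le> real K * t"
    and a: "\<And>x y. norm (a x - a y) \<le> La * norm (x - y)" and La: "0 \<le> La"
    and aX: "\<And>r. 0 \<le> r \<Longrightarrow> r \<le> t \<Longrightarrow> a (X r) = b (X r)"
    and R: "\<And>r. 0 \<le> r \<Longrightarrow> r \<le> s \<Longrightarrow> norm (X r) + 1 < R"
    and eqR: "\<And>y. norm y < R \<Longrightarrow> c y = b y" "\<And>y. norm y < R \<Longrightarrow> V y = 0"
      "\<And>y. norm y < R \<Longrightarrow> g y = (norm (b y))\<^sup>2"
    and g: "\<And>y. 0 \<le> g y" "\<And>y. g y \<le> A"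
    and w: "\<And>r. 0 \<le> r \<Longrightarrow> r \<le> s \<Longrightarrow> norm (w r) \<le> W"
  shows "\<forall>\<^sub>F m in sequentially. norm (X s) \<le> 3 + norm (X t) + 2 * W + s
    + occupation (t / real m) a c V g x m (K * m) (\<lambda>i. w (real (Suc i) * (t / real m)) - w (real i * (t / real m)))"
proof -
  define h where "h r = b (X r)" for r
  have h: "continuous_on {0..s} h"
    unfolding h_def by (rule continuous_on_compose2[OF b_cont X(1)]) auto
  \<comment> \<open>\<open>euler_error\<close> is applied twice, with \<open>La\<close> up to time
    \<open>t\<close> and with \<open>L\<close> after it. A defect of d \<eta> per step then gives an
    error of at most \<eta> (D - 1), so \<eta> = 1 / D keeps the scheme within 1 of
    \<open>X\<close>.\<close>
  define D where "D = ((s * exp (s * La)) + s) * exp (s * L) + 1"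
  have s0: "0 < s" using t by simp
  have D: "0 < D" using s0 by (auto simp: D_def intro!: add_nonneg_pos mult_nonneg_nonneg add_nonneg_nonneg)
  define \<eta> where "\<eta> = 1 / D"
  have \<eta>: "0 < \<eta>" "((s * \<eta> * exp (s * La)) + s * \<eta>) * exp (s * L) \<le> 1"
    and \<eta>': "s * \<eta> * exp (s * La) \<le> 1"
  proof -
    show "0 < \<eta>" using D by (simp add: \<eta>_def)
    have "((s * \<eta> * exp (s * La)) + s * \<eta>) * exp (s * L) = \<eta> * (D - 1)"
      by (simp add: D_def algebra_simps)
    also have "\<dots> \<le> 1" using D by (simp add: \<eta>_def field_simps)
    finally show *: "((s * \<eta> * exp (s * La)) + s * \<eta>) * exp (s * L) \<le> 1" .
    have "s * \<eta> * exp (s * La) * 1 \<le> ((s * \<eta> * exp (s * La)) + s * \<eta>) * exp (s * L)"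
      using s0 \<open>0 < \<eta>\<close> nonneg by (intro mult_mono) auto
    with * show "s * \<eta> * exp (s * La) \<le> 1" by simp
  qed
  have "uniformly_continuous_on {0..s} h" "uniformly_continuous_on {0..s} X"
    using h X(1) by (auto intro: compact_uniformly_continuous)
  then obtain e1 e2 where e1: "0 < e1" "\<And>u v. u \<in> {0..s} \<Longrightarrow> v \<in> {0..s} \<Longrightarrow> dist v u < e1 \<Longrightarrow> dist (h v) (h u) < \<eta>"
    and e2: "0 < e2" "\<And>u v. u \<in> {0..s} \<Longrightarrow> v \<in> {0..s} \<Longrightarrow> dist v u < e2 \<Longrightarrow> dist (X v) (X u) < 1"
    unfolding uniformly_continuous_on_def using \<eta>(1) zero_less_one by metis
  have "\<forall>\<^sub>F m in sequentially. t / real m < min e1 e2"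
    using e1(1) e2(1) by real_asymp
  then show ?thesis
    using eventually_gt_at_top[of 0]
  proof eventually_elim
    case (elim m)
    define d where "d = t / real m"
    define \<xi> where "\<xi> i = w (real (Suc i) * d) - w (real i * d)" for i
    have d: "0 < d" "d < e1" "d < e2" "real m * d = t" using t elim by (auto simp: d_def)
    define J where "J = nat \<lfloor>s / d\<rfloor>"
    have J: "real J * d \<le> s" "s < real (Suc J) * d"
    proof -
      have "real J \<le> s / d" "s / d < real (Suc J)"
        using s0 d(1) by (auto simp: J_def of_nat_floor) linarith
      then show "real J * d \<le> s" "s < real (Suc J) * d"
        using d(1) by (auto simp: field_simps)
    qed
    have mJ: "m \<le> J"
    proof -
      have "real m * d < real (Suc J) * d" using J(2) t(2) d(4) by linarith
      then show ?thesis using d(1) by simp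
    qed
    have JK: "J \<le> K * m"
    proof -
      have "real J * d \<le> real (K * m) * d" using J(1) t(3) d(4) by (simp add: mult.assoc)
      then show ?thesis using d(1) by (simp del: of_nat_mult)
    qed
    have le_s: "real i * d \<le> s" if "i \<le> J" for i
    proof -
      have "real i * d \<le> real J * d" using that d(1) by (intro mult_right_mono) auto
      then show ?thesis using J(1) by linarith
    qed
    have step: "norm (X (real (Suc i) * d) - X (real i * d) - d *\<^sub>R h (real i * d) - \<xi> i) \<le> d * \<eta>"
      if "i < J" for i
    proof -
      have "norm (X (real (Suc i) * d) - X (real i * d) - (real (Suc i) * d - real i * d) *\<^sub>R h (real i * d)
          - (w (real (Suc i) * d) - w (real i * d))) \<le> (real (Suc i) * d - real i * d) * \<eta>"
      proof (rule integral_equation_increment[of s X x w h])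
        show "X r = x + w r + integral {0..r} h" if "0 \<le> r" "r \<le> s" for r
          using X(2)[OF that] by (simp add: h_def[abs_def])
        show "real (Suc i) * d \<le> s" using le_s[of "Suc i"] that by simp
        fix r assume r: "real i * d \<le> r" "r \<le> real (Suc i) * d"
        have i0: "0 \<le> real i * d" using d by simp
        have "r \<le> s" using r(2) le_s[of "Suc i"] that by linarith
        moreover have "dist r (real i * d) < e1" using r d by (auto simp: dist_real_def algebra_simps)
        ultimately have "dist (h r) (h (real i * d)) < \<eta>"
          using e1(2)[of "real i * d" r] r(1) i0 le_s[of i] that by simp
        then show "norm (h r - h (real i * d)) \<le> \<eta>" by (simp add: dist_norm)
      qed (use d h in \<open>auto simp: mult_right_mono\<close>)
      then show ?thesis by (simp add: \<xi>_def algebra_simps)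
    qed
    define Y where "Y = euler d a \<xi> x m"
    have "norm (Y - X (real m * d)) \<le> (0 + real m * d * \<eta>) * exp (real m * d * La)"
      unfolding Y_def
    proof (rule euler_error[OF a La])
      show "norm (X (real (Suc i) * d) - X (real i * d) - d *\<^sub>R a (X (real i * d)) - \<xi> i) \<le> d * \<eta>" if "i < m" for i
      proof -
        have "real i * d \<le> real m * d" using that d by (intro mult_right_mono) auto
        then show ?thesis using step[of i] that mJ aX[of "real i * d"] d by (simp add: h_def)
      qed
    qed (use d \<eta> X0 in auto)
    also have "\<dots> \<le> s * \<eta> * exp (s * La)"
      unfolding d(4) using t \<eta> La by (auto intro!: mult_mono)
    finally have Y: "norm (Y - X t) \<le> s * \<eta> * exp (s * La)" by (simp add: d(4))
    define Z where "Z k = euler d c (\<lambda>i. \<xi> (m + i)) Y k" for k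
    have Z: "norm (Z k - X (real (m + k) * d)) \<le> 1" if "m + k \<le> J" for k
    proof -
      have "norm (Z k - X (real (m + k) * d)) \<le> (s * \<eta> * exp (s * La) + real k * d * \<eta>) * exp (real k * d * L)"
        unfolding Z_def
      proof (rule euler_error[OF c_lip nonneg(1), where p = "\<lambda>k. X (real (m + k) * d)"])
        show "norm (X (real (m + Suc i) * d) - X (real (m + i) * d) - d *\<^sub>R c (X (real (m + i) * d)) - \<xi> (m + i)) \<le> d * \<eta>"
          if "i < k" for i
        proof -
          have "norm (X (real (m + i) * d)) < R"
            using R[of "real (m + i) * d"] le_s[of "m + i"] that \<open>m + k \<le> J\<close> d by simp
          then show ?thesis
            using step[of "m + i"] that \<open>m + k \<le> J\<close> by (simp add: h_def eqR)
        qed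
      qed (use d \<eta> Y in auto)
      also have "\<dots> \<le> (s * \<eta> * exp (s * La) + s * \<eta>) * exp (s * L)"
      proof -
        have "real k * d \<le> s" using le_s[of k] that by simp
        then show ?thesis
          using s0 \<eta> nonneg d by (intro mult_mono add_left_mono) (auto intro!: mult_right_mono)
      qed
      finally show ?thesis using \<eta>(2) by simp
    qed
    have ZR: "norm (Z k) < R" if "m + k \<le> J" for k
    proof -
      have "norm (Z k) \<le> norm (X (real (m + k) * d)) + 1"
        using Z[OF that] norm_triangle_ineq2[of "Z k" "X (real (m + k) * d)"] by linarith
      then show ?thesis using R[of "real (m + k) * d"] le_s[OF that] d by simp
    qed
    have killed: "killed_euler d c V g k (\<lambda>i. \<xi> (m + i)) Y = (norm (b (Z k)))\<^sup>2" if "m + k \<le> J" for k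
    proof -
      have "V (euler d c (\<lambda>i. \<xi> (m + i)) Y i) = 0" if "i < k" for i
        using ZR[of i] that \<open>m + k \<le> J\<close> by (simp add: eqR flip: Z_def)
      then show ?thesis
        using ZR[OF that] by (subst killed_euler_eq) (auto simp: eqR simp flip: Z_def)
    qed
    have "(\<Sum>k<J - m. d * (norm (b (Z k)))\<^sup>2) = (\<Sum>k<J - m. d * killed_euler d c V g k (\<lambda>i. \<xi> (m + i)) Y)"
      using killed by (intro sum.cong) auto
    \<comment> \<open>The terms of the occupation sum beyond time \<open>s\<close> are
      nonnegative.\<close>
    also have "\<dots> \<le> occupation d a c V g x m (K * m) \<xi>"
      unfolding occupation_def Y_def[symmetric] using JK d killed_euler_bounds(1)[OF _ g]
      by (intro sum_mono2) auto
    finally have occ: "(\<Sum>k<J - m. d * (norm (b (Z k)))\<^sup>2) \<le> occupation d a c V g x m (K * m) \<xi>" .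
    have "Z k = Y + (\<Sum>j<k. d *\<^sub>R b (Z j)) + (w (real (m + k) * d) - w t)" if "m + k \<le> J" for k
      using that
    proof (induction k)
      case 0
      then show ?case by (simp add: Z_def d(4))
    next
      case (Suc k)
      have "Z (Suc k) = Z k + d *\<^sub>R b (Z k) + \<xi> (m + k)"
        using ZR[of k] Suc.prems by (simp add: Z_def eqR)
      then show ?case using Suc by (simp add: \<xi>_def)
    qed
    from this[of "J - m"] have "Z (J - m) = Y + (\<Sum>j<J - m. d *\<^sub>R b (Z j)) + (w (real J * d) - w t)"
      using mJ by simp
    also have "norm \<dots> \<le> norm Y + norm (\<Sum>j<J - m. d *\<^sub>R b (Z j)) + (norm (w (real J * d)) + norm (w t))"
      by (intro order_trans[OF norm_triangle_ineq] add_mono norm_triangle_ineq norm_triangle_ineq4)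
    \<comment> \<open>Here the displacement is paid for by |b|^2: the 1 in |b| \<le> 1 + |b|^2 adds
      up to the elapsed time.\<close>
    also have "norm (\<Sum>j<J - m. d *\<^sub>R b (Z j)) \<le> (\<Sum>j<J - m. d * (1 + (norm (b (Z j)))\<^sup>2))"
      using d by (intro order_trans[OF norm_sum] sum_mono) (auto intro!: mult_left_mono le_one_plus_square)
    also have "\<dots> = real (J - m) * d + (\<Sum>k<J - m. d * (norm (b (Z k)))\<^sup>2)"
      by (simp add: distrib_left sum.distrib)
    also have "real (J - m) * d \<le> s" by (rule le_s) simp
    also have "norm (w (real J * d)) \<le> W" using w[of "real J * d"] J(1) d by simp
    also have "norm (w t) \<le> W" using w[of t] t by simp
    also have "norm Y \<le> norm (X t) + 1"
      using Y \<eta>' norm_triangle_ineq2[of Y "X t"] by linarith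
    finally have "norm (Z (J - m)) \<le> norm (X t) + 1 + (s + (\<Sum>k<J - m. d * (norm (b (Z k)))\<^sup>2)) + (W + W)"
      by simp
    moreover have "norm (X (real J * d)) \<le> norm (Z (J - m)) + 1"
      using Z[of "J - m"] mJ norm_triangle_ineq3[of "Z (J - m)" "X (real J * d)"] by simp
    moreover have "norm (X s) \<le> norm (X (real J * d)) + 1"
    proof -
      have "dist s (real J * d) < e2" using J d by (auto simp: dist_real_def algebra_simps)
      then have "dist (X s) (X (real J * d)) < 1"
        using e2(2)[of "real J * d" s] J d s0 by simp
      then show ?thesis
        using norm_triangle_ineq2[of "X s" "X (real J * d)"] by (simp add: dist_norm)
    qed
    ultimately show ?case using occ unfolding \<xi>_def d_def by linarith
  qed
qed

end

subsection \<open>Truncation and conclusion\<close>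

lemma locally_lipschitz_on_cball:
  fixes b :: "real ^ 'n \<Rightarrow> real ^ 'n"
  assumes "locally_lipschitz b"
  obtains L where "0 \<le> L" "\<And>x y. x \<in> cball p r \<Longrightarrow> y \<in> cball p r \<Longrightarrow> norm (b x - b y) \<le> L * norm (x - y)"
proof -
  \<comment> \<open>The field is viewed as constant in a dummy time parameter, to use the
    compactness result for \<open>local_lipschitz\<close>.\<close>
  have "local_lipschitz {0 :: real} (cball p r) (\<lambda>_. b)"
  proof (rule local_lipschitzI)
    fix t :: real and x :: "real ^ 'n"
    obtain u L where "0 < u" "L-lipschitz_on (cball x u) b"
      using assms unfolding locally_lipschitz_def by blast
    then show "\<exists>u>0. \<exists>L. \<forall>t\<in>cball t u \<inter> {0 :: real}. L-lipschitz_on (cball x u \<inter> cball p r) b"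
      by (blast intro: lipschitz_on_subset)
  qed
  then obtain L where "L-lipschitz_on (cball p r) b"
    by (rule local_lipschitz_compact_implies_lipschitz) auto
  then show thesis
    by (intro that[of L]) (auto simp: lipschitz_on_def dist_norm)
qed

lemma locally_lipschitz_continuous:
  fixes b :: "real ^ 'n \<Rightarrow> real ^ 'n"
  assumes "locally_lipschitz b"
  shows "continuous_on UNIV b"
proof (rule continuous_at_imp_continuous_on, rule ballI)
  fix x
  obtain u L where u: "0 < u" "L-lipschitz_on (cball x u) b"
    using assms unfolding locally_lipschitz_def by blast
  from lipschitz_on_continuous_on[OF lipschitz_on_subset[OF u(2) ball_subset_cball]]
  have "\<forall>y\<in>ball x u. isCont b y" by (simp only: continuous_on_eq_continuous_at open_ball)
  then show "isCont b x" using u(1) by simp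
qed

text \<open>The collar of width 1 separates the cases: two points at distance below 1 lie both in
  the ball of radius r + 1 or both outside the ball of radius r, and for points further apart
  boundedness suffices, with slope \<open>2 * A\<close>.\<close>

lemma lipschitz_zero_outside_cball:
  fixes f :: "real ^ 'n \<Rightarrow> 'b :: real_normed_vector"
  assumes L: "0 \<le> L" "\<And>x y. norm x \<le> r + 1 \<Longrightarrow> norm y \<le> r + 1 \<Longrightarrow> norm (f x - f y) \<le> L * norm (x - y)"
    and z: "\<And>x. r < norm x \<Longrightarrow> f x = 0"
  obtains L' A where "0 \<le> L'" "\<And>x y. norm (f x - f y) \<le> L' * norm (x - y)" "\<And>x. norm (f x) \<le> A"
proof -
  define A where "A = norm (f 0) + L * \<bar>r\<bar>"
  have A: "norm (f x) \<le> A" for x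
  proof (cases "norm x \<le> r")
    case True
    then have "0 \<le> r" using norm_ge_zero order_trans by blast
    then have "norm (f x - f 0) \<le> L * norm x" using True L(2)[of x 0] by simp
    also have "\<dots> \<le> L * \<bar>r\<bar>" using True L(1) by (intro mult_left_mono) auto
    finally show ?thesis using norm_triangle_ineq2[of "f x" "f 0"] by (simp add: A_def)
  qed (use L(1) z in \<open>auto simp: A_def\<close>)
  have A0: "0 \<le> A" using A[of 0] norm_ge_zero order_trans by blast
  have "norm (f x - f y) \<le> (L + 2 * A) * norm (x - y)" for x y
  proof (cases "norm (x - y) < 1")
    case True
    have "norm (f x - f y) \<le> L * norm (x - y)"
    proof (cases "norm x \<le> r + 1 \<and> norm y \<le> r + 1")
      case True
      then show ?thesis by (intro L(2)) auto
    next
      case False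
      then have "r < norm x" "r < norm y"
        using norm_triangle_ineq2[of x y] norm_triangle_ineq2[of y x] \<open>norm (x - y) < 1\<close>
        by (auto simp: norm_minus_commute)
      then show ?thesis using L(1) by (simp add: z)
    qed
    also have "\<dots> \<le> (L + 2 * A) * norm (x - y)" using A0 by (intro mult_right_mono) auto
    finally show ?thesis .
  next
    case False
    have "norm (f x - f y) \<le> 2 * A * 1"
      using norm_triangle_ineq4[of "f x" "f y"] A[of x] A[of y] by simp
    also have "\<dots> \<le> (L + 2 * A) * norm (x - y)"
      using False A0 L(1) by (intro mult_mono) auto
    finally show ?thesis .
  qed
  then show thesis using A A0 L(1) by (intro that[of "L + 2 * A" A]) auto
qed

text \<open>Product estimates on the ball of radius r + 1, made global by
  \<open>lipschitz_zero_outside_cball\<close>. \<open>V\<close> differentiates only the smooth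
  \<psi>, so Lipschitz continuity of \<open>b\<close> carries over to it. All constants may grow
  with \<open>R\<close>.\<close>

lemma truncation_exists:
  fixes b :: "real ^ 'n \<Rightarrow> real ^ 'n" and R :: real
  assumes lip: "locally_lipschitz b" and div: "divergence_free b"
  obtains c \<psi> V L C LV r \<Lambda> A where "truncated_field b c \<psi> V L C LV"
    "\<And>y. 0 \<le> \<psi> y" "\<And>y. \<psi> y \<le> 1"
    "\<And>y. norm y < R \<Longrightarrow> \<psi> y = 1" "\<And>y. norm y < R \<Longrightarrow> V y = 0"
    "\<And>x. r < norm x \<Longrightarrow> \<psi> x = 0" "0 \<le> \<Lambda>"
    "\<And>x y. \<bar>\<psi> x * (norm (b x))\<^sup>2 - \<psi> y * (norm (b y))\<^sup>2\<bar> \<le> \<Lambda> * norm (x - y)"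
    "\<And>x. \<psi> x * (norm (b x))\<^sup>2 \<le> A"
proof -
  obtain \<psi> :: "real ^ 'n \<Rightarrow> real" where \<psi>: "test_function \<psi>" "\<And>x. 0 \<le> \<psi> x" "\<And>x. \<psi> x \<le> 1"
      "\<And>x. norm x < R \<Longrightarrow> \<psi> x = 1"
    using smooth_cutoff_exists[of R] by blast
  obtain r where r: "\<And>x. r < norm x \<Longrightarrow> \<psi> x = 0"
    using \<psi>(1) unfolding test_function_iff by blast
  obtain K1 where K1: "0 \<le> K1" "\<And>x y. \<bar>\<psi> x - \<psi> y\<bar> \<le> K1 * norm (x - y)"
    using test_function_lipschitz[OF \<psi>(1)] by blast
  obtain K2 where K2: "0 \<le> K2" "\<And>x y v. \<bar>frechet_derivative \<psi> (at x) v - frechet_derivative \<psi> (at y) v\<bar> \<le> K2 * norm (x - y) * norm v"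
    using test_function_derivative_lipschitz[OF \<psi>(1)] by blast
  obtain K3 where K3: "0 \<le> K3" "\<And>x v. \<bar>frechet_derivative \<psi> (at x) v\<bar> \<le> K3 * norm v"
    using test_function_derivative_le[OF \<psi>(1)] by blast
  obtain Lb where Lb: "0 \<le> Lb" "\<And>x y. norm x \<le> r + 1 \<Longrightarrow> norm y \<le> r + 1 \<Longrightarrow> norm (b x - b y) \<le> Lb * norm (x - y)"
    using locally_lipschitz_on_cball[OF lip, of 0 "r + 1"] by auto
  note bc = locally_lipschitz_continuous[OF lip]
  have "bounded (b ` cball 0 (r + 1))"
    by (intro compact_imp_bounded compact_continuous_image continuous_on_subset[OF bc]) auto
  then obtain H' where "\<forall>v\<in>b ` cball 0 (r + 1). norm v \<le> H'"
    unfolding bounded_iff by blast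
  then have H': "norm (b x) \<le> H'" if "norm x \<le> r + 1" for x
    using that by simp
  \<comment> \<open>Nothing excludes that the ball is empty, in which case \<open>H'\<close> could
    be negative.\<close>
  define H where "H = max H' 0"
  have H: "0 \<le> H" "\<And>x. norm x \<le> r + 1 \<Longrightarrow> norm (b x) \<le> H"
    using H' by (auto simp: H_def le_max_iff_disj)
  define c where "c y = \<psi> y *\<^sub>R b y" for y
  define V where "V y = \<bar>frechet_derivative \<psi> (at y) (b y)\<bar>" for y
  define g where "g y = \<psi> y * (norm (b y))\<^sup>2" for y
  have D0: "frechet_derivative \<psi> (at y) = (\<lambda>_. 0)" if "r < norm y" for y
    by (rule frechet_derivative_zero_on_open[of "{y. r < norm y}"])
      (auto intro!: open_Collect_less continuous_intros that r)
  obtain L C1 where c: "0 \<le> L" "\<And>x y. norm (c x - c y) \<le> L * norm (x - y)" "\<And>x. norm (c x) \<le> C1"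
  proof (rule lipschitz_zero_outside_cball[of "Lb + K1 * H" r c])
    show "0 \<le> Lb + K1 * H" using Lb K1 H by simp
    fix x y :: "real ^ 'n" assume xy: "norm x \<le> r + 1" "norm y \<le> r + 1"
    have "c x - c y = \<psi> x *\<^sub>R (b x - b y) + (\<psi> x - \<psi> y) *\<^sub>R b y"
      by (simp add: c_def algebra_simps)
    also have "norm \<dots> \<le> 1 * norm (b x - b y) + \<bar>\<psi> x - \<psi> y\<bar> * norm (b y)"
      using \<psi>(2,3) by (intro order_trans[OF norm_triangle_ineq] add_mono) (auto intro: mult_left_le_one_le)
    also have "\<dots> \<le> 1 * (Lb * norm (x - y)) + (K1 * norm (x - y)) * H"
      using Lb(2)[OF xy] K1 H xy by (intro add_mono mult_mono) auto
    finally show "norm (c x - c y) \<le> (Lb + K1 * H) * norm (x - y)" by (simp add: algebra_simps)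
  qed (auto simp: c_def r)
  obtain LV C2 where V: "0 \<le> LV" "\<And>x y. norm (V x - V y) \<le> LV * norm (x - y)" "\<And>x. norm (V x) \<le> C2"
  proof (rule lipschitz_zero_outside_cball[of "K3 * Lb + K2 * H" r V])
    show "0 \<le> K3 * Lb + K2 * H" using Lb K2 K3 H by simp
    fix x y :: "real ^ 'n" assume xy: "norm x \<le> r + 1" "norm y \<le> r + 1"
    have "norm (V x - V y) \<le> \<bar>frechet_derivative \<psi> (at x) (b x) - frechet_derivative \<psi> (at y) (b y)\<bar>"
      unfolding V_def by simp
    also have "frechet_derivative \<psi> (at x) (b x) - frechet_derivative \<psi> (at y) (b y) =
        frechet_derivative \<psi> (at x) (b x - b y) + (frechet_derivative \<psi> (at x) (b y) - frechet_derivative \<psi> (at y) (b y))"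
      using linear_diff[OF linear_frechet_derivative[OF test_function_differentiable[OF \<psi>(1)]], of x "b x" "b y"]
      by simp
    also have "\<bar>\<dots>\<bar> \<le> K3 * norm (b x - b y) + K2 * norm (x - y) * norm (b y)"
      by (intro order_trans[OF abs_triangle_ineq] add_mono K2 K3)
    also have "\<dots> \<le> K3 * (Lb * norm (x - y)) + K2 * norm (x - y) * H"
      using Lb(2)[OF xy] K2 K3 H xy by (intro add_mono mult_left_mono) auto
    finally show "norm (V x - V y) \<le> (K3 * Lb + K2 * H) * norm (x - y)" by (simp add: algebra_simps)
  qed (auto simp: V_def D0)
  obtain \<Lambda> A where g: "0 \<le> \<Lambda>" "\<And>x y. norm (g x - g y) \<le> \<Lambda> * norm (x - y)" "\<And>x. norm (g x) \<le> A"
  proof (rule lipschitz_zero_outside_cball[of "2 * H * Lb + K1 * H\<^sup>2" r g])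
    show "0 \<le> 2 * H * Lb + K1 * H\<^sup>2" using Lb K1 H by simp
    fix x y :: "real ^ 'n" assume xy: "norm x \<le> r + 1" "norm y \<le> r + 1"
    have sq: "\<bar>(norm (b x))\<^sup>2 - (norm (b y))\<^sup>2\<bar> \<le> 2 * H * (Lb * norm (x - y))"
    proof -
      have "(norm (b x))\<^sup>2 - (norm (b y))\<^sup>2 = (norm (b x) + norm (b y)) * (norm (b x) - norm (b y))"
        by (simp add: algebra_simps power2_eq_square)
      also have "\<bar>\<dots>\<bar> \<le> (norm (b x) + norm (b y)) * norm (b x - b y)"
        by (simp add: abs_mult norm_triangle_ineq3 mult_left_mono)
      also have "\<dots> \<le> (2 * H) * (Lb * norm (x - y))"
        using H(2)[OF xy(1)] H(2)[OF xy(2)] Lb(2)[OF xy] H(1) by (intro mult_mono) auto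
      finally show ?thesis .
    qed
    have "g x - g y = \<psi> x * ((norm (b x))\<^sup>2 - (norm (b y))\<^sup>2) + (\<psi> x - \<psi> y) * (norm (b y))\<^sup>2"
      by (simp add: g_def algebra_simps)
    also have "\<bar>\<dots>\<bar> \<le> 1 * \<bar>(norm (b x))\<^sup>2 - (norm (b y))\<^sup>2\<bar> + \<bar>\<psi> x - \<psi> y\<bar> * (norm (b y))\<^sup>2"
      using \<psi>(2,3)
      by (intro order_trans[OF abs_triangle_ineq] add_mono) (auto simp: abs_mult intro: mult_left_le_one_le)
    also have "\<dots> \<le> 1 * (2 * H * (Lb * norm (x - y))) + (K1 * norm (x - y)) * H\<^sup>2"
      using sq K1 H xy by (intro add_mono mult_mono power_mono) auto
    finally show "norm (g x - g y) \<le> (2 * H * Lb + K1 * H\<^sup>2) * norm (x - y)"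
      by (simp add: algebra_simps)
  qed (auto simp: g_def r)
  have "truncated_field b c \<psi> V L (max C1 C2) LV"
  proof
    show "norm (c x) \<le> max C1 C2" for x using c(3)[of x] by simp
    show "V x \<le> max C1 C2" for x using V(3)[of x] by simp
  qed (use \<psi>(1) div bc c V in \<open>auto simp: c_def V_def\<close>)
  moreover have "V y = 0" if "norm y < R" for y
  proof -
    have "open {y :: real ^ 'n. norm y < R}" by (intro open_Collect_less continuous_intros)
    then have "(\<psi> has_derivative (\<lambda>_. 0)) (at y)"
      using that \<psi>(4) by (intro has_derivative_transform_within_open[OF has_derivative_const]) auto
    from fun_cong[OF frechet_derivative_at[OF this], of "b y"] show ?thesis by (simp add: V_def)
  qed
  ultimately show thesis
    using \<psi>(2-4) r g that[of c \<psi> V L "max C1 C2" LV r \<Lambda> A] by (force simp: g_def)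
qed

lemma in_L2_integrable:
  fixes b :: "real ^ 'n \<Rightarrow> real ^ 'n"
  assumes "in_Lp 2 b"
  shows "integrable lborel (\<lambda>y. (norm (b y))\<^sup>2)"
proof -
  have "integrable lborel (\<lambda>x. norm (b x) powr real_of_ereal 2)"
    using assms by (simp add: in_Lp_def)
  moreover have "norm (b x) powr real_of_ereal 2 = (norm (b x))\<^sup>2" for x
    by (simp add: powr_numeral)
  ultimately show ?thesis by simp
qed

text \<open>The functional \<open>H m\<close> dominates the solution as long as it stays in the ball of radius
  \<open>R - 1\<close>, while the bound on its expectation does not depend on \<open>R\<close>.\<close>

lemma dominating_functional:
  fixes b a :: "real ^ 'n \<Rightarrow> real ^ 'n" and B :: "real \<Rightarrow> 'a \<Rightarrow> real ^ 'n" and R :: real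
  assumes lip: "locally_lipschitz b" and div: "divergence_free b" and L2: "in_Lp 2 b"
    and bm: "brownian_motion M B"
    and a: "\<And>x y. norm (a x - a y) \<le> La * norm (x - y)" and La: "0 \<le> La"
    and t: "0 < t" "3 * (t * La) \<le> 1"
    and \<kappa>: "\<And>S :: real ^ 'n. ennreal \<kappa> \<le> (\<integral>\<^sup>+z. ennreal (gauss_shift t z S) \<partial>lborel)"
  obtains H :: "nat \<Rightarrow> 'a \<Rightarrow> real" where
    "\<And>m. H m \<in> borel_measurable M"
    "\<forall>\<^sub>F m in sequentially. ennreal \<kappa> * (\<integral>\<^sup>+\<omega>. H m \<omega> \<partial>M)
      \<le> ennreal (4 ^ CARD('n) * (real K * t * ((LINT y|lborel. (norm (b y))\<^sup>2) + 1)))"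
    "\<And>\<omega> X s W. \<lbrakk>continuous_on {0..s} X;
      \<And>r. 0 \<le> r \<Longrightarrow> r \<le> s \<Longrightarrow> X r = x + B r \<omega> + integral {0..r} (\<lambda>r. b (X r)); X 0 = x;
      t \<le> s; s \<le> real K * t; \<And>r. 0 \<le> r \<Longrightarrow> r \<le> t \<Longrightarrow> a (X r) = b (X r);
      \<And>r. 0 \<le> r \<Longrightarrow> r \<le> s \<Longrightarrow> norm (X r) + 1 < R;
      \<And>r. 0 \<le> r \<Longrightarrow> r \<le> s \<Longrightarrow> norm (B r \<omega>) \<le> W\<rbrakk> \<Longrightarrow>
      \<forall>\<^sub>F m in sequentially. norm (X s) \<le> 3 + norm (X t) + 2 * W + s + H m \<omega>"
proof -
  interpret brownian_motion M B by (rule bm)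
  obtain c \<psi> V L C LV r \<Lambda> A where tf: "truncated_field b c \<psi> V L C LV"
    and \<psi>01: "\<And>y. 0 \<le> \<psi> y" "\<And>y. \<psi> y \<le> 1" "\<And>y. norm y < R \<Longrightarrow> \<psi> y = 1"
    and V0: "\<And>y. norm y < R \<Longrightarrow> V y = 0" and r: "\<And>x. r < norm x \<Longrightarrow> \<psi> x = 0"
    and \<Lambda>: "0 \<le> \<Lambda>" "\<And>x y. \<bar>\<psi> x * (norm (b x))\<^sup>2 - \<psi> y * (norm (b y))\<^sup>2\<bar> \<le> \<Lambda> * norm (x - y)"
    and A: "\<And>x. \<psi> x * (norm (b x))\<^sup>2 \<le> A"
    using truncation_exists[OF lip div, of R] by blast
  interpret truncated_field b c \<psi> V L C LV by (rule tf)
  define g where "g y = \<psi> y * (norm (b y))\<^sup>2" for y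
  have g: "\<And>x. 0 \<le> g x" "\<And>x. g x \<le> A" "\<And>x y. \<bar>g x - g y\<bar> \<le> \<Lambda> * norm (x - y)"
      "\<And>x. x \<notin> cball 0 r \<Longrightarrow> g x = 0"
    using \<psi>01 \<Lambda> A r by (auto simp: g_def)
  define H where "H m \<omega> = occupation (t / real m) a c V g x m (K * m) (increment B (t / real m) \<omega>)" for m \<omega>
  have gc: "continuous_on UNIV g" by (rule lipschitz_continuous_on[of g \<Lambda>]) (use g(3) in simp)
  have "(LINT y|lborel. g y) \<le> (LINT y|lborel. (norm (b y))\<^sup>2)"
  proof (rule integral_mono)
    show "integrable lborel g" by (rule integrable_continuous_zero_outside_cball[OF gc g(4)])
    show "integrable lborel (\<lambda>y. (norm (b y))\<^sup>2)" by (rule in_L2_integrable[OF L2])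
    show "g y \<le> (norm (b y))\<^sup>2" for y
      using \<psi>01(1,2)[of y] by (auto simp: g_def intro: mult_left_le_one_le)
  qed
  then have "4 ^ CARD('n) * (real K * t * ((LINT y|lborel. g y) + 1)) \<le>
      4 ^ CARD('n) * (real K * t * ((LINT y|lborel. (norm (b y))\<^sup>2) + 1))"
    using t by (intro mult_left_mono) auto
  note le = ennreal_leI[OF this]
  show thesis
  proof (rule that[of H])
    show "H m \<in> borel_measurable M" for m
      unfolding H_def increment_def
    proof (intro measurable_occupation)
      show "(\<lambda>\<omega>. B (real (Suc i) * (t / real m)) \<omega> - B (real i * (t / real m)) \<omega>) \<in> borel_measurable M" for i
        using t by (intro borel_measurable_diff measurable_B) auto
    qed (auto intro!: borel_measurable_continuous_onI lipschitz_continuous_on[OF a] c_cont V_cont gc)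
    show "\<forall>\<^sub>F m in sequentially. ennreal \<kappa> * (\<integral>\<^sup>+\<omega>. H m \<omega> \<partial>M)
      \<le> ennreal (4 ^ CARD('n) * (real K * t * ((LINT y|lborel. (norm (b y))\<^sup>2) + 1)))"
    proof (rule eventually_mono)
      show "\<forall>\<^sub>F m in sequentially. ennreal \<kappa> * (\<integral>\<^sup>+\<omega>. H m \<omega> \<partial>M)
          \<le> ennreal (4 ^ CARD('n) * (real K * t * ((LINT y|lborel. g y) + 1)))"
        unfolding H_def
        by (rule expectation_occupation_le[OF bm g(1,2,3) _ \<Lambda>(1) a La t \<kappa>]) (rule g(4))
    qed (rule order_trans[OF _ le])
    fix \<omega> X s W
    assume X: "continuous_on {0..s} X"
      "\<And>r. 0 \<le> r \<Longrightarrow> r \<le> s \<Longrightarrow> X r = x + B r \<omega> + integral {0..r} (\<lambda>r. b (X r))" "X 0 = x"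
      and s: "t \<le> s" "s \<le> real K * t" and aX: "\<And>r. 0 \<le> r \<Longrightarrow> r \<le> t \<Longrightarrow> a (X r) = b (X r)"
      and R: "\<And>r. 0 \<le> r \<Longrightarrow> r \<le> s \<Longrightarrow> norm (X r) + 1 < R"
      and W: "\<And>r. 0 \<le> r \<Longrightarrow> r \<le> s \<Longrightarrow> norm (B r \<omega>) \<le> W"
    show "\<forall>\<^sub>F m in sequentially. norm (X s) \<le> 3 + norm (X t) + 2 * W + s + H m \<omega>"
      unfolding H_def increment_def
      by (rule norm_solution_le_occupation[where R = R, OF X t(1) s a La aX R _ V0 _ g(1,2) W])
        (auto simp: c_def g_def \<psi>01)
  qed
qed

section \<open>Excluding explosion\<close>

lemma ennreal_le_divide_of_cmult_le:
  assumes "0 < \<kappa>" "ennreal \<kappa> * a \<le> ennreal C"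
  shows "a \<le> ennreal (C / \<kappa>)"
proof -
  have "a = ennreal (1 / \<kappa>) * (ennreal \<kappa> * a)"
    using assms(1) by (simp add: mult.assoc[symmetric] ennreal_mult'[symmetric])
  also have "\<dots> \<le> ennreal (1 / \<kappa>) * ennreal C"
    by (rule mult_left_mono[OF assms(2)]) simp
  also have "\<dots> = ennreal (C / \<kappa>)"
    using assms(1) by (simp add: ennreal_mult'[symmetric])
  finally show ?thesis .
qed

lemma no_explosion_of_bounded:
  fixes X :: "real \<Rightarrow> real ^ 'n"
  assumes lim: "filterlim (\<lambda>s. norm (X s)) at_top (at_left z)"
    and bd: "\<And>s. t \<le> s \<Longrightarrow> s < z \<Longrightarrow> norm (X s) \<le> D" and t: "t < z"
  shows False
proof -
  have "\<forall>\<^sub>F s in at_left z. D < norm (X s)"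
    using lim by (simp add: filterlim_at_top_dense)
  moreover have "\<forall>\<^sub>F s in at_left z. s \<in> {t<..<z}"
    using t by (rule eventually_at_left_real)
  ultimately have "\<forall>\<^sub>F s in at_left z. False"
  proof eventually_elim
    case (elim s)
    then show ?case using bd[of s] by simp
  qed
  then show False by (simp add: trivial_limit_at_left_real)
qed

text \<open>On a path that stays in the unit ball about \<open>x\<close> up to time \<open>t\<close>
  the fields \<open>a\<close> and \<open>b\<close> agree, so the dominating functionals apply for
  every \<open>R\<close> beyond the size of the path on [0, s]. Their double liminf
  \<open>\<Phi>\<close> has finite expectation by Fatou, since the bound \<open>E\<close> is free of
  \<open>R\<close>; hence it is almost surely finite, and it bounds |X| between \<open>t\<close> and
  the explosion time. Only \<open>\<Phi>\<close>, a functional of the noise, is integrated.\<close>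

lemma no_explosion_while_near_start:
  fixes b a :: "real ^ 'n \<Rightarrow> real ^ 'n" and B :: "real \<Rightarrow> 'a \<Rightarrow> real ^ 'n" and K :: nat
  assumes lip: "locally_lipschitz b" and div: "divergence_free b" and L2: "in_Lp 2 b"
    and bm: "brownian_motion M B" and sol: "strong_solution M B b x X \<zeta>"
    and a: "\<And>x y. norm (a x - a y) \<le> La * norm (x - y)" and La: "0 \<le> La"
    and ab: "\<And>y. y \<in> cball x 1 \<Longrightarrow> a y = b y"
    and t: "0 < t" "3 * (t * La) \<le> 1"
  shows "AE \<omega> in M. \<not> ((\<forall>r. 0 \<le> r \<and> r \<le> t \<longrightarrow> X r \<omega> \<in> cball x 1) \<and> ereal t < \<zeta> \<omega> \<and> \<zeta> \<omega> \<le> ereal (real K * t))"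
proof -
  interpret brownian_motion M B by (rule bm)
  obtain \<kappa> where \<kappa>: "0 < \<kappa>" "\<And>S :: real ^ 'n. ennreal \<kappa> \<le> (\<integral>\<^sup>+z. ennreal (gauss_shift t z S) \<partial>lborel)"
    using gauss_shift_average[OF t(1)] by metis
  define E where "E = 4 ^ CARD('n) * (real K * t * ((LINT y|lborel. (norm (b y))\<^sup>2) + 1)) / \<kappa>"
  \<comment> \<open>Packs the conclusions of \<open>dominating_functional\<close> into one
    predicate, so that an \<open>H\<close> can be chosen for every \<open>R\<close>.\<close>
  define dominating where "dominating R H \<longleftrightarrow> (\<forall>m. H m \<in> borel_measurable M) \<and>
      (\<forall>\<^sub>F m in sequentially. (\<integral>\<^sup>+\<omega>. ennreal (H m \<omega>) \<partial>M) \<le> ennreal E) \<and>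
      (\<forall>\<omega> Y s W. continuous_on {0..s} Y \<longrightarrow>
        (\<forall>r. 0 \<le> r \<longrightarrow> r \<le> s \<longrightarrow> Y r = x + B r \<omega> + integral {0..r} (\<lambda>r. b (Y r))) \<longrightarrow> Y 0 = x \<longrightarrow>
        t \<le> s \<longrightarrow> s \<le> real K * t \<longrightarrow> (\<forall>r. 0 \<le> r \<longrightarrow> r \<le> t \<longrightarrow> a (Y r) = b (Y r)) \<longrightarrow>
        (\<forall>r. 0 \<le> r \<longrightarrow> r \<le> s \<longrightarrow> norm (Y r) + 1 < real R) \<longrightarrow>
        (\<forall>r. 0 \<le> r \<longrightarrow> r \<le> s \<longrightarrow> norm (B r \<omega>) \<le> W) \<longrightarrow>
        (\<forall>\<^sub>F m in sequentially. norm (Y s) \<le> 3 + norm (Y t) + 2 * W + s + H m \<omega>))"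
    for R :: nat and H :: "nat \<Rightarrow> 'a \<Rightarrow> real"
  have "\<exists>H. dominating R H" for R
  proof (rule dominating_functional[OF lip div L2 bm a La t \<kappa>(2), where R = "real R" and K = K and x = x])
    fix H :: "nat \<Rightarrow> 'a \<Rightarrow> real"
    assume H: "\<And>m. H m \<in> borel_measurable M"
      "\<forall>\<^sub>F m in sequentially. ennreal \<kappa> * (\<integral>\<^sup>+\<omega>. H m \<omega> \<partial>M)
        \<le> ennreal (4 ^ CARD('n) * (real K * t * ((LINT y|lborel. (norm (b y))\<^sup>2) + 1)))"
      and dom: "\<And>\<omega> Y s W. \<lbrakk>continuous_on {0..s} Y;
        \<And>r. 0 \<le> r \<Longrightarrow> r \<le> s \<Longrightarrow> Y r = x + B r \<omega> + integral {0..r} (\<lambda>r. b (Y r)); Y 0 = x;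
        t \<le> s; s \<le> real K * t; \<And>r. 0 \<le> r \<Longrightarrow> r \<le> t \<Longrightarrow> a (Y r) = b (Y r);
        \<And>r. 0 \<le> r \<Longrightarrow> r \<le> s \<Longrightarrow> norm (Y r) + 1 < real R;
        \<And>r. 0 \<le> r \<Longrightarrow> r \<le> s \<Longrightarrow> norm (B r \<omega>) \<le> W\<rbrakk> \<Longrightarrow>
        \<forall>\<^sub>F m in sequentially. norm (Y s) \<le> 3 + norm (Y t) + 2 * W + s + H m \<omega>"
    have "\<forall>\<^sub>F m in sequentially. (\<integral>\<^sup>+\<omega>. H m \<omega> \<partial>M) \<le> ennreal E"
      using H(2) unfolding E_def by (rule eventually_mono) (rule ennreal_le_divide_of_cmult_le[OF \<kappa>(1)])
    then have "dominating R H"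
      unfolding dominating_def by (intro conjI allI impI H(1) dom) simp_all
    then show "\<exists>H. dominating R H" by blast
  qed
  then obtain H where H: "\<And>R. dominating R (H R)" by metis
  have [measurable]: "H R m \<in> borel_measurable M" for R m
    using H[of R] by (simp add: dominating_def)
  have EH: "\<forall>\<^sub>F m in sequentially. (\<integral>\<^sup>+\<omega>. H R m \<omega> \<partial>M) \<le> ennreal E" for R
    using H[of R] by (simp add: dominating_def)
  \<comment> \<open>The order matters: \<open>R\<close> first has to exceed the path on [0, s], and
    the threshold for \<open>m\<close> depends on \<open>R\<close>.\<close>
  define \<Phi> where "\<Phi> \<omega> = liminf (\<lambda>R. liminf (\<lambda>m. ennreal (H R m \<omega>)))" for \<omega>
  have "(\<integral>\<^sup>+\<omega>. \<Phi> \<omega> \<partial>M) \<le> liminf (\<lambda>R. \<integral>\<^sup>+\<omega>. liminf (\<lambda>m. ennreal (H R m \<omega>)) \<partial>M)"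
    unfolding \<Phi>_def by (intro nn_integral_liminf) measurable
  also have "\<dots> \<le> liminf (\<lambda>R :: nat. ennreal E)"
  proof (intro Liminf_mono always_eventually allI)
    fix R
    have "(\<integral>\<^sup>+\<omega>. liminf (\<lambda>m. ennreal (H R m \<omega>)) \<partial>M) \<le> liminf (\<lambda>m. \<integral>\<^sup>+\<omega>. H R m \<omega> \<partial>M)"
      by (intro nn_integral_liminf) measurable
    also have "\<dots> \<le> liminf (\<lambda>m :: nat. ennreal E)" by (rule Liminf_mono[OF EH])
    finally show "(\<integral>\<^sup>+\<omega>. liminf (\<lambda>m. ennreal (H R m \<omega>)) \<partial>M) \<le> ennreal E" by (simp add: Liminf_const)
  qed
  finally have "(\<integral>\<^sup>+\<omega>. \<Phi> \<omega> \<partial>M) \<le> ennreal E" by (simp add: Liminf_const)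
  then have "(\<integral>\<^sup>+\<omega>. \<Phi> \<omega> \<partial>M) \<noteq> \<infinity>" by (auto simp: top_unique)
  moreover have "\<Phi> \<in> borel_measurable M" unfolding \<Phi>_def by measurable
  ultimately have "AE \<omega> in M. \<Phi> \<omega> \<noteq> \<infinity>" by (intro nn_integral_PInf_AE)
  moreover have "AE \<omega> in M. 0 < \<zeta> \<omega> \<and> X 0 \<omega> = x \<and>
        continuous_on {t. 0 \<le> t \<and> ereal t < \<zeta> \<omega>} (\<lambda>t. X t \<omega>) \<and>
        (\<forall>t. 0 \<le> t \<and> ereal t < \<zeta> \<omega> \<longrightarrow> X t \<omega> = x + B t \<omega> + integral {0..t} (\<lambda>s. b (X s \<omega>))) \<and>
        (\<zeta> \<omega> < \<infinity> \<longrightarrow> filterlim (\<lambda>t. norm (X t \<omega>)) at_top (at_left (real_of_ereal (\<zeta> \<omega>))))"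
    using sol unfolding strong_solution_def by blast
  ultimately show ?thesis
    using continuous_paths
  proof eventually_elim
    case (elim \<omega>)
    note fin = elim(1)
    have X0: "X 0 \<omega> = x" and Xc: "continuous_on {t. 0 \<le> t \<and> ereal t < \<zeta> \<omega>} (\<lambda>t. X t \<omega>)"
      and Xi: "\<And>t. 0 \<le> t \<Longrightarrow> ereal t < \<zeta> \<omega> \<Longrightarrow> X t \<omega> = x + B t \<omega> + integral {0..t} (\<lambda>s. b (X s \<omega>))"
      and Xe: "\<zeta> \<omega> < \<infinity> \<Longrightarrow> filterlim (\<lambda>t. norm (X t \<omega>)) at_top (at_left (real_of_ereal (\<zeta> \<omega>)))"
      using elim(2) by blast+
    show ?case
    proof
      assume *: "(\<forall>r. 0 \<le> r \<and> r \<le> t \<longrightarrow> X r \<omega> \<in> cball x 1) \<and> ereal t < \<zeta> \<omega> \<and> \<zeta> \<omega> \<le> ereal (real K * t)"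
      then obtain z where z: "\<zeta> \<omega> = ereal z" "t < z" "z \<le> real K * t"
        by (cases "\<zeta> \<omega>") auto
      \<comment> \<open>The Brownian path is bounded on the closed interval up to the supposed
        explosion time \<open>z\<close>, so \<open>c0\<close> does not depend on
        \<open>s\<close>.\<close>
      have "bounded ((\<lambda>t. B t \<omega>) ` {0..z})"
        by (intro compact_imp_bounded compact_continuous_image continuous_on_subset[OF elim(3)]) auto
      then obtain W where "\<forall>v\<in>(\<lambda>t. B t \<omega>) ` {0..z}. norm v \<le> W"
        unfolding bounded_iff by blast
      then have W: "norm (B r \<omega>) \<le> W" if "0 \<le> r" "r \<le> z" for r using that by simp
      define c0 where "c0 = 3 + norm (X t \<omega>) + 2 * W + z"
      have "norm (X s \<omega>) \<le> c0 + enn2real (\<Phi> \<omega>)" if s: "t \<le> s" "s < z" for s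
      proof -
        have Xs: "continuous_on {0..s} (\<lambda>r. X r \<omega>)"
          by (rule continuous_on_subset[OF Xc]) (use s z in auto)
        have "bounded ((\<lambda>r. X r \<omega>) ` {0..s})"
          by (intro compact_imp_bounded compact_continuous_image Xs) auto
        then obtain R0 where "\<forall>v\<in>(\<lambda>r. X r \<omega>) ` {0..s}. norm v \<le> R0"
          unfolding bounded_iff by blast
        then have R0: "norm (X r \<omega>) \<le> R0" if "0 \<le> r" "r \<le> s" for r using that by simp
        have "\<forall>\<^sub>F R in sequentially. R0 + 1 < real R" by real_asymp
        then have "\<forall>\<^sub>F R in sequentially. ennreal (norm (X s \<omega>) - c0) \<le> liminf (\<lambda>m. ennreal (H R m \<omega>))"
        proof eventually_elim
          case (elim R)
          have "\<forall>\<^sub>F m in sequentially. norm (X s \<omega>) \<le> 3 + norm (X t \<omega>) + 2 * W + s + H R m \<omega>"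
          proof -
            have "X r \<omega> = x + B r \<omega> + integral {0..r} (\<lambda>r. b (X r \<omega>))" if "0 \<le> r" "r \<le> s" for r
              using that s z by (intro Xi) auto
            moreover have "a (X r \<omega>) = b (X r \<omega>)" if "0 \<le> r" "r \<le> t" for r
              using that * by (intro ab) auto
            moreover have "norm (X r \<omega>) + 1 < real R" if "0 \<le> r" "r \<le> s" for r
              using R0[OF that] elim by simp
            moreover have "norm (B r \<omega>) \<le> W" if "0 \<le> r" "r \<le> s" for r
              using that s by (intro W) auto
            moreover have "s \<le> real K * t" using s z by simp
            ultimately show ?thesis
              using H[of R, unfolded dominating_def, THEN conjunct2, THEN conjunct2, rule_format,
                  of s "\<lambda>r. X r \<omega>" \<omega> W] Xs X0 s(1) by blast
          qed
          then have "\<forall>\<^sub>F m in sequentially. ennreal (norm (X s \<omega>) - c0) \<le> ennreal (H R m \<omega>)"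
            by (rule eventually_mono) (use s in \<open>auto simp: c0_def intro!: ennreal_leI\<close>)
          then show ?case by (rule Liminf_bounded)
        qed
        then have "ennreal (norm (X s \<omega>) - c0) \<le> \<Phi> \<omega>"
          unfolding \<Phi>_def by (rule Liminf_bounded)
        also have "\<Phi> \<omega> = ennreal (enn2real (\<Phi> \<omega>))" using fin by (simp add: less_top)
        \<comment> \<open>\<open>ennreal\<close> sends a negative difference to 0; in that case the
          claim follows from the nonnegativity of \<open>enn2real\<close>.\<close>
        finally show ?thesis
          using enn2real_nonneg[of "\<Phi> \<omega>"] by (auto simp: ennreal_le_iff2)
      qed
      moreover have "filterlim (\<lambda>s. norm (X s \<omega>)) at_top (at_left z)"
        using Xe z by simp
      ultimately show False
        using z(2) by (intro no_explosion_of_bounded[of "\<lambda>s. X s \<omega>" z t]) auto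
    qed
  qed
qed

theorem corollary3:
  fixes b :: "real ^ 'n \<Rightarrow> real ^ 'n" and q :: ereal
    and M :: "'a measure" and B :: "real \<Rightarrow> 'a \<Rightarrow> real ^ 'n"
  assumes dim: "CARD('n) \<ge> 3"
    and lipschitz: "locally_lipschitz b"
    and div_free: "divergence_free b"
    and q: "q > ereal (real CARD('n) / 2)"
    and Lq: "in_Lp q b" and L2: "in_Lp 2 b"
    and bm: "brownian_motion M B"
  shows "\<forall>x X \<zeta>. strong_solution M B b x X \<zeta> \<longrightarrow> conservative M \<zeta>"
proof (intro allI impI)
  fix x X \<zeta> assume sol: "strong_solution M B b x X \<zeta>"
  \<comment> \<open>Composing with the projection onto the unit ball, a contraction, makes the
    Lipschitz bound on that ball global.\<close>
  define a where "a y = b (closest_point (cball x 1) y)" for y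
  obtain La where La: "0 \<le> La" "\<And>y z. y \<in> cball x 1 \<Longrightarrow> z \<in> cball x 1 \<Longrightarrow> norm (b y - b z) \<le> La * norm (y - z)"
    using locally_lipschitz_on_cball[OF lipschitz, of x 1] by blast
  have cp: "closest_point (cball x 1) y \<in> cball x 1" for y
    by (rule closest_point_in_set) auto
  have a: "norm (a y - a z) \<le> La * norm (y - z)" for y z
  proof -
    have "norm (a y - a z) \<le> La * norm (closest_point (cball x 1) y - closest_point (cball x 1) z)"
      unfolding a_def by (rule La(2)[OF cp cp])
    also have "\<dots> \<le> La * norm (y - z)"
      using closest_point_lipschitz[of "cball x 1" y z] La(1)
      by (intro mult_left_mono) (auto simp: dist_norm)
    finally show ?thesis .
  qed
  have ab: "a y = b y" if "y \<in> cball x 1" for y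
    using that by (simp add: a_def closest_point_self)
  \<comment> \<open>How long the path stays near \<open>x\<close> depends on \<omega>, while
    \<open>no_explosion_while_near_start\<close> needs a fixed time. A sequence tending to 0 costs
    only countably many null sets. The factor 3 (La + 1) ensures 3 t La \<le> 1 and is positive also
    for La = 0.\<close>
  define t where "t j = 1 / (real (Suc j) * (3 * (La + 1)))" for j
  have t: "0 < t j" "3 * (t j * La) \<le> 1" for j
  proof -
    have pos: "0 < real (Suc j) * (3 * (La + 1))" using La(1) by simp
    then show "0 < t j" by (simp add: t_def)
    have "3 * La \<le> 1 * (3 * (La + 1))" by simp
    also have "\<dots> \<le> real (Suc j) * (3 * (La + 1))" using La(1) by (intro mult_right_mono) auto
    finally show "3 * (t j * La) \<le> 1" using pos by (simp add: t_def divide_le_eq)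
  qed
  have "AE \<omega> in M. \<forall>j K. \<not> ((\<forall>r. 0 \<le> r \<and> r \<le> t j \<longrightarrow> X r \<omega> \<in> cball x 1) \<and> ereal (t j) < \<zeta> \<omega> \<and> \<zeta> \<omega> \<le> ereal (real K * t j))"
    by (intro AE_all_countable[THEN iffD2] allI no_explosion_while_near_start[OF lipschitz div_free L2 bm sol a La(1) ab t])
  moreover have "AE \<omega> in M. 0 < \<zeta> \<omega> \<and> X 0 \<omega> = x \<and> continuous_on {t. 0 \<le> t \<and> ereal t < \<zeta> \<omega>} (\<lambda>t. X t \<omega>)"
    using sol unfolding strong_solution_def by (auto elim: eventually_mono)
  ultimately show "conservative M \<zeta>"
    unfolding conservative_def
  proof eventually_elim
    case (elim \<omega>)
    show "\<zeta> \<omega> = \<infinity>"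
    proof (rule ccontr)
      assume "\<zeta> \<omega> \<noteq> \<infinity>"
      then obtain z where z: "\<zeta> \<omega> = ereal z" "0 < z" using elim(2) by (cases "\<zeta> \<omega>") auto
      have "continuous_on {t. 0 \<le> t \<and> ereal t < \<zeta> \<omega>} (\<lambda>t. X t \<omega>)" "0 \<in> {t. 0 \<le> t \<and> ereal t < \<zeta> \<omega>}"
        using elim(2) by (auto simp: zero_ereal_def)
      then obtain e where e: "0 < e" "\<And>r. 0 \<le> r \<Longrightarrow> ereal r < \<zeta> \<omega> \<Longrightarrow> dist r 0 < e \<Longrightarrow> dist (X r \<omega>) (X 0 \<omega>) < 1"
        unfolding continuous_on_iff using zero_less_one by blast
      \<comment> \<open>For this \<omega>, a \<open>t j\<close> below \<open>e\<close> keeps the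
        path in the unit ball by continuity at 0, and a \<open>t j\<close> below \<open>z\<close>
        lies before the explosion.\<close>
      have "\<forall>\<^sub>F j in sequentially. t j < min e z"
        unfolding t_def using e(1) z(2) La(1) by real_asymp
      then obtain j where j: "t j < e" "t j < z"
        by (auto dest!: eventually_happens)
      obtain K :: nat where "z / t j \<le> real K" using real_arch_simple by blast
      then have "z \<le> real K * t j" using t(1)[of j] by (simp add: field_simps)
      moreover have "X r \<omega> \<in> cball x 1" if "0 \<le> r" "r \<le> t j" for r
        using e(2)[of r] that j z elim(2) by (auto simp: dist_commute intro: less_imp_le)
      ultimately show False using elim(1) z j by auto
    qed
  qed
qed

end
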